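(* Let $\mathbf{T}=\{(z,w)\in\mathbf{C}^2 : |z|<|w|<1\}$ be the Hartogs triangle. Then $H^{p,1}_{L^2,\overline\partial_s}(\mathbf{T})=0$ for $0\le p\le 2$.
   Context: $L^2_{p,q}(\mathbf{T})$ is the Hilbert space of $(p,q)$-forms on $\mathbf{T}$ with square-integrable coefficients, and $C^\infty_{p,q}(\overline{\mathbf{T}})$ is the space of $(p,q)$-forms smooth up to the boundary (restrictions of smooth forms on $\mathbf{C}^2$). The strong maximal extension $\overline\partial_s$ on $(p,q)$-forms is the closure in the graph norm of $\overline\partial$ restricted to $C^\infty_{p,q}(\overline{\mathbf{T}})$; i.e. $f\in\mathrm{Dom}(\overline\partial_s)$ if and only if there is a sequence $f_\nu\in C^\infty_{p,q}(\overline{\mathbf{T}})$ with $f_\nu\to f$ and $\overline\partial f_\nu\to\overline\partial f$ in $L^2$, and then $\overline\partial_s f=\overline\partial f$. The $L^2$ Dolbeault cohomology groups with respect to $\overline\partial_s$ are $$H^{p,q}_{L^2,\overline\partial_s}(\mathbf{T})=\frac{\{f\in L^2_{p,q}(\mathbf{T}) : f\in\mathrm{Dom}(\overline\partial_s),\ \overline\partial_s f=0\}}{\{f\in L^2_{p,q}(\mathbf{T}) : f=\overline\partial_s u\text{ for some }u\in L^2_{p,q-1}(\mathbf{T})\cap\mathrm{Dom}(\overline\partial_s)\}}.$$ *)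

theory Defs
  imports "HOL-Analysis.Analysis"
begin

primrec higher_differentiable ::
  "('a::real_normed_vector \<Rightarrow> 'b::real_normed_vector) \<Rightarrow> nat \<Rightarrow> bool" where
  "higher_differentiable f 0 \<longleftrightarrow> continuous_on UNIV f"
| "higher_differentiable f (Suc n) \<longleftrightarrow>
     (\<forall>x. f differentiable (at x)) \<and>
     (\<forall>v. higher_differentiable (\<lambda>x. frechet_derivative f (at x) v) n)"

definition smooth :: "('a::real_normed_vector \<Rightarrow> 'b::real_normed_vector) \<Rightarrow> bool" where
  "smooth f \<longleftrightarrow> (\<forall>n. higher_differentiable f n)"

definition hartogs_triangle :: "(complex \<times> complex) set" where
  "hartogs_triangle = {(z, w). cmod z < cmod w \<and> cmod w < 1}"

text \<open>
  A differential form on a subset of \<open>\<complex>\<^sup>2\<close> is given by its coefficients: \<open>f I J\<close> is the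
  coefficient function of \<open>dz\<^sub>I \<and> d\<bar>z\<^sub>J\<close>, where \<open>I, J \<subseteq> {1, 2}\<close> are multi-indices written
  in increasing order.  The functions are total; only their values on the domain under
  consideration matter.
\<close>

type_synonym form = "nat set \<Rightarrow> nat set \<Rightarrow> complex \<times> complex \<Rightarrow> complex"

definition zero_form :: form where
  "zero_form = (\<lambda>I J x. 0)"

text \<open>
  Bidegrees are integers, so that the forms of bidegree \<open>(p, -1)\<close> exist and are all zero.
\<close>

definition multi_indices :: "int \<Rightarrow> nat set set" where
  "multi_indices p = {I. I \<subseteq> {1, 2} \<and> int (card I) = p}"

definition forms :: "int \<Rightarrow> int \<Rightarrow> form set" where
  "forms p q = {f. \<forall>I J. \<not> (I \<in> multi_indices p \<and> J \<in> multi_indices q) \<longrightarrow> f I J = (\<lambda>x. 0)}"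

definition smooth_forms :: "int \<Rightarrow> int \<Rightarrow> form set" where
  "smooth_forms p q = {f \<in> forms p q. \<forall>I J. smooth (f I J)}"

definition coord_vec :: "nat \<Rightarrow> complex \<Rightarrow> complex \<times> complex" where
  "coord_vec k c = (if k = 1 then (c, 0) else (0, c))"

text \<open>The Wirtinger derivative \<open>\<partial>/\<partial>\<bar>z\<^sub>k = 1/2 (\<partial>/\<partial>x\<^sub>k + i \<partial>/\<partial>y\<^sub>k)\<close>.\<close>

definition wirtinger_bar ::
  "nat \<Rightarrow> (complex \<times> complex \<Rightarrow> complex) \<Rightarrow> complex \<times> complex \<Rightarrow> complex" where
  "wirtinger_bar k h x =
     (frechet_derivative h (at x) (coord_vec k 1)
      + \<i> * frechet_derivative h (at x) (coord_vec k \<i>)) / 2"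

text \<open>
  The sign comes from
  \<open>d\<bar>z\<^sub>k \<and> dz\<^sub>I \<and> d\<bar>z\<^sub>L = (-1)\<^bsup>|I| + |{j \<in> L. j < k}|\<^esup> dz\<^sub>I \<and> d\<bar>z\<^sub>J\<close> with \<open>L = J - {k}\<close>.
\<close>

definition dbar :: "form \<Rightarrow> form" where
  "dbar f = (\<lambda>I J x. \<Sum>k\<in>J \<inter> {1, 2}.
     (-1) ^ (card I + card {j \<in> J. j < k}) * wirtinger_bar k (f I (J - {k})) x)"

text \<open>
  Elements of \<open>L\<^sup>2\<close> are represented by functions, without identifying those that agree almost
  everywhere; \<open>dbar_s\<close> below is invariant under changing either form on a null set.
\<close>

definition L2_forms :: "(complex \<times> complex) set \<Rightarrow> int \<Rightarrow> int \<Rightarrow> form set" where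
  "L2_forms \<Omega> p q = {f \<in> forms p q. \<forall>I J.
     f I J \<in> borel_measurable (lebesgue_on \<Omega>) \<and>
     integrable (lebesgue_on \<Omega>) (\<lambda>x. (cmod (f I J x))\<^sup>2)}"

definition L2_norm :: "(complex \<times> complex) set \<Rightarrow> form \<Rightarrow> real" where
  "L2_norm \<Omega> f =
     sqrt (\<Sum>I\<in>Pow {1, 2}. \<Sum>J\<in>Pow {1, 2}. LINT x|lebesgue_on \<Omega>. (cmod (f I J x))\<^sup>2)"

text \<open>
  \<open>dbar_s \<Omega> p q f g\<close> says that \<open>f\<close> is in the domain of the strong maximal extension on
  \<open>(p, q)\<close>-forms and that its value there is \<open>g\<close>: the pair lies in the closure of the graph of
  \<open>dbar\<close> on forms smooth up to the boundary.  Such a \<open>g\<close> is \<open>dbar f\<close> in the sense of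
  distributions, hence unique up to null sets.  The forms \<open>F n\<close> live on all of \<open>\<complex>\<^sup>2\<close>; their
  restrictions to \<open>\<Omega>\<close> are the forms smooth up to the boundary, and for bounded \<open>\<Omega>\<close> all the
  integrals below are finite.
\<close>

definition dbar_s :: "(complex \<times> complex) set \<Rightarrow> int \<Rightarrow> int \<Rightarrow> form \<Rightarrow> form \<Rightarrow> bool" where
  "dbar_s \<Omega> p q f g \<longleftrightarrow>
     f \<in> L2_forms \<Omega> p q \<and> g \<in> L2_forms \<Omega> p (q + 1) \<and>
     (\<exists>F. (\<forall>n. F n \<in> smooth_forms p q) \<and>
          (\<lambda>n. L2_norm \<Omega> (F n - f)) \<longlonglongrightarrow> 0 \<and>
          (\<lambda>n. L2_norm \<Omega> (dbar (F n) - g)) \<longlonglongrightarrow> 0)"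

definition dbar_s_kernel :: "(complex \<times> complex) set \<Rightarrow> int \<Rightarrow> int \<Rightarrow> form set" where
  "dbar_s_kernel \<Omega> p q = {f \<in> L2_forms \<Omega> p q. dbar_s \<Omega> p q f zero_form}"

definition dbar_s_range :: "(complex \<times> complex) set \<Rightarrow> int \<Rightarrow> int \<Rightarrow> form set" where
  "dbar_s_range \<Omega> p q = {f \<in> L2_forms \<Omega> p q. \<exists>u \<in> L2_forms \<Omega> p (q - 1). dbar_s \<Omega> p (q - 1) u f}"

definition cohomologous :: "(complex \<times> complex) set \<Rightarrow> int \<Rightarrow> int \<Rightarrow> (form \<times> form) set" where
  "cohomologous \<Omega> p q =
     {(f, g). f \<in> dbar_s_kernel \<Omega> p q \<and> g \<in> dbar_s_kernel \<Omega> p q \<and> f - g \<in> dbar_s_range \<Omega> p q}"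

definition L2_cohomology :: "(complex \<times> complex) set \<Rightarrow> int \<Rightarrow> int \<Rightarrow> form set set" where
  "L2_cohomology \<Omega> p q = dbar_s_kernel \<Omega> p q // cohomologous \<Omega> p q"

definition null_class :: "(complex \<times> complex) set \<Rightarrow> int \<Rightarrow> int \<Rightarrow> form set" where
  "null_class \<Omega> p q = cohomologous \<Omega> p q `` {zero_form}"

end

theory Submission
  imports Defs
begin

text \<open>
Write \<open>T\<close> for the Hartogs triangle and \<open>D\<close> for the unit disc.  The coefficients of \<open>dz\<^sub>I\<close> do not
interact, so the claim is that a \<open>(0, 1)\<close>-form \<open>f = f\<^sub>1 d\<bar>z + f\<^sub>2 d\<bar>w\<close> with \<open>dbar_s f = 0\<close> is \<open>dbar_s u\<close>
for a function \<open>u\<close>.  The form \<open>f\<close> comes with smooth forms \<open>F\<^sub>n \<rightarrow> f\<close> such that \<open>dbar F\<^sub>n \<rightarrow> 0\<close>, and it is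
enough to have linear operators \<open>K\<close> and \<open>E\<close>, bounded in \<open>L\<^sup>2(T)\<close>, such that
\<open>dbar (K F) = F - E (dbar F)\<close> on a dense class of smooth forms and such that \<open>K F\<close> lies in the domain of
\<open>dbar_s\<close>: then \<open>K F\<^sub>n\<close> is a Cauchy sequence, and its limit \<open>u\<close> satisfies \<open>dbar_s u = f\<close> because the graph
of \<open>dbar_s\<close> is closed (\<open>scalar_dbar_problem\<close>).

The dense class consists of the polynomials in \<open>z, \<bar>z, w, \<bar>w\<close>.  They approximate smooth functions together with
their first derivatives (\<open>weierstrass_C1_on_T\<close>, by convolution with Landau's polynomial kernels), and on
them the operators are explicit.  With \<open>\<zeta> = z / w\<close> the triangle becomes the product of \<open>D\<close> and the
punctured disc, and \<open>g \<mapsto> w g(\<zeta> w, w)\<close> is an isometry from \<open>L\<^sup>2(T)\<close> to \<open>L\<^sup>2(D \<times> D)\<close>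
(\<open>T_sq_isometry\<close>).  After multiplication by \<open>w\<close> the components of a polynomial form in the coordinates
\<open>(\<zeta>, w)\<close> are polynomials \<open>H\<^sub>1, H\<^sub>2\<close> on \<open>D \<times> D\<close>.  There the equation is solved by
\<open>U = S\<^sub>1 H\<^sub>1 + P\<^sub>1 S\<^sub>2 H\<^sub>2\<close>, where \<open>S\<^sub>k\<close> solves the one-dimensional equation in the \<open>k\<close>-th variable and
\<open>P\<^sub>1 = 1 - S\<^sub>1 \<partial>/\<partial>\<bar>\<zeta>\<close>; one computes \<open>\<partial>U/\<partial>\<bar>\<zeta> = H\<^sub>1\<close> and \<open>\<partial>U/\<partial>\<bar>w = H\<^sub>2 - S\<^sub>1 (\<partial>H\<^sub>2/\<partial>\<bar>\<zeta> - \<partial>H\<^sub>1/\<partial>\<bar>w)\<close>.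

The one-dimensional operator is \<open>S g = \<partial>v/\<partial>x\<close>, where \<open>v\<close> is the solution of
\<open>\<partial>\<^sup>2v/\<partial>x\<partial>\<bar>x = g\<close> that vanishes on the unit circle; on monomials \<open>v\<close> is given by a formula.  Integration by parts gives
\<open>\<parallel>S g\<parallel> \<le> 2 \<parallel>g\<parallel>\<close> (\<open>green_gradient_estimate\<close>) and shows that \<open>1 - S \<partial>/\<partial>\<bar>x\<close> is an orthogonal
projection (\<open>bergman_projection_estimate\<close>).

The function \<open>u = U(z / w, w) / w\<close> is a polynomial in \<open>z, \<bar>z, w, \<bar>w\<close> and negative powers of \<open>w\<close>
and \<open>\<bar>w\<close>, so the only obstacle to its being smooth up to the boundary is the origin, where
\<open>|u| \<le> C / |w|\<close>.  A logarithmic cut-off just suffices: multiplication by \<open>|w|\<^bsup>2t\<^esup>\<close>, regularised to a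
smooth function, changes the graph norm by an amount that tends to \<open>0\<close> with \<open>t\<close>
(\<open>solution_in_closure\<close>).
\<close>

type_synonym C2 = "complex \<times> complex"

section \<open>Lebesgue measure in the complex plane\<close>

text \<open>
The measures \<open>M\<close> and \<open>lborel\<close> enter symmetrically up to the sign of \<open>D\<close>: integrate
\<open>indicator A x * indicator D (y - x)\<close> in both orders and shift \<open>x\<close> by \<open>y\<close>.  For a symmetric \<open>D\<close> of finite positive
measure this says that \<open>M\<close> is a multiple of Lebesgue measure.
\<close>

lemma translation_invariant_measure_proportional:
  fixes M :: "'a::euclidean_space measure"
  assumes "sigma_finite_measure M" and M [measurable_cong, simp]: "sets M = sets borel"
    and invariant: "\<And>c. distr M borel ((+) c) = M"
    and A [measurable]: "A \<in> sets borel" and D [measurable]: "D \<in> sets borel"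
  shows "emeasure M A * emeasure lborel D = emeasure M (uminus -` D) * emeasure lborel A"
proof -
  interpret M: sigma_finite_measure M by fact
  interpret pair_sigma_finite M lborel ..
  have shift_M: "(\<integral>\<^sup>+x. f x \<partial>M) = (\<integral>\<^sup>+x. f (c + x) \<partial>M)" if [measurable]: "f \<in> borel_measurable borel" for f c
    by (subst invariant [symmetric, of c]) (simp add: nn_integral_distr)
  have shift_lborel: "(\<integral>\<^sup>+x. f x \<partial>lborel) = (\<integral>\<^sup>+x. f (c + x) \<partial>lborel)"
    if [measurable]: "f \<in> borel_measurable borel" for f and c :: 'a
    by (subst lborel_distr_plus [symmetric, of c]) (simp add: nn_integral_distr)
  have "emeasure M A * emeasure lborel D
      = (\<integral>\<^sup>+x. indicator A x * (\<integral>\<^sup>+y. indicator D y \<partial>lborel) \<partial>M)"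
    by (simp add: nn_integral_multc)
  also have "\<dots> = (\<integral>\<^sup>+x. (\<integral>\<^sup>+y. indicator A x * indicator D (y - x) \<partial>lborel) \<partial>M)"
  proof (rule nn_integral_cong)
    fix x
    show "indicator A x * (\<integral>\<^sup>+y. indicator D y \<partial>lborel)
        = (\<integral>\<^sup>+y. indicator A x * indicator D (y - x) \<partial>lborel)"
      by (subst shift_lborel [of _ "- x"]) (simp_all add: nn_integral_cmult)
  qed
  also have "\<dots> = (\<integral>\<^sup>+y. (\<integral>\<^sup>+x. indicator A x * indicator D (y - x) \<partial>M) \<partial>lborel)"
    by (rule Fubini' [symmetric]) measurable
  also have "\<dots> = (\<integral>\<^sup>+y. (\<integral>\<^sup>+x. indicator A (y + x) * indicator D (- x) \<partial>M) \<partial>lborel)"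
  proof (rule nn_integral_cong)
    fix y
    show "(\<integral>\<^sup>+x. indicator A x * indicator D (y - x) \<partial>M)
        = (\<integral>\<^sup>+x. indicator A (y + x) * indicator D (- x) \<partial>M)"
      by (subst shift_M [of _ y]) simp_all
  qed
  also have "\<dots> = (\<integral>\<^sup>+x. (\<integral>\<^sup>+y. indicator A (y + x) * indicator D (- x) \<partial>lborel) \<partial>M)"
    by (rule Fubini') measurable
  also have "\<dots> = (\<integral>\<^sup>+x. indicator (uminus -` D) x * emeasure lborel A \<partial>M)"
  proof (rule nn_integral_cong)
    fix x
    have "(\<integral>\<^sup>+y. indicator A (y + x) \<partial>lborel) = (\<integral>\<^sup>+y. indicator A y \<partial>lborel)"
      by (subst (2) shift_lborel [of _ x]) (simp_all add: add.commute)
    then show "(\<integral>\<^sup>+y. indicator A (y + x) * indicator D (- x) \<partial>lborel)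
        = indicator (uminus -` D) x * emeasure lborel A"
      by (subst nn_integral_multc) (auto simp: mult.commute indicator_vimage)
  qed
  also have "\<dots> = emeasure M (uminus -` D) * emeasure lborel A"
  proof -
    have "uminus -` D \<in> sets M"
      using measurable_sets_borel [of uminus borel D] by simp
    then show ?thesis by (simp add: nn_integral_multc)
  qed
  finally show ?thesis .
qed

lemma emeasure_complex_ball:
  assumes "0 \<le> r"
  shows "emeasure lborel (ball (c::complex) r) = ennreal (pi * r\<^sup>2)"
  using assms unit_ball_vol_2 by (simp add: emeasure_ball)

text \<open>
Multiplication by a complex number preserves translation invariance, so it can only multiply
Lebesgue measure by a constant; the constant is read off from the unit disc.
\<close>

lemma nn_integral_complex_divide:
  assumes w: "w \<noteq> (0::complex)" and [measurable]: "f \<in> borel_measurable borel"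
  shows "(\<integral>\<^sup>+z. f (z / w) \<partial>lborel) = ennreal ((cmod w)\<^sup>2) * (\<integral>\<^sup>+z. f z \<partial>lborel)"
proof -
  define M where "M = distr lborel borel (\<lambda>z. z / w)"
  have M [simp, measurable_cong]: "sets M = sets borel" by (simp add: M_def)
  have M_vimage: "emeasure M A = emeasure lborel ((\<lambda>z. z / w) -` A)" if "A \<in> sets borel" for A
    unfolding M_def using that by (subst emeasure_distr) auto
  have M_ball: "emeasure M (ball 0 r) = ennreal (pi * (r * cmod w)\<^sup>2)" if "r \<ge> 0" for r
  proof -
    have "(\<lambda>z. z / w) -` ball 0 r = ball 0 (r * cmod w)"
      using w by (auto simp: norm_divide divide_simps)
    then show ?thesis using that by (simp add: M_vimage emeasure_complex_ball)
  qed
  have "sigma_finite_measure M"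
  proof
    show "\<exists>A. countable A \<and> A \<subseteq> sets M \<and> \<Union> A = space M \<and> (\<forall>a\<in>A. emeasure M a \<noteq> \<infinity>)"
    proof (intro exI conjI)
      show "countable (range (\<lambda>n. ball (0::complex) (real n)))" by simp
      show "range (\<lambda>n. ball (0::complex) (real n)) \<subseteq> sets M" by auto
      show "\<Union> (range (\<lambda>n. ball (0::complex) (real n))) = space M"
        using sets_eq_imp_space_eq [OF M] by (auto simp: reals_Archimedean2)
      show "\<forall>a\<in>range (\<lambda>n. ball (0::complex) (real n)). emeasure M a \<noteq> \<infinity>"
        by (auto simp: M_ball)
    qed
  qed
  moreover have "distr M borel ((+) c) = M" for c
  proof -
    have "distr M borel ((+) c) = distr lborel borel (\<lambda>z. (c * w + z) / w)"
      unfolding M_def using w by (subst distr_distr) (auto simp: o_def field_simps)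
    also have "\<dots> = distr (distr lborel borel ((+) (c * w))) borel (\<lambda>z. z / w)"
      by (subst distr_distr) (auto simp: o_def)
    finally show ?thesis by (simp add: M_def lborel_distr_plus)
  qed
  ultimately have proportional: "emeasure M A * emeasure lborel (ball (0::complex) 1)
      = emeasure M (uminus -` ball 0 1) * emeasure lborel A" if "A \<in> sets borel" for A
    using that by (intro translation_invariant_measure_proportional) auto
  have "uminus -` ball (0::complex) 1 = ball 0 1" by auto
  with proportional have proportional: "emeasure M A * ennreal pi = ennreal (pi * (cmod w)\<^sup>2) * emeasure lborel A"
    if "A \<in> sets borel" for A
    using that M_ball [of 1] by (simp add: emeasure_complex_ball)
  have "M = scale_measure (ennreal ((cmod w)\<^sup>2)) lborel"
  proof (rule measure_eqI)
    fix A assume "A \<in> sets M"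
    then have "ennreal pi * emeasure M A = ennreal pi * (ennreal ((cmod w)\<^sup>2) * emeasure lborel A)"
      using proportional [of A] by (simp add: ennreal_mult mult_ac)
    then show "emeasure M A = emeasure (scale_measure (ennreal ((cmod w)\<^sup>2)) lborel) A"
      by (subst (asm) ennreal_mult_cancel_left) auto
  qed simp
  moreover have "(\<integral>\<^sup>+z. f (z / w) \<partial>lborel) = (\<integral>\<^sup>+z. f z \<partial>M)"
    unfolding M_def by (subst nn_integral_distr) auto
  ultimately show ?thesis by (simp add: nn_integral_scale_measure)
qed

text \<open>
Polar coordinates in the variable \<open>s = |w|\<^sup>2\<close>: discs have area \<open>\<pi> s\<close>, so the image of Lebesgue measure on the unit disc is
\<open>\<pi>\<close> times Lebesgue measure on \<open>{0..1}\<close>.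
\<close>

lemma nn_integral_disc_radial:
  assumes [measurable]: "\<phi> \<in> borel_measurable borel"
  shows "(\<integral>\<^sup>+w. \<phi> ((cmod w)\<^sup>2) * indicator (ball 0 1) w \<partial>lborel)
       = ennreal pi * (\<integral>\<^sup>+s. \<phi> s * indicator {0..1} s \<partial>lborel)"
proof -
  define M where "M = distr (restrict_space lborel (ball (0::complex) 1)) borel (\<lambda>w. (cmod w)\<^sup>2)"
  define N where "N = scale_measure (ennreal pi) (density lborel (indicator {0..1::real}))"
  have N_em: "emeasure N A = ennreal pi * emeasure lborel (A \<inter> {0..1})" if "A \<in> sets borel" for A
  proof -
    have "(\<integral>\<^sup>+s. indicator {0..1} s * indicator A s \<partial>lborel)
        = (\<integral>\<^sup>+s. indicator (A \<inter> {0..1::real}) s \<partial>lborel)"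
      by (intro nn_integral_cong) (simp split: split_indicator)
    moreover have "emeasure N A = ennreal pi * (\<integral>\<^sup>+s. indicator {0..1} s * indicator A s \<partial>lborel)"
      unfolding N_def using that by (subst emeasure_scale_measure, subst emeasure_density) simp_all
    moreover have "(\<integral>\<^sup>+s. indicator (A \<inter> {0..1::real}) s \<partial>lborel) = emeasure lborel (A \<inter> {0..1})"
      using that by (intro nn_integral_indicator) simp
    ultimately show ?thesis by (simp only:)
  qed
  have M_em: "emeasure M A = emeasure lborel ({w. (cmod w)\<^sup>2 \<in> A} \<inter> ball 0 1)" if [measurable]: "A \<in> sets borel" for A
  proof -
    have "{w. (cmod w)\<^sup>2 \<in> A} = (\<lambda>w::complex. (cmod w)\<^sup>2) -` A" by auto
    then have [measurable]: "{w. (cmod w)\<^sup>2 \<in> A} \<in> sets borel"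
      using measurable_sets_borel [of "\<lambda>w::complex. (cmod w)\<^sup>2" borel A] by simp
    have "emeasure M A = emeasure (restrict_space lborel (ball 0 1)) ({w. (cmod w)\<^sup>2 \<in> A} \<inter> ball 0 1)"
      unfolding M_def using that
      by (subst emeasure_distr) (auto simp: space_restrict_space measurable_restrict_space1 vimage_def Int_def intro!: arg_cong2[where f=emeasure])
    then show ?thesis by (simp add: emeasure_restrict_space)
  qed
  have "M = N"
  proof (rule measure_eqI_lessThan)
    show "emeasure M {x<..} < \<infinity>" for x
    proof -
      have "emeasure M {x<..} \<le> emeasure lborel (ball (0::complex) 1)"
        by (subst M_em) (auto intro!: emeasure_mono)
      then show ?thesis by (simp add: emeasure_complex_ball le_less_trans)
    qed
    show "emeasure M {x<..} = emeasure N {x<..}" for x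
    proof -
      consider "x < 0" | "0 \<le> x" "x < 1" | "1 \<le> x" by linarith
      then show ?thesis
      proof cases
        case 1
        then have "{w. (cmod w)\<^sup>2 \<in> {x<..}} \<inter> ball 0 1 = ball 0 1"
          by (auto simp: less_le_trans)
        moreover have "{x<..} \<inter> {0..1} = {0..1}" using 1 by auto
        ultimately show ?thesis by (simp add: M_em N_em emeasure_complex_ball)
      next
        case 2
        have sq: "x < (cmod w)\<^sup>2 \<longleftrightarrow> sqrt x < cmod w" for w
          using 2 by (metis norm_ge_zero real_sqrt_less_iff real_sqrt_unique)
        have "{w. (cmod w)\<^sup>2 \<in> {x<..}} \<inter> ball 0 1 = ball 0 1 - cball 0 (sqrt x)"
          by (auto simp: sq)
        moreover have "emeasure lborel (ball (0::complex) 1 - cball 0 (sqrt x)) = ennreal (pi - pi * x)"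
        proof -
          have "cball 0 (sqrt x) \<subseteq> ball (0::complex) 1" using 2 by (auto simp: le_less_trans)
          moreover have "emeasure lborel (cball (0::complex) (sqrt x)) = ennreal (pi * x)"
            using 2 emeasure_cball [of "sqrt x" "0::complex"] unit_ball_vol_2 by simp
          ultimately show ?thesis
            using 2 by (subst emeasure_Diff) (auto simp: emeasure_complex_ball ennreal_minus)
        qed
        moreover have "{x<..} \<inter> {0..1} = {x<..1}" using 2 by auto
        ultimately show ?thesis using 2
          by (simp add: M_em N_em ennreal_mult [symmetric] right_diff_distrib)
      next
        case 3
        then have "{w. (cmod w)\<^sup>2 \<in> {x<..}} \<inter> ball 0 1 = {}"
          by (auto, smt (verit, best) norm_ge_zero power_le_one)
        moreover have "{x<..} \<inter> {0..1} = {}" using 3 by auto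
        ultimately show ?thesis by (simp add: M_em N_em)
      qed
    qed
  qed (auto simp: M_def N_def)
  have "(\<integral>\<^sup>+w. \<phi> ((cmod w)\<^sup>2) * indicator (ball 0 1) w \<partial>lborel) = (\<integral>\<^sup>+s. \<phi> s \<partial>M)"
    unfolding M_def
    by (subst nn_integral_distr) (auto simp: nn_integral_restrict_space measurable_restrict_space1)
  also have "\<dots> = ennreal pi * (\<integral>\<^sup>+s. \<phi> s * indicator {0..1} s \<partial>lborel)"
    unfolding \<open>M = N\<close> N_def
    by (subst nn_integral_scale_measure, simp, subst nn_integral_density, simp, simp, simp only: mult.commute)
  finally show ?thesis .
qed

section \<open>Integration by parts on the unit ball\<close>

lemma difference_quotient_tendsto:
  fixes h :: "'a::real_normed_vector \<Rightarrow> 'b::real_normed_vector"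
  assumes h': "(h has_derivative h') (at x)"
  shows "(\<lambda>n. real (Suc n) *\<^sub>R (h (x + v /\<^sub>R real (Suc n)) - h x)) \<longlonglongrightarrow> h' v"
proof -
  have "((\<lambda>t. h (x + t *\<^sub>R v)) has_vector_derivative h' v) (at 0)"
  proof -
    have "((\<lambda>t. x + t *\<^sub>R v) has_derivative (\<lambda>t. t *\<^sub>R v)) (at 0)"
      by (auto intro!: derivative_eq_intros)
    from diff_chain_at [OF this, of h "h'"] h'
    have "((\<lambda>t. h (x + t *\<^sub>R v)) has_derivative (\<lambda>t. h' (t *\<^sub>R v))) (at 0)"
      by (simp add: o_def)
    then show ?thesis
      unfolding has_vector_derivative_def
      using linear_cmul [OF bounded_linear.linear [OF has_derivative_bounded_linear [OF h']]] by simp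
  qed
  then have "((\<lambda>t. (h (x + t *\<^sub>R v) - h x - t *\<^sub>R h' v) /\<^sub>R \<bar>t\<bar>) \<longlongrightarrow> 0) (at 0)"
    by (simp add: has_vector_derivative_def has_derivative_at_within)
  moreover have "filterlim (\<lambda>n. inverse (real (Suc n))) (at 0) sequentially"
    unfolding filterlim_at using LIMSEQ_inverse_real_of_nat by simp
  ultimately have "(\<lambda>n. (h (x + inverse (real (Suc n)) *\<^sub>R v) - h x
      - inverse (real (Suc n)) *\<^sub>R h' v) /\<^sub>R \<bar>inverse (real (Suc n))\<bar>) \<longlonglongrightarrow> 0"
    by (rule filterlim_compose)
  moreover have "(h (x + inverse (real (Suc n)) *\<^sub>R v) - h x
      - inverse (real (Suc n)) *\<^sub>R h' v) /\<^sub>R \<bar>inverse (real (Suc n))\<bar>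
      = real (Suc n) *\<^sub>R (h (x + v /\<^sub>R real (Suc n)) - h x) - h' v" for n
    by (simp add: scaleR_diff_right)
  ultimately show ?thesis by (simp add: LIM_zero_iff)
qed

text \<open>
Extended by \<open>0\<close>, the function \<open>h\<close> is Lipschitz, because the extension is \<open>h\<close> composed with the
nearest-point projection to the ball.  The integral of its difference quotients vanishes by translation
invariance, and they converge dominatedly to the derivative.
\<close>

lemma integral_derivative_vanishing_on_sphere:
  fixes h :: "'a::euclidean_space \<Rightarrow> 'b::euclidean_space"
  assumes h': "\<And>x. (h has_derivative h' x) (at x)"
    and cont: "\<And>v. continuous_on UNIV (\<lambda>x. h' x v)"
    and zero: "\<And>x. norm x = 1 \<Longrightarrow> h x = 0"
  shows "(LINT x:cball 0 1|lborel. h' x v) = 0"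
proof -
  let ?B = "cball (0::'a) 1"
  define g where "g x = h (closest_point ?B x)" for x
  have cp: "closest_point ?B x \<in> ?B" for x
    by (rule closest_point_in_set) auto
  have g_in: "g x = h x" if "x \<in> ?B" for x
    using that by (simp add: g_def closest_point_self)
  have g_out: "g x = 0" if "norm x \<ge> 1" for x
  proof (cases "norm x = 1")
    case True
    then show ?thesis using g_in [of x] zero by simp
  next
    case False
    have aff: "affine hull ?B = UNIV"
      by (rule affine_hull_nonempty_interior) auto
    have "closest_point ?B x \<in> rel_frontier ?B"
      using that False by (intro closest_point_in_rel_frontier) (auto simp: aff rel_interior_interior)
    then have "closest_point ?B x \<in> sphere 0 1"
      by (simp add: rel_frontier_def rel_interior_interior aff)
    then show ?thesis using zero by (simp add: g_def)
  qed
  \<comment> \<open>a bound for the derivatives in all directions, from bounds in the coordinate directions\<close>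
  obtain K where K: "\<And>x u. x \<in> ?B \<Longrightarrow> norm (h' x u) \<le> K * norm u"
  proof -
    have lin: "linear (h' x)" for x
      using h' has_derivative_bounded_linear bounded_linear.linear by blast
    have "\<exists>C. \<forall>x\<in>?B. norm (h' x b) \<le> C" for b
      using compact_imp_bounded [OF compact_continuous_image [OF continuous_on_subset [OF cont [of b]]], of ?B]
      by (auto simp: bounded_iff)
    then obtain C where C: "\<And>b x. x \<in> ?B \<Longrightarrow> norm (h' x b) \<le> C b" by metis
    have "norm (h' x u) \<le> (\<Sum>b\<in>Basis. C b) * norm u" if x: "x \<in> ?B" for x u
    proof -
      have "h' x u = (\<Sum>b\<in>Basis. (u \<bullet> b) *\<^sub>R h' x b)"
        using linear_sum [OF lin, of x "\<lambda>b. (u \<bullet> b) *\<^sub>R b" Basis]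
        by (simp add: euclidean_representation linear_cmul [OF lin])
      also have "norm \<dots> \<le> (\<Sum>b\<in>Basis. norm u * C b)"
        by (intro sum_norm_le) (auto intro!: mult_mono C x Basis_le_norm)
      finally show ?thesis by (simp add: sum_distrib_left mult.commute)
    qed
    then show ?thesis by (rule that)
  qed
  have lip: "norm (g x - g y) \<le> K * norm (x - y)" for x y
  proof -
    have K0: "K \<ge> 0"
    proof -
      have "0 \<le> norm (h' 0 (SOME i. i \<in> Basis))" by simp
      also have "\<dots> \<le> K" using K [of 0 "SOME i. i \<in> Basis"] SOME_Basis by simp
      finally show ?thesis .
    qed
    have "norm (g x - g y) \<le> K * norm (closest_point ?B x - closest_point ?B y)"
      unfolding g_def
    proof (rule differentiable_bound [of ?B])
      show "(h has_derivative h' z) (at z within ?B)" for z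
        using h' has_derivative_at_withinI by blast
      show "onorm (h' z) \<le> K" if "z \<in> ?B" for z
        using K [OF that] by (intro onorm_bound K0) auto
    qed (use cp in auto)
    also have "\<dots> \<le> K * norm (x - y)"
      using closest_point_lipschitz [of ?B x y] K0 by (intro mult_left_mono) (auto simp: dist_norm)
    finally show ?thesis .
  qed
  have g_cont: "continuous_on UNIV g"
  proof -
    have "continuous_on UNIV h"
      using h' by (meson has_derivative_continuous continuous_at_imp_continuous_on)
    moreover have "continuous_on UNIV (closest_point ?B)"
      by (rule continuous_on_closest_point) auto
    ultimately show ?thesis
      unfolding g_def by (rule continuous_on_compose2 [of UNIV h UNIV "closest_point ?B"]) auto
  qed
  then have [measurable]: "g \<in> borel_measurable borel"
    by (rule borel_measurable_continuous_onI)
  have g_ind: "g = (\<lambda>x. indicator ?B x *\<^sub>R g x)"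
    using g_out by (auto simp: fun_eq_iff indicator_def)
  have g_int: "integrable lborel g"
  proof -
    have "set_integrable lborel ?B g"
      unfolding set_integrable_def
      by (intro borel_integrable_compact continuous_on_subset [OF g_cont]) auto
    then show ?thesis unfolding set_integrable_def using g_ind by metis
  qed
  have shift: "(LINT x|lborel. g (x + c)) = (LINT x|lborel. g x)" "integrable lborel (\<lambda>x. g (x + c))" for c
  proof -
    show "(LINT x|lborel. g (x + c)) = (LINT x|lborel. g x)"
      by (subst (2) lborel_distr_plus [symmetric, of c]) (simp add: integral_distr add.commute)
    have "integrable (distr lborel borel ((+) c)) g" using g_int lborel_distr_plus [of c] by simp
    then show "integrable lborel (\<lambda>x. g (x + c))"
      by (subst (asm) integrable_distr_eq) (auto simp: add.commute)
  qed
  define q where "q n x = real (Suc n) *\<^sub>R (g (x + v /\<^sub>R real (Suc n)) - g x)" for n x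
  have "(\<lambda>n. LINT x|lborel. q n x) \<longlonglongrightarrow> (LINT x|lborel. indicator ?B x *\<^sub>R h' x v)"
  proof (rule integral_dominated_convergence)
    show "(\<lambda>x. indicator ?B x *\<^sub>R h' x v) \<in> borel_measurable lborel"
    proof -
      have "(\<lambda>x. h' x v) \<in> borel_measurable lborel"
        using borel_measurable_continuous_onI [OF cont] by simp
      then show ?thesis
        by (intro borel_measurable_scaleR borel_measurable_indicator) auto
    qed
    show "q n \<in> borel_measurable lborel" for n
      unfolding q_def by measurable
    show "integrable lborel (\<lambda>x. (K * norm v) * indicator (cball (0::'a) (1 + norm v)) x :: real)"
      using emeasure_lborel_cball_finite [of "0::'a" "1 + norm v"]
      by (intro integrable_mult_right integrable_real_indicator) auto
    show "AE x in lborel. norm (q n x) \<le> (K * norm v) * indicator (cball (0::'a) (1 + norm v)) x" for n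
    proof (intro AE_I2)
      fix x
      show "norm (q n x) \<le> (K * norm v) * indicator (cball (0::'a) (1 + norm v)) x"
      proof (cases "norm x \<le> 1 + norm v")
        case True
        have "norm (q n x) = real (Suc n) * norm (g (x + v /\<^sub>R real (Suc n)) - g x)"
          by (simp add: q_def)
        also have "\<dots> \<le> real (Suc n) * (K * norm (v /\<^sub>R real (Suc n)))"
          using lip [of "x + v /\<^sub>R real (Suc n)" x] by (intro mult_left_mono) auto
        also have "\<dots> = K * norm v" by (simp add: field_simps)
        finally show ?thesis using True by simp
      next
        case False
        have "norm (v /\<^sub>R real (Suc n)) \<le> norm v" by (simp add: field_simps mult_left_le)
        moreover have "norm x - norm (v /\<^sub>R real (Suc n)) \<le> norm (x + v /\<^sub>R real (Suc n))"
          by (metis norm_diff_ineq)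
        ultimately have "norm (x + v /\<^sub>R real (Suc n)) \<ge> 1" "norm x \<ge> 1" using False norm_ge_zero [of v] by linarith+
        then show ?thesis by (simp add: q_def g_out False)
      qed
    qed
    have "AE x in lborel. x \<notin> sphere (0::'a) 1"
      using negligible_sphere [of 0 1] AE_not_in by (metis AE_completion_iff negligible_iff_null_sets)
    then show "AE x in lborel. (\<lambda>n. q n x) \<longlonglongrightarrow> indicator ?B x *\<^sub>R h' x v"
    proof eventually_elim
      case (elim x)
      have lim0: "(\<lambda>n. v /\<^sub>R real (Suc n)) \<longlonglongrightarrow> 0"
        using tendsto_scaleR [OF LIMSEQ_inverse_real_of_nat tendsto_const [of v]] by simp
      then have lim: "(\<lambda>n. x + v /\<^sub>R real (Suc n)) \<longlonglongrightarrow> x"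
        using tendsto_add [OF tendsto_const [of x] lim0] by simp
      consider "norm x < 1" | "norm x > 1" using elim by force
      then show ?case
      proof cases
        case 1
        have "eventually (\<lambda>n. x + v /\<^sub>R real (Suc n) \<in> ball 0 1) sequentially"
          using lim 1 by (intro topological_tendstoD) auto
        then have "eventually (\<lambda>n. q n x = real (Suc n) *\<^sub>R (h (x + v /\<^sub>R real (Suc n)) - h x)) sequentially"
          by eventually_elim (use 1 in \<open>simp add: q_def g_in\<close>)
        moreover have "(\<lambda>n. real (Suc n) *\<^sub>R (h (x + v /\<^sub>R real (Suc n)) - h x)) \<longlonglongrightarrow> h' x v"
          by (rule difference_quotient_tendsto) (rule h')
        ultimately show ?thesis using 1 by (simp add: tendsto_cong)
      next
        case 2
        have "eventually (\<lambda>n. x + v /\<^sub>R real (Suc n) \<in> - cball 0 1) sequentially"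
          using lim 2 by (intro topological_tendstoD) auto
        then have "eventually (\<lambda>n. q n x = 0) sequentially"
          by eventually_elim (use 2 in \<open>simp add: q_def g_out\<close>)
        then show ?thesis using 2 by (simp add: tendsto_eventually)
      qed
    qed
  qed
  moreover have "(LINT x|lborel. q n x) = 0" for n
    unfolding q_def using shift [of "v /\<^sub>R real (Suc n)"] g_int by simp
  ultimately show ?thesis
    unfolding set_lebesgue_integral_def by (simp add: LIMSEQ_const_iff)
qed

section \<open>Two estimates on the unit disc\<close>

text \<open>
\<open>p\<close> and \<open>q\<close> are the derivatives of \<open>h\<close> with respect to \<open>x\<close> and \<open>cnj x\<close>.
\<close>

definition has_wirtinger :: "(complex \<Rightarrow> complex) \<Rightarrow> complex \<Rightarrow> complex \<Rightarrow> complex \<Rightarrow> bool" where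
  "has_wirtinger h p q x \<longleftrightarrow> (h has_derivative (\<lambda>v. p * v + q * cnj v)) (at x)"

lemma has_wirtinger_const: "has_wirtinger (\<lambda>x. c) 0 0 x"
  by (simp add: has_wirtinger_def)

lemma has_wirtinger_add:
  "has_wirtinger f p q x \<Longrightarrow> has_wirtinger g r s x \<Longrightarrow> has_wirtinger (\<lambda>x. f x + g x) (p + r) (q + s) x"
  unfolding has_wirtinger_def by (drule (1) has_derivative_add) (simp add: algebra_simps)

lemma has_wirtinger_mult:
  assumes "has_wirtinger f p q x" "has_wirtinger g r s x"
  shows "has_wirtinger (\<lambda>x. f x * g x) (p * g x + f x * r) (q * g x + f x * s) x"
  using has_derivative_mult [OF assms [unfolded has_wirtinger_def]]
  by (simp add: has_wirtinger_def algebra_simps)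

lemma has_wirtinger_cmult:
  assumes "has_wirtinger f p q x"
  shows "has_wirtinger (\<lambda>x. c * f x) (c * p) (c * q) x"
  using has_wirtinger_mult [OF has_wirtinger_const assms] by simp

lemma has_wirtinger_diff:
  assumes "has_wirtinger f p q x" "has_wirtinger g r s x"
  shows "has_wirtinger (\<lambda>x. f x - g x) (p - r) (q - s) x"
  using has_wirtinger_add [OF assms(1) has_wirtinger_cmult [OF assms(2), of "-1"]] by simp

lemma has_wirtinger_cnj:
  assumes "has_wirtinger f p q x"
  shows "has_wirtinger (\<lambda>x. cnj (f x)) (cnj q) (cnj p) x"
  using has_derivative_cnj [OF assms [unfolded has_wirtinger_def]]
  by (simp add: has_wirtinger_def algebra_simps)

lemma has_wirtinger_id: "has_wirtinger (\<lambda>x. x) 1 0 x"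
  by (simp add: has_wirtinger_def)

lemma has_wirtinger_power: "has_wirtinger (\<lambda>x. x ^ n) (of_nat n * x ^ (n - 1)) 0 x"
proof -
  have "((\<lambda>x. x ^ n) has_field_derivative of_nat n * x ^ (n - 1)) (at x)"
    by (auto intro!: derivative_eq_intros)
  then show ?thesis by (simp add: has_wirtinger_def has_field_derivative_def)
qed

lemma has_wirtinger_cnj_power: "has_wirtinger (\<lambda>x. cnj x ^ n) 0 (of_nat n * cnj x ^ (n - 1)) x"
  using has_wirtinger_cnj [OF has_wirtinger_power] by simp

lemma has_wirtinger_continuous:
  assumes "\<And>x. has_wirtinger f (p x) (q x) x"
  shows "continuous_on UNIV f"
  using assms unfolding has_wirtinger_def
  by (meson has_derivative_continuous continuous_at_imp_continuous_on)

text \<open>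
The directions \<open>1\<close> and \<open>\<i>\<close> separate the two Wirtinger derivatives.
\<close>

lemma integral_wirtinger_vanishing_on_circle:
  assumes h: "\<And>x. has_wirtinger h (p x) (q x) x"
    and p: "continuous_on UNIV p" and q: "continuous_on UNIV q"
    and zero: "\<And>x. cmod x = 1 \<Longrightarrow> h x = 0"
  shows "(LINT x:cball 0 1|lborel. p x) = 0" and "(LINT x:cball 0 1|lborel. q x) = 0"
proof -
  have int: "set_integrable lborel (cball 0 1) p" "set_integrable lborel (cball 0 1) q"
    unfolding set_integrable_def
    by (intro borel_integrable_compact continuous_on_subset [OF p] continuous_on_subset [OF q] compact_cball subset_UNIV)+
  have *: "(LINT x:cball 0 1|lborel. p x * v + q x * cnj v) = 0" for v
    by (rule integral_derivative_vanishing_on_sphere [of h "\<lambda>x v. p x * v + q x * cnj v" v])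
       (auto intro!: continuous_intros p q zero h [unfolded has_wirtinger_def])
  have "(LINT x:cball 0 1|lborel. p x) * v + (LINT x:cball 0 1|lborel. q x) * cnj v = 0" for v
    using * [of v] int by simp
  from this [of 1] this [of \<i>]
  show "(LINT x:cball 0 1|lborel. p x) = 0" "(LINT x:cball 0 1|lborel. q x) = 0"
    by (auto simp: algebra_simps)
qed

definition disc_integral :: "(complex \<Rightarrow> real) \<Rightarrow> real" where
  "disc_integral f = (LINT x:cball 0 1|lborel. f x)"

lemma set_integrable_disc:
  fixes f :: "complex \<Rightarrow> 'b::{banach, second_countable_topology}"
  shows "continuous_on UNIV f \<Longrightarrow> set_integrable lborel (cball 0 1) f"
  unfolding set_integrable_def
  by (intro borel_integrable_compact) (auto intro: continuous_on_subset)

lemma disc_integral_add: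
  "continuous_on UNIV f \<Longrightarrow> continuous_on UNIV g \<Longrightarrow>
    disc_integral (\<lambda>x. f x + g x) = disc_integral f + disc_integral g"
  by (simp add: disc_integral_def set_integral_add set_integrable_disc)

lemma disc_integral_cmult: "disc_integral (\<lambda>x. c * f x) = c * disc_integral f"
  by (simp add: disc_integral_def)

lemma disc_integral_mono:
  "continuous_on UNIV f \<Longrightarrow> continuous_on UNIV g \<Longrightarrow> (\<And>x. cmod x \<le> 1 \<Longrightarrow> f x \<le> g x) \<Longrightarrow>
    disc_integral f \<le> disc_integral g"
  unfolding disc_integral_def by (intro set_integral_mono set_integrable_disc) auto

lemma disc_integral_Re:
  assumes "continuous_on UNIV f"
  shows "disc_integral (\<lambda>x. Re (f x)) = Re (LINT x:cball 0 1|lborel. f x)"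
  using integral_Re [OF set_integrable_disc [OF assms, unfolded set_integrable_def]]
  by (simp add: disc_integral_def set_lebesgue_integral_def)

lemma Re_mult_cnj: "Re (z * cnj z) = (cmod z)\<^sup>2"
  by (simp add: complex_mult_cnj cmod_power2)

text \<open>
Here \<open>v\<close> solves the Dirichlet problem \<open>\<partial>\<^sup>2v/\<partial>x\<partial>\<bar>x = g\<close>, and \<open>p\<close>, \<open>q\<close> are its Wirtinger derivatives.
Integrating by parts, \<open>\<parallel>p\<parallel>\<^sup>2 = - Re \<langle>g, v\<rangle> = \<parallel>q\<parallel>\<^sup>2\<close>; and the divergence of \<open>x |v|\<^sup>2\<close> gives a Poincare inequality
\<open>\<parallel>v\<parallel>\<^sup>2 \<le> 4 \<parallel>p\<parallel>\<^sup>2\<close>.  The two combine to the claim.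
\<close>

lemma green_gradient_estimate:
  assumes v: "\<And>x. has_wirtinger v (p x) (q x) x"
    and p: "\<And>x. has_wirtinger p (r x) (g x) x"
    and q: "\<And>x. has_wirtinger q (g x) (s x) x"
    and [continuous_intros]: "continuous_on UNIV r" "continuous_on UNIV g" "continuous_on UNIV s"
    and zero: "\<And>x. cmod x = 1 \<Longrightarrow> v x = 0"
  shows "disc_integral (\<lambda>x. (cmod (p x))\<^sup>2) \<le> 4 * disc_integral (\<lambda>x. (cmod (g x))\<^sup>2)"
proof -
  note [continuous_intros] = has_wirtinger_continuous [OF v]
    has_wirtinger_continuous [OF p] has_wirtinger_continuous [OF q]
  define V where "V = disc_integral (\<lambda>x. (cmod (v x))\<^sup>2)"
  define P where "P = disc_integral (\<lambda>x. (cmod (p x))\<^sup>2)"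
  define Q where "Q = disc_integral (\<lambda>x. (cmod (q x))\<^sup>2)"
  define G where "G = disc_integral (\<lambda>x. (cmod (g x))\<^sup>2)"
  have P: "P + disc_integral (\<lambda>x. Re (g x * cnj (v x))) = 0"
  proof -
    have "(LINT x:cball 0 1|lborel. g x * cnj (v x) + p x * cnj (p x)) = 0"
      by (rule integral_wirtinger_vanishing_on_circle(2)
            [OF has_wirtinger_mult [OF p has_wirtinger_cnj [OF v]]])
         (auto intro!: continuous_intros simp: zero)
    then have "disc_integral (\<lambda>x. Re (g x * cnj (v x) + p x * cnj (p x))) = 0"
      by (subst disc_integral_Re) (auto intro!: continuous_intros)
    then have "disc_integral (\<lambda>x. Re (g x * cnj (v x)) + (cmod (p x))\<^sup>2) = 0"
      by (simp only: plus_complex.sel mult_1_left Re_mult_cnj)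
    then show ?thesis
      by (subst (asm) disc_integral_add) (auto intro!: continuous_intros simp: P_def)
  qed
  have Q: "Q + disc_integral (\<lambda>x. Re (g x * cnj (v x))) = 0"
  proof -
    have "(LINT x:cball 0 1|lborel. g x * cnj (v x) + q x * cnj (q x)) = 0"
      by (rule integral_wirtinger_vanishing_on_circle(1)
            [OF has_wirtinger_mult [OF q has_wirtinger_cnj [OF v]]])
         (auto intro!: continuous_intros simp: zero)
    then have "disc_integral (\<lambda>x. Re (g x * cnj (v x) + q x * cnj (q x))) = 0"
      by (subst disc_integral_Re) (auto intro!: continuous_intros)
    then have "disc_integral (\<lambda>x. Re (g x * cnj (v x)) + (cmod (q x))\<^sup>2) = 0"
      by (simp only: plus_complex.sel mult_1_left Re_mult_cnj)
    then show ?thesis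
      by (subst (asm) disc_integral_add) (auto intro!: continuous_intros simp: Q_def)
  qed
  \<comment> \<open>The Poincare inequality comes from the divergence of \<open>x |v|\<^sup>2\<close>, with \<open>V / 2\<close> to be absorbed.\<close>
  have V: "V \<le> V / 2 + P + Q"
  proof -
    have "(LINT x:cball 0 1|lborel. 1 * (v x * cnj (v x)) + x * (p x * cnj (v x) + v x * cnj (q x))) = 0"
      by (rule integral_wirtinger_vanishing_on_circle(1)
            [OF has_wirtinger_mult [OF has_wirtinger_id has_wirtinger_mult [OF v has_wirtinger_cnj [OF v]]]])
         (auto intro!: continuous_intros simp: zero)
    then have "disc_integral (\<lambda>x. Re (1 * (v x * cnj (v x)) + x * (p x * cnj (v x) + v x * cnj (q x)))) = 0"
      by (subst disc_integral_Re) (auto intro!: continuous_intros)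
    then have "disc_integral (\<lambda>x. (cmod (v x))\<^sup>2 + Re (x * (p x * cnj (v x) + v x * cnj (q x)))) = 0"
      by (simp only: plus_complex.sel mult_1_left Re_mult_cnj)
    then have "V = - disc_integral (\<lambda>x. Re (x * (p x * cnj (v x) + v x * cnj (q x))))"
      by (subst (asm) disc_integral_add) (auto intro!: continuous_intros simp: V_def)
    also have "\<dots> = disc_integral (\<lambda>x. (-1) * Re (x * (p x * cnj (v x) + v x * cnj (q x))))"
      by (subst disc_integral_cmult) simp
    also have "\<dots> \<le> disc_integral (\<lambda>x. (1/2) * (cmod (v x))\<^sup>2 + ((cmod (p x))\<^sup>2 + (cmod (q x))\<^sup>2))"
    proof (rule disc_integral_mono)
      fix x :: complex assume x: "cmod x \<le> 1"
      have "- Re (x * (p x * cnj (v x) + v x * cnj (q x))) \<le> cmod (x * (p x * cnj (v x) + v x * cnj (q x)))"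
        using abs_Re_le_cmod abs_le_D2 by blast
      also have "\<dots> = cmod x * cmod (p x * cnj (v x) + v x * cnj (q x))" by (simp add: norm_mult)
      also have "\<dots> \<le> 1 * cmod (p x * cnj (v x) + v x * cnj (q x))"
        using x by (intro mult_right_mono) auto
      also have "\<dots> \<le> cmod (p x) * cmod (v x) + cmod (v x) * cmod (q x)"
        using norm_triangle_ineq [of "p x * cnj (v x)" "v x * cnj (q x)"] by (simp add: norm_mult)
      also have "\<dots> \<le> (1/2) * (cmod (v x))\<^sup>2 + ((cmod (p x))\<^sup>2 + (cmod (q x))\<^sup>2)"
      proof -
        have "0 \<le> (cmod (v x) / 2 - cmod (p x))\<^sup>2 + (cmod (v x) / 2 - cmod (q x))\<^sup>2" by simp
        then show ?thesis by (simp add: power2_eq_square algebra_simps)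
      qed
      finally show "-1 * Re (x * (p x * cnj (v x) + v x * cnj (q x)))
          \<le> (1/2) * (cmod (v x))\<^sup>2 + ((cmod (p x))\<^sup>2 + (cmod (q x))\<^sup>2)" by simp
    qed (auto intro!: continuous_intros)
    also have "\<dots> = V / 2 + P + Q"
      by (simp only: disc_integral_add disc_integral_cmult V_def P_def Q_def continuous_intros)
    finally show ?thesis .
  qed
  have "- disc_integral (\<lambda>x. Re (g x * cnj (v x))) \<le> 2 * G + V / 8"
  proof -
    have "- disc_integral (\<lambda>x. Re (g x * cnj (v x))) = disc_integral (\<lambda>x. (-1) * Re (g x * cnj (v x)))"
      by (subst disc_integral_cmult) simp
    also have "\<dots> \<le> disc_integral (\<lambda>x. 2 * (cmod (g x))\<^sup>2 + (1/8) * (cmod (v x))\<^sup>2)"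
    proof (rule disc_integral_mono)
      fix x
      have "- Re (g x * cnj (v x)) \<le> cmod (g x * cnj (v x))"
        using abs_Re_le_cmod abs_le_D2 by blast
      also have "\<dots> = cmod (g x) * cmod (v x)" by (simp add: norm_mult)
      also have "\<dots> \<le> 2 * (cmod (g x))\<^sup>2 + (1/8) * (cmod (v x))\<^sup>2"
      proof -
        have "0 \<le> 2 * (cmod (g x) - cmod (v x) / 4)\<^sup>2" by simp
        then show ?thesis by (simp add: power2_eq_square algebra_simps)
      qed
      finally show "-1 * Re (g x * cnj (v x)) \<le> 2 * (cmod (g x))\<^sup>2 + (1/8) * (cmod (v x))\<^sup>2" by simp
    qed (auto intro!: continuous_intros)
    also have "\<dots> = 2 * G + V / 8"
      by (simp only: disc_integral_add disc_integral_cmult V_def G_def continuous_intros)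
    finally show ?thesis .
  qed
  with P Q V have "P \<le> 4 * G" by linarith
  then show ?thesis by (simp add: P_def G_def)
qed

text \<open>
A holomorphic function is orthogonal to every \<open>\<partial>v/\<partial>x\<close> with \<open>v = 0\<close> on the circle.
\<close>

lemma bergman_projection_estimate:
  assumes v: "\<And>x. has_wirtinger v (p x) (q x) x"
    and f: "\<And>x. has_wirtinger f (f' x) 0 x"
    and [continuous_intros]: "continuous_on UNIV p" "continuous_on UNIV q" "continuous_on UNIV f'"
    and zero: "\<And>x. cmod x = 1 \<Longrightarrow> v x = 0"
  shows "disc_integral (\<lambda>x. (cmod (f x))\<^sup>2) \<le> disc_integral (\<lambda>x. (cmod (f x + p x))\<^sup>2)"
proof -
  note [continuous_intros] = has_wirtinger_continuous [OF v] has_wirtinger_continuous [OF f]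
  have "(LINT x:cball 0 1|lborel. p x * cnj (f x) + v x * cnj 0) = 0"
    by (rule integral_wirtinger_vanishing_on_circle(1)
          [OF has_wirtinger_mult [OF v has_wirtinger_cnj [OF f]]])
       (auto intro!: continuous_intros simp: zero)
  then have orth: "disc_integral (\<lambda>x. Re (p x * cnj (f x))) = 0"
    by (subst disc_integral_Re) (auto intro!: continuous_intros)
  have "disc_integral (\<lambda>x. (cmod (f x))\<^sup>2)
      = disc_integral (\<lambda>x. (cmod (f x))\<^sup>2 + 2 * Re (p x * cnj (f x)))"
    by (simp only: disc_integral_add disc_integral_cmult orth continuous_intros)
  also have "\<dots> \<le> disc_integral (\<lambda>x. (cmod (f x + p x))\<^sup>2)"
  proof (rule disc_integral_mono)
    show "(cmod (f x))\<^sup>2 + 2 * Re (p x * cnj (f x)) \<le> (cmod (f x + p x))\<^sup>2" for x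
      unfolding cmod_power2 by (simp add: power2_eq_square algebra_simps)
  qed (auto intro!: continuous_intros)
  finally show ?thesis .
qed

section \<open>The one-dimensional operators on polynomials\<close>

definition mon :: "nat \<Rightarrow> nat \<Rightarrow> complex \<Rightarrow> complex" where
  "mon a b x = x ^ a * cnj x ^ b"

text \<open>
The solution of \<open>\<partial>\<^sup>2v/\<partial>x\<partial>\<bar>x = mon a b\<close> with \<open>v = 0\<close> on the unit circle.  The subtrahend is \<open>x ^ (a - b)\<close> if
\<open>b \<le> a\<close> and \<open>cnj x ^ (b - a)\<close> otherwise: truncated subtraction makes the other factor \<open>1\<close>.
\<close>

definition green_mon :: "nat \<Rightarrow> nat \<Rightarrow> complex \<Rightarrow> complex" where
  "green_mon a b x = inverse (of_nat ((a + 1) * (b + 1))) * (mon (a + 1) (b + 1) x - mon (a - b) (b - a) x)"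

text \<open>
The derivative of \<open>green_mon a b\<close> with respect to \<open>x\<close>, that is the solution of \<open>\<partial>u/\<partial>\<bar>x = mon a b\<close> that is orthogonal to
the holomorphic functions.
\<close>

definition sol_mon :: "nat \<Rightarrow> nat \<Rightarrow> complex \<Rightarrow> complex" where
  "sol_mon a b x = inverse (of_nat (b + 1)) * mon a (b + 1) x
     - of_nat (a - b) / of_nat ((a + 1) * (b + 1)) * mon (a - b - 1) 0 x"

text \<open>
The derivative of \<open>green_mon a b\<close> with respect to \<open>cnj x\<close>.
\<close>

definition solbar_mon :: "nat \<Rightarrow> nat \<Rightarrow> complex \<Rightarrow> complex" where
  "solbar_mon a b x = inverse (of_nat (a + 1)) * mon (a + 1) b x
     - of_nat (b - a) / of_nat ((a + 1) * (b + 1)) * mon 0 (b - a - 1) x"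

text \<open>
The Bergman projection of \<open>mon a b\<close>; the coefficient vanishes for \<open>a < b\<close>.
\<close>

definition proj_mon :: "nat \<Rightarrow> nat \<Rightarrow> complex \<Rightarrow> complex" where
  "proj_mon a b x = of_nat (a + 1 - b) / of_nat (a + 1) * mon (a - b) 0 x"

lemma wirtinger_mon:
  "has_wirtinger (mon a b) (of_nat a * mon (a - 1) b x) (of_nat b * mon a (b - 1) x) x"
proof -
  have *: "mon a b = (\<lambda>x. x ^ a * cnj x ^ b)" by (simp add: mon_def fun_eq_iff)
  show ?thesis
    unfolding *
    using has_wirtinger_mult [OF has_wirtinger_power [of a x] has_wirtinger_cnj_power [of b x]]
    by (simp add: mon_def mult_ac)
qed

lemma wirtinger_green_mon:
  "has_wirtinger (green_mon a b) (sol_mon a b x) (solbar_mon a b x) x"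
proof -
  have *: "green_mon a b = (\<lambda>x. inverse (of_nat ((a + 1) * (b + 1))) * (mon (a + 1) (b + 1) x - mon (a - b) (b - a) x))"
    by (simp add: green_mon_def fun_eq_iff)
  have 1: "of_nat (a - b) * mon (a - b - 1) (b - a) x = of_nat (a - b) * mon (a - b - 1) 0 x"
    by (cases "a \<le> b") auto
  have 2: "of_nat (b - a) * mon (a - b) (b - a - 1) x = of_nat (b - a) * mon 0 (b - a - 1) x"
    by (cases "b \<le> a") auto
  have "has_wirtinger (green_mon a b)
     (inverse (of_nat ((a + 1) * (b + 1))) * (of_nat (a + 1) * mon (a + 1 - 1) (b + 1) x - of_nat (a - b) * mon (a - b - 1) (b - a) x))
     (inverse (of_nat ((a + 1) * (b + 1))) * (of_nat (b + 1) * mon (a + 1) (b + 1 - 1) x - of_nat (b - a) * mon (a - b) (b - a - 1) x)) x"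
    unfolding * by (intro has_wirtinger_cmult has_wirtinger_diff wirtinger_mon)
  moreover have "inverse (A * B) * (A * X - c * Y) = inverse B * X - c / (A * B) * Y"
    "inverse (A * B) * (B * X - c * Y) = inverse A * X - c / (A * B) * Y"
    if "A \<noteq> 0" "B \<noteq> 0" for A B X Y c :: complex
    using that by (simp_all add: field_simps)
  moreover have "of_nat (a + 1) \<noteq> (0::complex)" "of_nat (b + 1) \<noteq> (0::complex)"
    unfolding of_nat_eq_0_iff by simp_all
  ultimately show ?thesis
    unfolding 1 2 sol_mon_def solbar_mon_def of_nat_mult by simp
qed

lemma wirtinger_sol_mon:
  "has_wirtinger (sol_mon a b)
     (inverse (of_nat (b + 1)) * (of_nat a * mon (a - 1) (b + 1) x)
       - of_nat (a - b) / of_nat ((a + 1) * (b + 1)) * (of_nat (a - b - 1) * mon (a - b - 2) 0 x))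
     (mon a b x) x"
proof -
  have *: "sol_mon a b = (\<lambda>x. inverse (of_nat (b + 1)) * mon a (b + 1) x
     - of_nat (a - b) / of_nat ((a + 1) * (b + 1)) * mon (a - b - 1) 0 x)"
    by (simp add: sol_mon_def fun_eq_iff)
  have 2: "mon a b x = inverse (of_nat (b + 1)) * (of_nat (b + 1) * mon a (b + 1 - 1) x)
     - of_nat (a - b) / of_nat ((a + 1) * (b + 1)) * (of_nat 0 * mon (a - b - 1) (0 - 1) x)"
    by (simp del: of_nat_Suc of_nat_add)
  have 3: "a - b - 2 = a - b - 1 - 1" by simp
  show ?thesis
    unfolding * 2 3 by (intro has_wirtinger_cmult has_wirtinger_diff wirtinger_mon)
qed

lemma wirtinger_solbar_mon:
  "has_wirtinger (solbar_mon a b)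
     (mon a b x)
     (inverse (of_nat (a + 1)) * (of_nat b * mon (a + 1) (b - 1) x)
       - of_nat (b - a) / of_nat ((a + 1) * (b + 1)) * (of_nat (b - a - 1) * mon 0 (b - a - 2) x)) x"
proof -
  have *: "solbar_mon a b = (\<lambda>x. inverse (of_nat (a + 1)) * mon (a + 1) b x
     - of_nat (b - a) / of_nat ((a + 1) * (b + 1)) * mon 0 (b - a - 1) x)"
    by (simp add: solbar_mon_def fun_eq_iff)
  have 2: "mon a b x = inverse (of_nat (a + 1)) * (of_nat (a + 1) * mon (a + 1 - 1) b x)
     - of_nat (b - a) / of_nat ((a + 1) * (b + 1)) * (of_nat 0 * mon (0 - 1) (b - a - 1) x)"
    by (simp del: of_nat_Suc of_nat_add)
  have 3: "b - a - 2 = b - a - 1 - 1" by simp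
  show ?thesis
    unfolding * 2 3 by (intro has_wirtinger_cmult has_wirtinger_diff wirtinger_mon)
qed

lemma wirtinger_proj_mon:
  "has_wirtinger (proj_mon a b)
     (of_nat (a + 1 - b) / of_nat (a + 1) * (of_nat (a - b) * mon (a - b - 1) 0 x)) 0 x"
proof -
  have *: "proj_mon a b = (\<lambda>x. of_nat (a + 1 - b) / of_nat (a + 1) * mon (a - b) 0 x)"
    by (simp add: proj_mon_def fun_eq_iff)
  show ?thesis
    unfolding *
    using has_wirtinger_cmult [OF wirtinger_mon [of "a - b" 0 x], of "of_nat (a + 1 - b) / of_nat (a + 1)"]
    by (simp only: of_nat_0 mult_zero_left mult_zero_right)
qed

lemma mon_decomposition: "mon a b x = proj_mon a b x + of_nat b * sol_mon a (b - 1) x"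
proof (cases b)
  case 0
  then show ?thesis by (simp add: proj_mon_def del: of_nat_Suc)
next
  case (Suc n)
  have "of_nat (a - n) * mon (a - n - 1) 0 x = of_nat (a + 1 - b) * mon (a - b) 0 x"
    by (simp add: Suc)
  moreover have "of_nat (a + 1) \<noteq> (0::complex)" "of_nat (n + 1) \<noteq> (0::complex)"
    unfolding of_nat_eq_0_iff by simp_all
  moreover have "M = P / A * Q + B * (inverse B * M - R / (A * B) * S)"
    if "R * S = P * Q" "A \<noteq> 0" "B \<noteq> 0" for A B M P Q R S :: complex
    using that by (simp add: field_simps)
  ultimately show ?thesis
    unfolding Suc sol_mon_def proj_mon_def of_nat_mult by (simp del: of_nat_Suc of_nat_add)
qed

lemma green_mon_boundary:
  assumes "cmod x = 1" shows "green_mon a b x = 0"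
proof -
  have *: "x * cnj x = 1" using assms by (metis complex_norm_square of_real_1 one_power2)
  have pow: "x ^ n * cnj x ^ n = 1" for n
    using * by (simp flip: power_mult_distrib)
  have "x ^ (n + m) * cnj x ^ n = x ^ m" for n m
    using pow [of n] by (simp add: power_add mult_ac)
  moreover have "x ^ n * cnj x ^ (n + m) = cnj x ^ m" for n m
    using pow [of n] by (simp add: power_add mult.assoc [symmetric])
  ultimately have "mon (a + 1) (b + 1) x = mon (a - b) (b - a) x"
  proof -
    assume h1: "\<And>n m. x ^ (n + m) * cnj x ^ n = x ^ m" and h2: "\<And>n m. x ^ n * cnj x ^ (n + m) = cnj x ^ m"
    show ?thesis
    proof (cases "a \<le> b")
      case True
      then show ?thesis using h2 [of "a + 1" "b - a"] by (simp add: mon_def)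
    next
      case False
      then show ?thesis using h1 [of "b + 1" "a - b"] by (simp add: mon_def)
    qed
  qed
  then show ?thesis by (simp add: green_mon_def)
qed

text \<open>
A polynomial is a list of terms with coefficient \<open>c\<close> and exponents \<open>a\<close>, \<open>b\<close>.  The parameter \<open>\<phi>\<close> says what a
monomial is replaced by, so that a linear operator given by its values on monomials is applied to a polynomial by changing
\<open>\<phi>\<close> and keeping the list.
\<close>

definition ev :: "(nat \<Rightarrow> nat \<Rightarrow> complex \<Rightarrow> complex) \<Rightarrow> (complex \<times> nat \<times> nat) list \<Rightarrow> complex \<Rightarrow> complex" where
  "ev \<phi> ts x = (\<Sum>(c, a, b)\<leftarrow>ts. c * \<phi> a b x)"

lemma ev_Nil [simp]: "ev \<phi> [] x = 0"
  and ev_Cons [simp]: "ev \<phi> ((c, a, b) # ts) x = c * \<phi> a b x + ev \<phi> ts x"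
  by (simp_all add: ev_def)

lemma has_wirtinger_ev:
  assumes "\<And>a b x. has_wirtinger (\<phi> a b) (\<phi>1 a b x) (\<phi>2 a b x) x"
  shows "has_wirtinger (ev \<phi> ts) (ev \<phi>1 ts x) (ev \<phi>2 ts x) x"
proof (induction ts)
  case Nil
  have "ev \<phi> [] = (\<lambda>x. 0)" by (simp add: fun_eq_iff)
  then show ?case by (simp add: has_wirtinger_const)
next
  case (Cons t ts)
  obtain c a b where t: "t = (c, a, b)" by (cases t)
  have "ev \<phi> (t # ts) = (\<lambda>x. c * \<phi> a b x + ev \<phi> ts x)" by (simp add: fun_eq_iff t)
  then show ?case
    using has_wirtinger_add [OF has_wirtinger_cmult [OF assms, of c] Cons.IH] by (simp add: t)
qed

lemma continuous_mon: "continuous_on S (mon a b)"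
  unfolding mon_def [abs_def] by (intro continuous_intros)

lemma continuous_sol_mon: "continuous_on S (sol_mon a b)"
  unfolding sol_mon_def [abs_def] by (intro continuous_intros continuous_mon)

lemma continuous_proj_mon: "continuous_on S (proj_mon a b)"
  unfolding proj_mon_def [abs_def] by (intro continuous_intros continuous_mon)

lemma continuous_ev:
  assumes "\<And>a b. continuous_on S (\<phi> a b)"
  shows "continuous_on S (ev \<phi> ts)"
proof -
  have "continuous_on S (\<lambda>x. ev \<phi> ts x)"
    by (induction ts) (auto intro!: continuous_intros assms)
  then show ?thesis by simp
qed

lemma disc_estimate_sol:
  "disc_integral (\<lambda>x. (cmod (ev sol_mon ts x))\<^sup>2) \<le> 4 * disc_integral (\<lambda>x. (cmod (ev mon ts x))\<^sup>2)"
proof (rule green_gradient_estimate)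
  show "has_wirtinger (ev green_mon ts) (ev sol_mon ts x) (ev solbar_mon ts x) x" for x
    by (intro has_wirtinger_ev wirtinger_green_mon)
  show "has_wirtinger (ev sol_mon ts) (ev (\<lambda>a b x. inverse (of_nat (b + 1)) * (of_nat a * mon (a - 1) (b + 1) x)
       - of_nat (a - b) / of_nat ((a + 1) * (b + 1)) * (of_nat (a - b - 1) * mon (a - b - 2) 0 x)) ts x) (ev mon ts x) x" for x
    by (intro has_wirtinger_ev wirtinger_sol_mon)
  show "has_wirtinger (ev solbar_mon ts) (ev mon ts x) (ev (\<lambda>a b x. inverse (of_nat (a + 1)) * (of_nat b * mon (a + 1) (b - 1) x)
       - of_nat (b - a) / of_nat ((a + 1) * (b + 1)) * (of_nat (b - a - 1) * mon 0 (b - a - 2) x)) ts x) x" for x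
    by (intro has_wirtinger_ev wirtinger_solbar_mon)
  show "ev green_mon ts x = 0" if "cmod x = 1" for x
    by (induction ts) (auto simp: green_mon_boundary [OF that])
qed (rule continuous_ev, intro continuous_on_diff continuous_on_mult_left continuous_mon)+

lemma disc_estimate_proj:
  "disc_integral (\<lambda>x. (cmod (ev proj_mon ts x))\<^sup>2) \<le> disc_integral (\<lambda>x. (cmod (ev mon ts x))\<^sup>2)"
proof -
  let ?v = "\<lambda>a b x. of_nat b * green_mon a (b - 1) x"
  let ?p = "\<lambda>a b x. of_nat b * sol_mon a (b - 1) x"
  let ?q = "\<lambda>a b x. of_nat b * solbar_mon a (b - 1) x"
  let ?f = "\<lambda>a b x. of_nat (a + 1 - b) / of_nat (a + 1) * (of_nat (a - b) * mon (a - b - 1) 0 x)"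
  have "disc_integral (\<lambda>x. (cmod (ev proj_mon ts x))\<^sup>2)
      \<le> disc_integral (\<lambda>x. (cmod (ev proj_mon ts x + ev ?p ts x))\<^sup>2)"
  proof (rule bergman_projection_estimate)
    show "has_wirtinger (ev ?v ts) (ev ?p ts x) (ev ?q ts x) x" for x
      by (intro has_wirtinger_ev has_wirtinger_cmult wirtinger_green_mon)
    have "ev (\<lambda>a b x. 0) ts x = 0" for x by (induction ts) auto
    then show "has_wirtinger (ev proj_mon ts) (ev ?f ts x) 0 x" for x
      using has_wirtinger_ev [of proj_mon ?f "\<lambda>a b x. 0" ts x] wirtinger_proj_mon by simp
    show "ev ?v ts x = 0" if "cmod x = 1" for x
      by (induction ts) (auto simp: green_mon_boundary [OF that])
    show "continuous_on UNIV (ev ?q ts)"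
      unfolding solbar_mon_def
      by (rule continuous_ev, intro continuous_on_diff continuous_on_mult_left continuous_mon)
  qed (rule continuous_ev, intro continuous_on_mult_left continuous_mon continuous_sol_mon)+
  also have "(\<lambda>x. ev proj_mon ts x + ev ?p ts x) = ev mon ts"
  proof
    show "ev proj_mon ts x + ev ?p ts x = ev mon ts x" for x
      by (induction ts) (auto simp: mon_decomposition [of _ _ x] distrib_left)
  qed
  then have "(\<lambda>x. (cmod (ev proj_mon ts x + ev ?p ts x))\<^sup>2) = (\<lambda>x. (cmod (ev mon ts x))\<^sup>2)"
    by metis
  finally show ?thesis .
qed

lemma nn_integral_disc:
  assumes "continuous_on UNIV f"
  shows "(\<integral>\<^sup>+x. ennreal ((cmod (f x))\<^sup>2) * indicator (ball 0 1) x \<partial>lborel)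
    = ennreal (disc_integral (\<lambda>x. (cmod (f x))\<^sup>2))"
proof -
  have "AE x in lborel. x \<notin> sphere (0::complex) 1"
    using negligible_sphere [of 0 1] AE_not_in by (metis AE_completion_iff negligible_iff_null_sets)
  then have "AE x in lborel. ennreal ((cmod (f x))\<^sup>2) * indicator (ball 0 1) x
      = ennreal (indicator (cball 0 1) x *\<^sub>R (cmod (f x))\<^sup>2)"
    by eventually_elim (auto split: split_indicator)
  then have "(\<integral>\<^sup>+x. ennreal ((cmod (f x))\<^sup>2) * indicator (ball 0 1) x \<partial>lborel)
      = (\<integral>\<^sup>+x. ennreal (indicator (cball 0 1) x *\<^sub>R (cmod (f x))\<^sup>2) \<partial>lborel)"
    by (rule nn_integral_cong_AE)
  also have "\<dots> = ennreal (disc_integral (\<lambda>x. (cmod (f x))\<^sup>2))"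
    unfolding disc_integral_def set_lebesgue_integral_def
    by (intro nn_integral_eq_integral set_integrable_disc [unfolded set_integrable_def])
       (auto intro!: continuous_intros assms)
  finally show ?thesis .
qed

definition disc_sq :: "(complex \<Rightarrow> complex) \<Rightarrow> ennreal" where
  "disc_sq f = (\<integral>\<^sup>+x. ennreal ((cmod (f x))\<^sup>2) * indicator (ball 0 1) x \<partial>lborel)"

lemma disc_sq_eq: "continuous_on UNIV f \<Longrightarrow> disc_sq f = ennreal (disc_integral (\<lambda>x. (cmod (f x))\<^sup>2))"
  by (simp add: disc_sq_def nn_integral_disc)

lemma disc_sq_sol: "disc_sq (ev sol_mon ts) \<le> 4 * disc_sq (ev mon ts)"
proof -
  have "disc_sq (ev sol_mon ts) = ennreal (disc_integral (\<lambda>x. (cmod (ev sol_mon ts x))\<^sup>2))"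
    by (intro disc_sq_eq continuous_ev continuous_sol_mon)
  also have "\<dots> \<le> ennreal (4 * disc_integral (\<lambda>x. (cmod (ev mon ts x))\<^sup>2))"
    by (intro ennreal_leI disc_estimate_sol)
  also have "\<dots> = 4 * ennreal (disc_integral (\<lambda>x. (cmod (ev mon ts x))\<^sup>2))"
    by (subst ennreal_mult') auto
  also have "ennreal (disc_integral (\<lambda>x. (cmod (ev mon ts x))\<^sup>2)) = disc_sq (ev mon ts)"
    by (intro disc_sq_eq [symmetric] continuous_ev continuous_mon)
  finally show ?thesis .
qed

lemma disc_sq_proj: "disc_sq (ev proj_mon ts) \<le> disc_sq (ev mon ts)"
proof -
  have "disc_sq (ev proj_mon ts) = ennreal (disc_integral (\<lambda>x. (cmod (ev proj_mon ts x))\<^sup>2))"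
    by (intro disc_sq_eq continuous_ev continuous_proj_mon)
  also have "\<dots> \<le> ennreal (disc_integral (\<lambda>x. (cmod (ev mon ts x))\<^sup>2))"
    by (intro ennreal_leI disc_estimate_proj)
  also have "\<dots> = disc_sq (ev mon ts)"
    by (intro disc_sq_eq [symmetric] continuous_ev continuous_mon)
  finally show ?thesis .
qed

section \<open>Polynomials on the bidisc\<close>

text \<open>
A term \<open>(c, a, b, k, l)\<close> stands for \<open>c z\<^sup>a \<bar>z\<^sup>b w\<^sup>k \<bar>w\<^sup>l\<close>.
\<close>

type_synonym bipoly = "(complex \<times> nat \<times> nat \<times> nat \<times> nat) list"

definition ev2 :: "(nat \<Rightarrow> nat \<Rightarrow> complex \<Rightarrow> complex) \<Rightarrow> (nat \<Rightarrow> nat \<Rightarrow> complex \<Rightarrow> complex) \<Rightarrow>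
    bipoly \<Rightarrow> C2 \<Rightarrow> complex" where
  "ev2 \<phi> \<psi> ts x = (\<Sum>(c, a, b, k, l)\<leftarrow>ts. c * (\<phi> a b (fst x) * \<psi> k l (snd x)))"

lemma ev2_Nil [simp]: "ev2 \<phi> \<psi> [] x = 0"
  and ev2_Cons [simp]: "ev2 \<phi> \<psi> ((c, a, b, k, l) # ts) x
    = c * (\<phi> a b (fst x) * \<psi> k l (snd x)) + ev2 \<phi> \<psi> ts x"
  by (simp_all add: ev2_def)

lemma ev2_append: "ev2 \<phi> \<psi> (ts @ us) x = ev2 \<phi> \<psi> ts x + ev2 \<phi> \<psi> us x"
  by (simp add: ev2_def)

definition neg_poly :: "bipoly \<Rightarrow> bipoly" where
  "neg_poly ts = map (\<lambda>(c, r). (- c, r)) ts"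

lemma ev2_neg: "ev2 \<phi> \<psi> (neg_poly ts) x = - ev2 \<phi> \<psi> ts x"
  by (induction ts) (auto simp: neg_poly_def)

lemma continuous_ev2:
  assumes \<phi>: "\<And>a b. continuous_on UNIV (\<phi> a b)" and \<psi>: "\<And>a b. continuous_on UNIV (\<psi> a b)"
  shows "continuous_on S (ev2 \<phi> \<psi> ts)"
proof -
  have "continuous_on S (\<lambda>x. \<phi> a b (fst x))" for a b
    by (rule continuous_on_compose2 [OF \<phi>]) (auto intro: continuous_intros)
  moreover have "continuous_on S (\<lambda>x. \<psi> a b (snd x))" for a b
    by (rule continuous_on_compose2 [OF \<psi>]) (auto intro: continuous_intros)
  ultimately have "continuous_on S (\<lambda>x. ev2 \<phi> \<psi> ts x)"
    by (induction ts) (auto intro!: continuous_on_add continuous_on_mult)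
  then show ?thesis by simp
qed

lemma ev2_slice_fst: "ev2 \<phi> \<psi> ts (z, w) = ev \<phi> (map (\<lambda>(c, a, b, k, l). (c * \<psi> k l w, a, b)) ts) z"
  by (induction ts) auto

lemma ev2_slice_snd: "ev2 \<phi> \<psi> ts (z, w) = ev \<psi> (map (\<lambda>(c, a, b, k, l). (c * \<phi> a b z, k, l)) ts) w"
  by (induction ts) auto

lemma unit_disc_measurable [measurable]: "ball (0::complex) 1 \<in> sets borel"
  by simp

definition bidisc_sq :: "(C2 \<Rightarrow> complex) \<Rightarrow> ennreal" where
  "bidisc_sq f = (\<integral>\<^sup>+w. disc_sq (\<lambda>z. f (z, w)) * indicator (ball 0 1) w \<partial>lborel)"

text \<open>
The norm is defined by integrating over the first variable first, which suits operators acting in that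
variable; this form suits operators acting in the second one.
\<close>

lemma bidisc_sq_swap:
  assumes [measurable]: "f \<in> borel_measurable borel"
  shows "bidisc_sq f = (\<integral>\<^sup>+z. disc_sq (\<lambda>w. f (z, w)) * indicator (ball 0 1) z \<partial>lborel)"
proof -
  have [measurable]: "f \<in> borel_measurable (lborel \<Otimes>\<^sub>M lborel)"
    unfolding lborel_prod by simp
  have "bidisc_sq f = (\<integral>\<^sup>+w. (\<integral>\<^sup>+z. ennreal ((cmod (f (z, w)))\<^sup>2) * indicator (ball 0 1) z
      * indicator (ball 0 1) w \<partial>lborel) \<partial>lborel)"
    unfolding bidisc_sq_def disc_sq_def by (intro nn_integral_cong nn_integral_multc [symmetric]) measurable
  also have "\<dots> = (\<integral>\<^sup>+z. (\<integral>\<^sup>+w. ennreal ((cmod (f (z, w)))\<^sup>2) * indicator (ball 0 1) z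
      * indicator (ball 0 1) w \<partial>lborel) \<partial>lborel)"
    by (rule lborel_pair.Fubini') measurable
  also have "\<dots> = (\<integral>\<^sup>+z. (\<integral>\<^sup>+w. ennreal ((cmod (f (z, w)))\<^sup>2) * indicator (ball 0 1) w
      * indicator (ball 0 1) z \<partial>lborel) \<partial>lborel)"
    by (simp add: mult_ac)
  also have "\<dots> = (\<integral>\<^sup>+z. disc_sq (\<lambda>w. f (z, w)) * indicator (ball 0 1) z \<partial>lborel)"
    unfolding disc_sq_def by (intro nn_integral_cong nn_integral_multc) measurable
  finally show ?thesis .
qed

lemma bidisc_sq_cmult:
  assumes [measurable]: "f \<in> borel_measurable borel"
  shows "(\<integral>\<^sup>+w. c * disc_sq (\<lambda>z. f (z, w)) * indicator (ball 0 1) w \<partial>lborel) = c * bidisc_sq f"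
proof -
  have [measurable]: "f \<in> borel_measurable (lborel \<Otimes>\<^sub>M lborel)"
    unfolding lborel_prod by simp
  show ?thesis
    unfolding bidisc_sq_def disc_sq_def mult.assoc by (intro nn_integral_cmult) measurable
qed

text \<open>
With the second variable fixed, this is the one-dimensional estimate for a polynomial whose coefficients depend on a parameter.
\<close>

lemma bidisc_sol_fst:
  assumes "\<And>a b. continuous_on UNIV (\<psi> a b)"
  shows "bidisc_sq (ev2 sol_mon \<psi> ts) \<le> 4 * bidisc_sq (ev2 mon \<psi> ts)"
proof -
  have "bidisc_sq (ev2 sol_mon \<psi> ts)
      \<le> (\<integral>\<^sup>+w. 4 * disc_sq (\<lambda>z. ev2 mon \<psi> ts (z, w)) * indicator (ball 0 1) w \<partial>lborel)"
    unfolding bidisc_sq_def ev2_slice_fst by (intro nn_integral_mono mult_right_mono disc_sq_sol) auto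
  also have "\<dots> = 4 * bidisc_sq (ev2 mon \<psi> ts)"
    by (intro bidisc_sq_cmult borel_measurable_continuous_onI continuous_ev2 continuous_mon assms)
  finally show ?thesis .
qed

lemma bidisc_proj_fst: "bidisc_sq (ev2 proj_mon \<psi> ts) \<le> bidisc_sq (ev2 mon \<psi> ts)"
  unfolding bidisc_sq_def ev2_slice_fst by (intro nn_integral_mono mult_right_mono disc_sq_proj) auto

lemma bidisc_sol_snd:
  assumes "\<And>a b. continuous_on UNIV (\<phi> a b)"
  shows "bidisc_sq (ev2 \<phi> sol_mon ts) \<le> 4 * bidisc_sq (ev2 \<phi> mon ts)"
proof -
  define f where "f = ev2 \<phi> mon ts"
  have f [measurable]: "f \<in> borel_measurable borel"
    unfolding f_def by (intro borel_measurable_continuous_onI continuous_ev2 continuous_mon assms)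
  have [measurable]: "f \<in> borel_measurable (lborel \<Otimes>\<^sub>M lborel)"
    unfolding lborel_prod by simp
  have "ev2 \<phi> sol_mon ts \<in> borel_measurable borel"
    by (intro borel_measurable_continuous_onI continuous_ev2 continuous_sol_mon assms)
  then have "bidisc_sq (ev2 \<phi> sol_mon ts)
      = (\<integral>\<^sup>+z. disc_sq (\<lambda>w. ev2 \<phi> sol_mon ts (z, w)) * indicator (ball 0 1) z \<partial>lborel)"
    by (rule bidisc_sq_swap)
  also have "\<dots> \<le> (\<integral>\<^sup>+z. 4 * (disc_sq (\<lambda>w. f (z, w)) * indicator (ball 0 1) z) \<partial>lborel)"
    unfolding f_def ev2_slice_snd mult.assoc [symmetric]
    by (intro nn_integral_mono mult_right_mono disc_sq_sol) auto
  also have "\<dots> = 4 * bidisc_sq f"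
    unfolding bidisc_sq_swap [OF f]
    unfolding disc_sq_def by (intro nn_integral_cmult) measurable
  finally show ?thesis by (simp add: f_def)
qed

definition has_wirtinger2 :: "(C2 \<Rightarrow> complex) \<Rightarrow> complex \<Rightarrow> complex \<Rightarrow> complex \<Rightarrow> complex
    \<Rightarrow> C2 \<Rightarrow> bool" where
  "has_wirtinger2 h p1 q1 p2 q2 x \<longleftrightarrow>
     (h has_derivative (\<lambda>v. p1 * fst v + q1 * cnj (fst v) + p2 * snd v + q2 * cnj (snd v))) (at x)"

lemma wirtinger_bar_eq:
  assumes "has_wirtinger2 h p1 q1 p2 q2 x"
  shows "wirtinger_bar k h x = (if k = 1 then q1 else q2)"
proof -
  have "frechet_derivative h (at x) = (\<lambda>v. p1 * fst v + q1 * cnj (fst v) + p2 * snd v + q2 * cnj (snd v))"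
    by (rule frechet_derivative_at [symmetric]) (rule assms [unfolded has_wirtinger2_def])
  then show ?thesis
    by (simp add: wirtinger_bar_def coord_vec_def complex_eq_iff)
qed

lemma has_wirtinger2_const: "has_wirtinger2 (\<lambda>x. c) 0 0 0 0 x"
  by (simp add: has_wirtinger2_def)

lemma has_wirtinger2_add:
  "has_wirtinger2 f p1 q1 p2 q2 x \<Longrightarrow> has_wirtinger2 g r1 s1 r2 s2 x \<Longrightarrow>
    has_wirtinger2 (\<lambda>x. f x + g x) (p1 + r1) (q1 + s1) (p2 + r2) (q2 + s2) x"
  unfolding has_wirtinger2_def by (drule (1) has_derivative_add) (simp add: algebra_simps)

lemma has_wirtinger2_mult:
  assumes "has_wirtinger2 f p1 q1 p2 q2 x" "has_wirtinger2 g r1 s1 r2 s2 x"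
  shows "has_wirtinger2 (\<lambda>x. f x * g x) (p1 * g x + f x * r1) (q1 * g x + f x * s1)
    (p2 * g x + f x * r2) (q2 * g x + f x * s2) x"
  using has_derivative_mult [OF assms [unfolded has_wirtinger2_def]]
  by (simp add: has_wirtinger2_def algebra_simps)

lemma has_wirtinger2_cmult:
  assumes "has_wirtinger2 f p1 q1 p2 q2 x"
  shows "has_wirtinger2 (\<lambda>x. c * f x) (c * p1) (c * q1) (c * p2) (c * q2) x"
  using has_wirtinger2_mult [OF has_wirtinger2_const assms] by simp

lemma has_wirtinger2_fst:
  assumes "has_wirtinger f p q (fst x)"
  shows "has_wirtinger2 (\<lambda>x. f (fst x)) p q 0 0 x"
proof -
  have "(fst has_derivative fst) (at x)" by (rule bounded_linear_imp_has_derivative) (rule bounded_linear_fst)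
  from diff_chain_at [OF this, of f] show ?thesis
    using assms by (simp add: has_wirtinger_def has_wirtinger2_def o_def)
qed

lemma has_wirtinger2_snd:
  assumes "has_wirtinger f p q (snd x)"
  shows "has_wirtinger2 (\<lambda>x. f (snd x)) 0 0 p q x"
proof -
  have "(snd has_derivative snd) (at x)" by (rule bounded_linear_imp_has_derivative) (rule bounded_linear_snd)
  from diff_chain_at [OF this, of f] show ?thesis
    using assms by (simp add: has_wirtinger_def has_wirtinger2_def o_def)
qed

lemma has_wirtinger2_ev2:
  assumes \<phi>: "\<And>a b x. has_wirtinger (\<phi> a b) (\<phi>1 a b x) (\<phi>2 a b x) x"
    and \<psi>: "\<And>a b x. has_wirtinger (\<psi> a b) (\<psi>1 a b x) (\<psi>2 a b x) x"
  shows "has_wirtinger2 (ev2 \<phi> \<psi> ts) (ev2 \<phi>1 \<psi> ts x) (ev2 \<phi>2 \<psi> ts x) (ev2 \<phi> \<psi>1 ts x) (ev2 \<phi> \<psi>2 ts x) x"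
proof (induction ts)
  case Nil
  have "ev2 \<phi> \<psi> [] = (\<lambda>x. 0)" by (simp add: fun_eq_iff)
  then show ?case by (simp add: has_wirtinger2_const)
next
  case (Cons t ts)
  obtain c a b k l where t: "t = (c, a, b, k, l)" by (cases t)
  have "ev2 \<phi> \<psi> (t # ts) = (\<lambda>x. c * (\<phi> a b (fst x) * \<psi> k l (snd x)) + ev2 \<phi> \<psi> ts x)"
    by (simp add: fun_eq_iff t)
  then show ?case
    using has_wirtinger2_add [OF has_wirtinger2_cmult [OF has_wirtinger2_mult
        [OF has_wirtinger2_fst [OF \<phi> [of a b "fst x"]] has_wirtinger2_snd [OF \<psi> [of k l "snd x"]]], of c] Cons.IH]
    by (simp add: t)
qed

abbreviation dbar_mon :: "nat \<Rightarrow> nat \<Rightarrow> complex \<Rightarrow> complex" where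
  "dbar_mon a b x \<equiv> of_nat b * mon a (b - 1) x"

text \<open>
The polynomial \<open>\<partial>h\<^sub>2/\<partial>\<bar>z - \<partial>h\<^sub>1/\<partial>\<bar>w\<close>, the coefficient of the exterior derivative of
\<open>h\<^sub>1 d\<bar>z + h\<^sub>2 d\<bar>w\<close>.
\<close>

definition curl :: "bipoly \<Rightarrow> bipoly \<Rightarrow> bipoly" where
  "curl h1 h2 = map (\<lambda>(c, a, b, k, l). (c * of_nat b, a, b - 1, k, l)) h2
     @ map (\<lambda>(c, a, b, k, l). (- c * of_nat l, a, b, k, l - 1)) h1"

lemma ev2_curl:
  "ev2 \<phi> \<psi> (curl h1 h2) x
    = ev2 (\<lambda>a b x. of_nat b * \<phi> a (b - 1) x) \<psi> h2 x - ev2 \<phi> (\<lambda>a b x. of_nat b * \<psi> a (b - 1) x) h1 x"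
proof -
  have "ev2 \<phi> \<psi> (map (\<lambda>(c, a, b, k, l). (c * of_nat b, a, b - 1, k, l)) h2) x
      = ev2 (\<lambda>a b x. of_nat b * \<phi> a (b - 1) x) \<psi> h2 x"
    by (induction h2) auto
  moreover have "ev2 \<phi> \<psi> (map (\<lambda>(c, a, b, k, l). (- c * of_nat l, a, b, k, l - 1)) h1) x
      = - ev2 \<phi> (\<lambda>a b x. of_nat b * \<psi> a (b - 1) x) h1 x"
    by (induction h1) auto
  ultimately show ?thesis by (simp add: curl_def ev2_append)
qed

text \<open>
The function \<open>S\<^sub>1 h\<^sub>1 + P\<^sub>1 S\<^sub>2 h\<^sub>2\<close>.  The projection keeps the second summand holomorphic in the first variable, so that
it does not disturb the first equation.
\<close>

definition potential :: "bipoly \<Rightarrow> bipoly \<Rightarrow> C2 \<Rightarrow> complex" where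
  "potential h1 h2 x = ev2 sol_mon mon h1 x + ev2 proj_mon sol_mon h2 x"

text \<open>
The derivative of the second summand with respect to \<open>\<bar>w\<close> is \<open>P\<^sub>1 h\<^sub>2 = h\<^sub>2 - S\<^sub>1 \<partial>h\<^sub>2/\<partial>\<bar>z\<close> and that of the first is
\<open>S\<^sub>1 \<partial>h\<^sub>1/\<partial>\<bar>w\<close>, because operators in different variables commute.
\<close>

lemma wirtinger_potential:
  "\<exists>p1 p2. has_wirtinger2 (potential h1 h2) p1 (ev2 mon mon h1 x) p2
     (ev2 mon mon h2 x - ev2 sol_mon mon (curl h1 h2) x) x"
proof -
  let ?P = "\<lambda>a b x. of_nat (a + 1 - b) / of_nat (a + 1) * (of_nat (a - b) * mon (a - b - 1) 0 x)"
  let ?S = "\<lambda>a b x. inverse (of_nat (b + 1)) * (of_nat a * mon (a - 1) (b + 1) x)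
       - of_nat (a - b) / of_nat ((a + 1) * (b + 1)) * (of_nat (a - b - 1) * mon (a - b - 2) 0 x)"
  let ?M = "\<lambda>a b x. of_nat a * mon (a - 1) b x"
  have A: "has_wirtinger2 (ev2 sol_mon mon h1) (ev2 ?S mon h1 x) (ev2 mon mon h1 x)
      (ev2 sol_mon ?M h1 x) (ev2 sol_mon dbar_mon h1 x) x"
    by (intro has_wirtinger2_ev2 wirtinger_sol_mon wirtinger_mon)
  have B: "has_wirtinger2 (ev2 proj_mon sol_mon h2) (ev2 ?P sol_mon h2 x) (ev2 (\<lambda>a b x. 0) sol_mon h2 x)
      (ev2 proj_mon ?S h2 x) (ev2 proj_mon mon h2 x) x"
    by (intro has_wirtinger2_ev2 wirtinger_sol_mon wirtinger_proj_mon)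
  have zero: "ev2 (\<lambda>a b x. 0) sol_mon h2 x = 0" by (induction h2) auto
  have decomposition: "ev2 mon mon h2 x
      = ev2 proj_mon mon h2 x + ev2 (\<lambda>a b x. of_nat b * sol_mon a (b - 1) x) mon h2 x"
  proof (induction h2)
    case (Cons t h2)
    obtain c a b k l where "t = (c, a, b, k, l)" by (cases t)
    then show ?case
      using Cons mon_decomposition [of a b "fst x"] by (simp add: algebra_simps)
  qed simp
  obtain p1 p2 where "has_wirtinger2 (potential h1 h2) p1 (ev2 mon mon h1 x + ev2 (\<lambda>a b x. 0) sol_mon h2 x)
      p2 (ev2 sol_mon dbar_mon h1 x + ev2 proj_mon mon h2 x) x"
    using has_wirtinger2_add [OF A B] unfolding potential_def [abs_def] by blast
  moreover have "ev2 sol_mon dbar_mon h1 x + ev2 proj_mon mon h2 x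
      = ev2 mon mon h2 x - ev2 sol_mon mon (curl h1 h2) x"
    by (simp only: decomposition ev2_curl) simp
  ultimately have "has_wirtinger2 (potential h1 h2) p1 (ev2 mon mon h1 x) p2
      (ev2 mon mon h2 x - ev2 sol_mon mon (curl h1 h2) x) x"
    by (simp only: zero add_0_right)
  then show ?thesis by blast
qed

section \<open>The Hartogs triangle in bidisc coordinates\<close>

abbreviation T where "T \<equiv> hartogs_triangle"

text \<open>
Squares of norms are used throughout, with values in \<open>ennreal\<close>: they need no integrability
assumptions, and \<open>|a + b|\<^sup>2 \<le> 2 |a|\<^sup>2 + 2 |b|\<^sup>2\<close> replaces the triangle inequality.
\<close>

definition T_sq :: "(C2 \<Rightarrow> complex) \<Rightarrow> ennreal" where
  "T_sq f = (\<integral>\<^sup>+x. ennreal ((cmod (f x))\<^sup>2) \<partial>lebesgue_on T)"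

lemma open_hartogs: "open T"
proof -
  have "T = {x. cmod (fst x) < cmod (snd x)} \<inter> {x. cmod (snd x) < 1}"
    by (auto simp: hartogs_triangle_def)
  also have "open \<dots>"
    by (intro open_Int open_Collect_less continuous_intros)
  finally show ?thesis .
qed

lemma T_borel [measurable]: "T \<in> sets borel"
  using open_hartogs by simp

lemma T_lebesgue [measurable]: "T \<in> sets lebesgue"
  using T_borel sets_completionI_sets by (metis sets_lborel)

lemma T_sq_eq:
  "T_sq f = (\<integral>\<^sup>+x. ennreal ((cmod (f x))\<^sup>2) * indicator T x \<partial>lborel)"
  unfolding T_sq_def by (subst nn_integral_restrict_space) (auto simp: nn_integral_completion)

text \<open>
The slice of the triangle at \<open>w\<close> is the disc of radius \<open>|w|\<close>, which is \<open>w\<close> times the unit disc.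
\<close>

lemma nn_integral_T_slices:
  assumes [measurable]: "f \<in> borel_measurable borel"
  shows "(\<integral>\<^sup>+x. f x * indicator T x \<partial>lborel)
    = (\<integral>\<^sup>+w. (\<integral>\<^sup>+z. f (z * w, w) * ennreal ((cmod w)\<^sup>2) * indicator (ball 0 1) z \<partial>lborel)
        * indicator (ball 0 1) w \<partial>lborel)"
proof -
  have [measurable]: "f \<in> borel_measurable (lborel \<Otimes>\<^sub>M lborel)"
    unfolding lborel_prod by simp
  have [measurable]: "T \<in> sets (lborel \<Otimes>\<^sub>M lborel)"
    unfolding lborel_prod by simp
  have "(\<integral>\<^sup>+x. f x * indicator T x \<partial>lborel)
      = (\<integral>\<^sup>+w. (\<integral>\<^sup>+z. f (z, w) * indicator T (z, w) \<partial>lborel) \<partial>lborel)"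
    unfolding lborel_prod [symmetric] by (rule lborel_pair.nn_integral_snd [symmetric]) measurable
  also have "\<dots> = (\<integral>\<^sup>+w. (\<integral>\<^sup>+z. f (z * w, w) * ennreal ((cmod w)\<^sup>2) * indicator (ball 0 1) z \<partial>lborel)
        * indicator (ball 0 1) w \<partial>lborel)"
  proof (rule nn_integral_cong)
    fix w :: complex
    show "(\<integral>\<^sup>+z. f (z, w) * indicator T (z, w) \<partial>lborel)
       = (\<integral>\<^sup>+z. f (z * w, w) * ennreal ((cmod w)\<^sup>2) * indicator (ball 0 1) z \<partial>lborel)
        * indicator (ball 0 1) w"
    proof (cases "w = 0")
      case True
      then show ?thesis by (simp add: hartogs_triangle_def)
    next
      case False
      have pair [measurable]: "(\<lambda>z::complex. (z * w, w)) \<in> borel_measurable borel"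
        by (intro borel_measurable_continuous_onI continuous_intros)
      have [measurable]: "(\<lambda>z. f (z * w, w)) \<in> borel_measurable borel"
        using measurable_compose [OF pair] assms by measurable
      have "(\<integral>\<^sup>+z. f (z, w) * indicator T (z, w) \<partial>lborel)
         = (\<integral>\<^sup>+z. (\<lambda>z. f (z * w, w) * indicator (ball 0 1) z * indicator (ball 0 1) w) (z / w) \<partial>lborel)"
        using False
        by (intro nn_integral_cong)
           (auto simp: hartogs_triangle_def norm_divide divide_simps split: split_indicator)
      also have "\<dots> = ennreal ((cmod w)\<^sup>2) *
           (\<integral>\<^sup>+z. f (z * w, w) * indicator (ball 0 1) z * indicator (ball 0 1) w \<partial>lborel)"
        by (rule nn_integral_complex_divide [OF False]) measurable
      also have "\<dots> = (\<integral>\<^sup>+z. f (z * w, w) * ennreal ((cmod w)\<^sup>2) * indicator (ball 0 1) z \<partial>lborel)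
          * indicator (ball 0 1) w"
        by (subst nn_integral_cmult [symmetric], simp, subst nn_integral_multc [symmetric], simp)
           (simp add: mult_ac)
      finally show ?thesis .
    qed
  qed
  finally show ?thesis .
qed

lemma T_sq_isometry:
  assumes [measurable]: "g \<in> borel_measurable borel"
  shows "T_sq g = bidisc_sq (\<lambda>x. snd x * g (fst x * snd x, snd x))"
proof -
  have "T_sq g = (\<integral>\<^sup>+w. (\<integral>\<^sup>+z. ennreal ((cmod (g (z * w, w)))\<^sup>2) * ennreal ((cmod w)\<^sup>2) * indicator (ball 0 1) z \<partial>lborel)
        * indicator (ball 0 1) w \<partial>lborel)"
    unfolding T_sq_eq by (subst nn_integral_T_slices) measurable
  also have "\<dots> = bidisc_sq (\<lambda>x. snd x * g (fst x * snd x, snd x))"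
    unfolding bidisc_sq_def disc_sq_def
    by (simp add: norm_mult power_mult_distrib ennreal_mult mult_ac)
  finally show ?thesis .
qed

lemma quotient_measurable:
  assumes \<phi>: "continuous_on UNIV \<phi>"
  shows "(\<lambda>x::C2. \<phi> (fst x / snd x, snd x) / snd x :: complex) \<in> borel_measurable borel"
proof -
  have [measurable]: "\<phi> \<in> borel_measurable borel"
    using \<phi> by (rule borel_measurable_continuous_onI)
  have pair: "(\<lambda>x::C2. (fst x / snd x, snd x)) \<in> borel_measurable borel"
    by (intro borel_measurable_Pair borel_measurable_divide borel_measurable_continuous_onI continuous_intros)
  have "(\<lambda>x. \<phi> (fst x / snd x, snd x)) \<in> borel_measurable borel"
    using measurable_compose [OF pair] by measurable
  then show ?thesis
    using borel_measurable_continuous_onI [OF continuous_on_snd [OF continuous_on_id]]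
    by (rule borel_measurable_divide)
qed

lemma T_sq_quotient:
  assumes \<phi>: "continuous_on UNIV \<phi>"
  shows "T_sq (\<lambda>x. \<phi> (fst x / snd x, snd x) / snd x) = bidisc_sq \<phi>"
proof -
  have "T_sq (\<lambda>x. \<phi> (fst x / snd x, snd x) / snd x)
     = bidisc_sq (\<lambda>x. snd x * (\<phi> (fst x * snd x / snd x, snd x) / snd x))"
    using quotient_measurable [OF \<phi>] by (subst T_sq_isometry) simp_all
  also have "\<dots> = bidisc_sq \<phi>"
    unfolding bidisc_sq_def
  proof (rule nn_integral_cong_AE)
    show "AE w in lborel. disc_sq (\<lambda>z. snd (z, w) * (\<phi> (fst (z, w) * snd (z, w) / snd (z, w), snd (z, w)) / snd (z, w)))
       * indicator (ball 0 1) w = disc_sq (\<lambda>z. \<phi> (z, w)) * indicator (ball 0 1) w"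
      using AE_lborel_singleton [of "0::complex"] by eventually_elim simp
  qed
  finally show ?thesis .
qed

lemma bidisc_sq_mono:
  assumes "\<And>z w. cmod z < 1 \<Longrightarrow> cmod w < 1 \<Longrightarrow> cmod (f (z, w)) \<le> cmod (g (z, w))"
  shows "bidisc_sq f \<le> bidisc_sq g"
proof -
  have "disc_sq (\<lambda>z. f (z, w)) \<le> disc_sq (\<lambda>z. g (z, w))" if "cmod w < 1" for w
    unfolding disc_sq_def using that
    by (intro nn_integral_mono) (auto split: split_indicator intro!: ennreal_leI power_mono assms)
  then show ?thesis
    unfolding bidisc_sq_def by (intro nn_integral_mono) (auto split: split_indicator)
qed

lemma sq_norm_add_le: "ennreal ((cmod (a + b))\<^sup>2) \<le> 2 * ennreal ((cmod a)\<^sup>2) + 2 * ennreal ((cmod b)\<^sup>2)"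
proof -
  have "(cmod (a + b))\<^sup>2 \<le> (cmod a + cmod b)\<^sup>2"
    by (intro power_mono norm_triangle_ineq) auto
  also have "\<dots> \<le> 2 * (cmod a)\<^sup>2 + 2 * (cmod b)\<^sup>2"
    using zero_le_power2 [of "cmod a - cmod b"] by (simp add: power2_eq_square algebra_simps)
  finally have "ennreal ((cmod (a + b))\<^sup>2) \<le> ennreal (2 * (cmod a)\<^sup>2 + 2 * (cmod b)\<^sup>2)"
    by (rule ennreal_leI)
  then show ?thesis by (simp add: ennreal_mult)
qed

lemma bidisc_sq_add:
  assumes [measurable]: "f \<in> borel_measurable borel" "g \<in> borel_measurable borel"
  shows "bidisc_sq (\<lambda>x. f x + g x) \<le> 2 * bidisc_sq f + 2 * bidisc_sq g"
proof -
  have [measurable]: "f \<in> borel_measurable (lborel \<Otimes>\<^sub>M lborel)" "g \<in> borel_measurable (lborel \<Otimes>\<^sub>M lborel)"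
    unfolding lborel_prod by simp_all
  have "disc_sq (\<lambda>z. f (z, w) + g (z, w)) \<le> 2 * disc_sq (\<lambda>z. f (z, w)) + 2 * disc_sq (\<lambda>z. g (z, w))" for w
  proof -
    have [measurable]: "(\<lambda>z. f (z, w)) \<in> borel_measurable lborel" "(\<lambda>z. g (z, w)) \<in> borel_measurable lborel"
      by measurable
    have "disc_sq (\<lambda>z. f (z, w) + g (z, w)) \<le> (\<integral>\<^sup>+z. 2 * (ennreal ((cmod (f (z, w)))\<^sup>2) * indicator (ball 0 1) z)
         + 2 * (ennreal ((cmod (g (z, w)))\<^sup>2) * indicator (ball 0 1) z) \<partial>lborel)"
      unfolding disc_sq_def
      by (intro nn_integral_mono) (auto split: split_indicator intro: sq_norm_add_le)
    also have "\<dots> = 2 * disc_sq (\<lambda>z. f (z, w)) + 2 * disc_sq (\<lambda>z. g (z, w))"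
      unfolding disc_sq_def by (simp add: nn_integral_add nn_integral_cmult)
    finally show ?thesis .
  qed
  then have "bidisc_sq (\<lambda>x. f x + g x) \<le> (\<integral>\<^sup>+w. 2 * (disc_sq (\<lambda>z. f (z, w)) * indicator (ball 0 1) w)
       + 2 * (disc_sq (\<lambda>z. g (z, w)) * indicator (ball 0 1) w) \<partial>lborel)"
    unfolding bidisc_sq_def by (intro nn_integral_mono) (auto split: split_indicator)
  also have "\<dots> = 2 * bidisc_sq f + 2 * bidisc_sq g"
  proof -
    have [measurable]: "(\<lambda>w. disc_sq (\<lambda>z. f (z, w))) \<in> borel_measurable lborel"
      "(\<lambda>w. disc_sq (\<lambda>z. g (z, w))) \<in> borel_measurable lborel"
      unfolding disc_sq_def by measurable
    show ?thesis
      unfolding bidisc_sq_def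
      by (subst nn_integral_add, measurable, subst (1 2) nn_integral_cmult, measurable)
  qed
  finally show ?thesis .
qed

lemma T_sq_add:
  assumes [measurable]: "f \<in> borel_measurable (lebesgue_on T)" "g \<in> borel_measurable (lebesgue_on T)"
  shows "T_sq (\<lambda>x. f x + g x) \<le> 2 * T_sq f + 2 * T_sq g"
proof -
  have "T_sq (\<lambda>x. f x + g x) \<le> (\<integral>\<^sup>+x. 2 * ennreal ((cmod (f x))\<^sup>2) + 2 * ennreal ((cmod (g x))\<^sup>2) \<partial>lebesgue_on T)"
    unfolding T_sq_def by (intro nn_integral_mono sq_norm_add_le)
  also have "\<dots> = 2 * T_sq f + 2 * T_sq g"
    unfolding T_sq_def by (subst nn_integral_add, measurable, subst (1 2) nn_integral_cmult, measurable)
  finally show ?thesis .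
qed

abbreviation poly_fun :: "bipoly \<Rightarrow> C2 \<Rightarrow> complex" where
  "poly_fun \<equiv> ev2 mon mon"

abbreviation poly_dbar1 :: "bipoly \<Rightarrow> C2 \<Rightarrow> complex" where
  "poly_dbar1 \<equiv> ev2 dbar_mon mon"

abbreviation poly_dbar2 :: "bipoly \<Rightarrow> C2 \<Rightarrow> complex" where
  "poly_dbar2 \<equiv> ev2 mon dbar_mon"

text \<open>
In the coordinates \<open>(\<zeta>, w)\<close> with \<open>z = \<zeta> w\<close> we have \<open>d\<bar>z = \<bar>w d\<bar>\<zeta> + \<bar>\<zeta> d\<bar>w\<close>, so that \<open>f\<^sub>1 d\<bar>z + f\<^sub>2 d\<bar>w\<close> becomes
\<open>\<bar>w f\<^sub>1 d\<bar>\<zeta> + (\<bar>\<zeta> f\<^sub>1 + f\<^sub>2) d\<bar>w\<close>.  The polynomials \<open>pullback1\<close> and \<open>pullback2\<close> are these components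
multiplied by \<open>w\<close>, the factor that turns the norm of \<open>T\<close> into that of the bidisc.
\<close>

definition pullback1 :: "bipoly \<Rightarrow> bipoly" where
  "pullback1 ts = map (\<lambda>(c, a, b, k, l). (c, a, b, a + k + 1, b + l + 1)) ts"

definition pullback2 :: "bipoly \<Rightarrow> bipoly \<Rightarrow> bipoly" where
  "pullback2 ts us = map (\<lambda>(c, a, b, k, l). (c, a, b + 1, a + k + 1, b + l)) ts
     @ map (\<lambda>(c, a, b, k, l). (c, a, b, a + k + 1, b + l)) us"

lemma ev_pullback1: "poly_fun (pullback1 ts) (z, w) = w * (cnj w * poly_fun ts (z * w, w))"
  unfolding pullback1_def
  by (induction ts) (auto simp: mon_def power_add power_mult_distrib algebra_simps)

lemma ev_pullback2: "poly_fun (pullback2 ts us) (z, w)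
    = w * (cnj z * poly_fun ts (z * w, w) + poly_fun us (z * w, w))"
proof -
  have "poly_fun (map (\<lambda>(c, a, b, k, l). (c, a, b + 1, a + k + 1, b + l)) ts) (z, w)
      = w * (cnj z * poly_fun ts (z * w, w))"
    by (induction ts) (auto simp: mon_def power_add power_mult_distrib algebra_simps)
  moreover have "poly_fun (map (\<lambda>(c, a, b, k, l). (c, a, b, a + k + 1, b + l)) us) (z, w)
      = w * poly_fun us (z * w, w)"
    by (induction us) (auto simp: mon_def power_add power_mult_distrib algebra_simps)
  ultimately show ?thesis
    by (simp add: pullback2_def ev2_append distrib_left)
qed

lemma ev_curl_pullback: "poly_fun (curl (pullback1 ts) (pullback2 ts us)) (z, w)
    = w * (cnj w * (poly_dbar1 us (z * w, w) - poly_dbar2 ts (z * w, w)))"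
proof -
  have 1: "poly_dbar1 (map (\<lambda>(c, a, b, k, l). (c, a, b + 1, a + k + 1, b + l)) ts) (z, w)
      - poly_dbar2 (pullback1 ts) (z, w) = - w * (cnj w * poly_dbar2 ts (z * w, w))"
  proof (induction ts)
    case (Cons t ts)
    obtain c a b k l where t: "t = (c, a, b, k, l)" by (cases t)
    have "of_nat (b + 1) * mon a b z * mon (a + k + 1) (b + l) w
        - of_nat (b + l + 1) * mon a b z * mon (a + k + 1) (b + l) w
        = - w * (cnj w * (mon a b (z * w) * (of_nat l * mon k (l - 1) w)))"
      by (cases l) (simp_all add: mon_def power_add power_mult_distrib algebra_simps)
    then have "c * (of_nat (b + 1) * mon a b z * mon (a + k + 1) (b + l) w
        - of_nat (b + l + 1) * mon a b z * mon (a + k + 1) (b + l) w)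
        = - w * (cnj w * (c * (mon a b (z * w) * (of_nat l * mon k (l - 1) w))))"
      by (simp only: mult_ac mult_minus_left mult_minus_right)
    with Cons show ?case
      by (simp add: t pullback1_def algebra_simps)
  qed (simp add: pullback1_def)
  have 2: "poly_dbar1 (map (\<lambda>(c, a, b, k, l). (c, a, b, a + k + 1, b + l)) us) (z, w)
      = w * (cnj w * poly_dbar1 us (z * w, w))"
  proof (induction us)
    case (Cons t us)
    obtain c a b k l where t: "t = (c, a, b, k, l)" by (cases t)
    have "of_nat b * mon a (b - 1) z * mon (a + k + 1) (b + l) w
        = w * (cnj w * (of_nat b * mon a (b - 1) (z * w) * mon k l w))"
      by (cases b) (simp_all add: mon_def power_add power_mult_distrib algebra_simps)
    then have "c * (of_nat b * mon a (b - 1) z * mon (a + k + 1) (b + l) w)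
        = w * (cnj w * (c * (of_nat b * mon a (b - 1) (z * w) * mon k l w)))"
      by (simp only: mult_ac)
    with Cons show ?case
      by (simp add: t algebra_simps)
  qed simp
  show ?thesis
    unfolding ev2_curl using 1 2 by (simp add: pullback2_def ev2_append algebra_simps)
qed

section \<open>A solution operator on the Hartogs triangle\<close>

definition solution_lift :: "bipoly \<Rightarrow> bipoly \<Rightarrow> C2 \<Rightarrow> complex" where
  "solution_lift ts us = potential (pullback1 ts) (pullback2 ts us)"

text \<open>
The candidate solution for the form with polynomial components \<open>ts\<close> and \<open>us\<close>; \<open>solution_error\<close> is what its
derivative with respect to \<open>\<bar>w\<close> misses when the form is not closed.
\<close>

definition solution :: "bipoly \<Rightarrow> bipoly \<Rightarrow> C2 \<Rightarrow> complex" where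
  "solution ts us x = solution_lift ts us (fst x / snd x, snd x) / snd x"

definition solution_error :: "bipoly \<Rightarrow> bipoly \<Rightarrow> C2 \<Rightarrow> complex" where
  "solution_error ts us x = ev2 sol_mon mon (curl (pullback1 ts) (pullback2 ts us)) (fst x / snd x, snd x) / snd x"

lemma continuous_potential: "continuous_on S (potential h1 h2)"
proof -
  have "continuous_on S (\<lambda>x. potential h1 h2 x)"
    unfolding potential_def
    by (intro continuous_on_add continuous_ev2 continuous_mon continuous_sol_mon continuous_proj_mon)
  then show ?thesis by simp
qed

lemma poly_fun_measurable [measurable]: "poly_fun ts \<in> borel_measurable borel"
  by (intro borel_measurable_continuous_onI continuous_ev2 continuous_mon)

lemma bidisc_weight_le:
  assumes [measurable]: "g \<in> borel_measurable borel"
  shows "bidisc_sq (\<lambda>x. snd x * (cnj (snd x) * g (fst x * snd x, snd x))) \<le> T_sq g"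
  unfolding T_sq_isometry [OF assms]
  by (rule bidisc_sq_mono) (auto simp: norm_mult mult_left_le_one_le intro!: mult_left_mono)

text \<open>
The components \<open>pullback1\<close> and \<open>pullback2\<close> have norms bounded by those of the form, since \<open>|\<zeta>|\<close> and \<open>|w|\<close> are
at most \<open>1\<close>.
\<close>

lemma T_sq_solution: "T_sq (solution ts us) \<le> 24 * (T_sq (poly_fun ts) + T_sq (poly_fun us))"
proof -
  have 1: "bidisc_sq (poly_fun (pullback1 ts)) \<le> T_sq (poly_fun ts)"
  proof -
    have "poly_fun (pullback1 ts) = (\<lambda>x. snd x * (cnj (snd x) * poly_fun ts (fst x * snd x, snd x)))"
      using ev_pullback1 by (auto simp: fun_eq_iff)
    then show ?thesis using bidisc_weight_le [of "poly_fun ts"] by simp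
  qed
  have 2: "bidisc_sq (poly_fun (pullback2 ts us)) \<le> 2 * T_sq (poly_fun ts) + 2 * T_sq (poly_fun us)"
  proof -
    define A where "A x = snd x * (cnj (fst x) * poly_fun ts (fst x * snd x, snd x))" for x
    define B where "B x = snd x * poly_fun us (fst x * snd x, snd x)" for x
    have cont: "continuous_on UNIV (\<lambda>x::C2. poly_fun ts (fst x * snd x, snd x))" for ts
      by (rule continuous_on_compose2 [OF continuous_ev2 [OF continuous_mon continuous_mon, of UNIV]])
         (auto intro!: continuous_intros)
    have m: "A \<in> borel_measurable borel" "B \<in> borel_measurable borel"
      unfolding A_def [abs_def] B_def [abs_def]
      by (intro borel_measurable_continuous_onI continuous_intros cont)+
    have "poly_fun (pullback2 ts us) = (\<lambda>x. A x + B x)"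
      using ev_pullback2 by (auto simp: fun_eq_iff A_def B_def distrib_left)
    then have "bidisc_sq (poly_fun (pullback2 ts us)) \<le> 2 * bidisc_sq A + 2 * bidisc_sq B"
      using bidisc_sq_add [OF m] by simp
    also have "\<dots> \<le> 2 * T_sq (poly_fun ts) + 2 * T_sq (poly_fun us)"
    proof (intro add_mono mult_left_mono)
      show "bidisc_sq A \<le> T_sq (poly_fun ts)"
        unfolding T_sq_isometry [OF poly_fun_measurable] A_def [abs_def]
        by (rule bidisc_sq_mono) (auto simp: norm_mult mult_left_le_one_le intro!: mult_left_mono)
      show "bidisc_sq B \<le> T_sq (poly_fun us)"
        by (simp add: T_sq_isometry B_def [abs_def])
    qed auto
    finally show ?thesis .
  qed
  have "T_sq (solution ts us) = bidisc_sq (solution_lift ts us)"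
    unfolding solution_def [abs_def] solution_lift_def by (intro T_sq_quotient continuous_potential)
  also have "\<dots> \<le> 2 * bidisc_sq (ev2 sol_mon mon (pullback1 ts)) + 2 * bidisc_sq (ev2 proj_mon sol_mon (pullback2 ts us))"
    unfolding solution_lift_def potential_def [abs_def]
    by (intro bidisc_sq_add borel_measurable_continuous_onI continuous_ev2 continuous_mon continuous_sol_mon continuous_proj_mon)
  also have "\<dots> \<le> 2 * (4 * bidisc_sq (poly_fun (pullback1 ts))) + 2 * (4 * bidisc_sq (poly_fun (pullback2 ts us)))"
  proof (intro add_mono mult_left_mono)
    show "bidisc_sq (ev2 sol_mon mon (pullback1 ts)) \<le> 4 * bidisc_sq (poly_fun (pullback1 ts))"
      by (intro bidisc_sol_fst continuous_mon)
    have "bidisc_sq (ev2 proj_mon sol_mon (pullback2 ts us)) \<le> bidisc_sq (ev2 mon sol_mon (pullback2 ts us))"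
      by (rule bidisc_proj_fst)
    also have "\<dots> \<le> 4 * bidisc_sq (poly_fun (pullback2 ts us))"
      by (intro bidisc_sol_snd continuous_mon)
    finally show "bidisc_sq (ev2 proj_mon sol_mon (pullback2 ts us)) \<le> 4 * bidisc_sq (poly_fun (pullback2 ts us))" .
  qed auto
  also have "\<dots> \<le> 2 * (4 * T_sq (poly_fun ts)) + 2 * (4 * (2 * T_sq (poly_fun ts) + 2 * T_sq (poly_fun us)))"
    by (intro add_mono mult_left_mono 1 2) auto
  also have "\<dots> = 24 * T_sq (poly_fun ts) + 16 * T_sq (poly_fun us)"
  proof -
    have "2 * (4 * a) + 2 * (4 * (2 * a + 2 * b)) = (8 + 16) * a + 16 * b" for a b :: ennreal
      by (simp only: distrib_left distrib_right mult.assoc [symmetric] add.assoc) simp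
    then show ?thesis by simp
  qed
  also have "\<dots> \<le> 24 * (T_sq (poly_fun ts) + T_sq (poly_fun us))"
    unfolding distrib_left by (intro add_mono mult_right_mono) auto
  finally show ?thesis .
qed

lemma T_sq_solution_error: "T_sq (solution_error ts us) \<le> 4 * T_sq (\<lambda>x. poly_dbar1 us x - poly_dbar2 ts x)"
proof -
  have c: "continuous_on UNIV (dbar_mon a b)" for a b
    by (intro continuous_on_mult_left continuous_mon)
  have m: "(\<lambda>x. poly_dbar1 us x - poly_dbar2 ts x) \<in> borel_measurable borel"
    by (intro borel_measurable_continuous_onI continuous_on_diff continuous_ev2 continuous_mon c)
  have "T_sq (solution_error ts us) = bidisc_sq (ev2 sol_mon mon (curl (pullback1 ts) (pullback2 ts us)))"
    unfolding solution_error_def [abs_def] by (intro T_sq_quotient continuous_ev2 continuous_mon continuous_sol_mon)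
  also have "\<dots> \<le> 4 * bidisc_sq (poly_fun (curl (pullback1 ts) (pullback2 ts us)))"
    by (intro bidisc_sol_fst continuous_mon)
  also have "poly_fun (curl (pullback1 ts) (pullback2 ts us))
      = (\<lambda>x. snd x * (cnj (snd x) * (poly_dbar1 us (fst x * snd x, snd x) - poly_dbar2 ts (fst x * snd x, snd x))))"
    using ev_curl_pullback by (auto simp: fun_eq_iff)
  also have "4 * bidisc_sq \<dots> \<le> 4 * T_sq (\<lambda>x. poly_dbar1 us x - poly_dbar2 ts x)"
    using bidisc_weight_le [OF m] by (intro mult_left_mono) auto
  finally show ?thesis .
qed

lemma wirtinger_solution:
  assumes x: "x \<in> T"
  shows "\<exists>p1 p2. has_wirtinger2 (solution ts us) p1 (poly_fun ts x) p2 (poly_fun us x - solution_error ts us x) x"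
proof -
  obtain z w where zw: "x = (z, w)" by (cases x)
  have w: "w \<noteq> 0" using x by (auto simp: zw hartogs_triangle_def)
  define y where "y = (z / w, w)"
  obtain p1 p2 where P: "has_wirtinger2 (solution_lift ts us) p1 (poly_fun (pullback1 ts) y) p2
      (poly_fun (pullback2 ts us) y - ev2 sol_mon mon (curl (pullback1 ts) (pullback2 ts us)) y) y"
    using wirtinger_potential unfolding solution_lift_def by blast
  define q1 where "q1 = poly_fun (pullback1 ts) y"
  define e where "e = ev2 sol_mon mon (curl (pullback1 ts) (pullback2 ts us)) y"
  define q2 where "q2 = poly_fun (pullback2 ts us) y - e"
  have inner: "((\<lambda>x. (fst x / snd x, snd x)) has_derivative
      (\<lambda>v. (fst v / w - z / w\<^sup>2 * snd v, snd v))) (at x)"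
    using w
    by (auto intro!: derivative_eq_intros simp: zw field_simps power2_eq_square)
  have P': "(solution_lift ts us has_derivative (\<lambda>v. p1 * fst v + q1 * cnj (fst v) + p2 * snd v + q2 * cnj (snd v)))
      (at (fst x / snd x, snd x))"
    using P by (simp add: has_wirtinger2_def y_def zw q1_def q2_def e_def)
  have "((\<lambda>x. solution_lift ts us (fst x / snd x, snd x)) has_derivative
      (\<lambda>v. p1 * (fst v / w - z / w\<^sup>2 * snd v) + q1 * cnj (fst v / w - z / w\<^sup>2 * snd v) + p2 * snd v + q2 * cnj (snd v))) (at x)"
    using diff_chain_at [OF inner P'] by (simp add: o_def)
  then have "has_wirtinger2 (\<lambda>x. solution_lift ts us (fst x / snd x, snd x)) (p1 / w) (q1 / cnj w)
      (p2 - p1 * z / w\<^sup>2) (q2 - q1 * cnj z / (cnj w)\<^sup>2) x"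
    unfolding has_wirtinger2_def by (rule has_derivative_eq_rhs) (simp add: fun_eq_iff algebra_simps)
  moreover have "has_wirtinger2 (\<lambda>x. inverse (snd x)) 0 0 (- inverse (w\<^sup>2)) 0 x"
    by (rule has_wirtinger2_snd)
       (use w in \<open>auto simp: has_wirtinger_def zw power2_eq_square intro!: derivative_eq_intros\<close>)
  ultimately have "has_wirtinger2 (\<lambda>x. solution_lift ts us (fst x / snd x, snd x) * inverse (snd x))
      (p1 / w * inverse (snd x) + solution_lift ts us (fst x / snd x, snd x) * 0)
      (q1 / cnj w * inverse (snd x) + solution_lift ts us (fst x / snd x, snd x) * 0)
      ((p2 - p1 * z / w\<^sup>2) * inverse (snd x) + solution_lift ts us (fst x / snd x, snd x) * (- inverse (w\<^sup>2)))
      ((q2 - q1 * cnj z / (cnj w)\<^sup>2) * inverse (snd x) + solution_lift ts us (fst x / snd x, snd x) * 0) x"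
    by (rule has_wirtinger2_mult)
  moreover have "solution ts us = (\<lambda>x. solution_lift ts us (fst x / snd x, snd x) * inverse (snd x))"
    by (simp add: solution_def fun_eq_iff divide_inverse)
  moreover have "q1 / cnj w * inverse (snd x) + solution_lift ts us (fst x / snd x, snd x) * 0 = poly_fun ts x"
    using w by (simp add: q1_def y_def ev_pullback1 zw field_simps)
  moreover have "(q2 - q1 * cnj z / (cnj w)\<^sup>2) * inverse (snd x) + solution_lift ts us (fst x / snd x, snd x) * 0
      = poly_fun us x - solution_error ts us x"
    using w by (simp add: q1_def q2_def y_def ev_pullback1 ev_pullback2 zw e_def solution_error_def field_simps power2_eq_square)
  ultimately show ?thesis by metis
qed

text \<open>
Linearity in the list representation: together with the bound for \<open>solution\<close> it turns Cauchy sequences of forms into Cauchy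
sequences of solutions.
\<close>

lemma solution_diff: "solution (ts @ neg_poly ts') (us @ neg_poly us') x = solution ts us x - solution ts' us' x"
proof -
  have 1: "pullback1 (ts @ neg_poly ts') = pullback1 ts @ neg_poly (pullback1 ts')"
    by (auto simp: pullback1_def neg_poly_def)
  have 2: "ev2 \<phi> \<psi> (pullback2 (ts @ neg_poly ts') (us @ neg_poly us')) y
      = ev2 \<phi> \<psi> (pullback2 ts us) y - ev2 \<phi> \<psi> (pullback2 ts' us') y" for \<phi> \<psi> y
  proof -
    have "map f (neg_poly ts) = neg_poly (map f ts)" if "\<And>c r. f (- c, r) = (\<lambda>(c, r). (- c, r)) (f (c, r))"
      for f :: "complex \<times> nat \<times> nat \<times> nat \<times> nat \<Rightarrow> complex \<times> nat \<times> nat \<times> nat \<times> nat" and ts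
      using that by (auto simp: neg_poly_def)
    then have "map (\<lambda>(c, a, b, k, l). (c, a, b + 1, a + k + 1, b + l)) (neg_poly ts')
        = neg_poly (map (\<lambda>(c, a, b, k, l). (c, a, b + 1, a + k + 1, b + l)) ts')"
      "map (\<lambda>(c, a, b, k, l). (c, a, b, a + k + 1, b + l)) (neg_poly us')
        = neg_poly (map (\<lambda>(c, a, b, k, l). (c, a, b, a + k + 1, b + l)) us')"
      by auto
    then show ?thesis by (simp add: pullback2_def ev2_append ev2_neg)
  qed
  show ?thesis
    by (simp add: solution_def solution_lift_def potential_def 1 2 ev2_append ev2_neg diff_divide_distrib add_divide_distrib)
qed

lemma potential_poly: "\<exists>L. potential h1 h2 = poly_fun L"
proof -
  have S: "\<exists>L. \<forall>x. ev2 sol_mon mon h x = poly_fun L x" for h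
  proof (induction h)
    case Nil
    show ?case by (rule exI [of _ "[]"]) simp
  next
    case (Cons t h)
    then obtain L where L: "\<forall>x. ev2 sol_mon mon h x = poly_fun L x" by blast
    obtain c a b k l where t: "t = (c, a, b, k, l)" by (cases t)
    have "ev2 sol_mon mon (t # h) x = poly_fun ((c * inverse (of_nat (b + 1)), a, b + 1, k, l) #
        (- (c * (of_nat (a - b) / of_nat ((a + 1) * (b + 1)))), a - b - 1, 0, k, l) # L) x" for x
      using L [rule_format, of x] by (simp add: t sol_mon_def left_diff_distrib right_diff_distrib mult.assoc)
    then show ?case by blast
  qed
  have P: "\<exists>L. \<forall>x. ev2 proj_mon sol_mon h x = poly_fun L x" for h
  proof (induction h)
    case Nil
    show ?case by (rule exI [of _ "[]"]) simp
  next
    case (Cons t h)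
    then obtain L where L: "\<forall>x. ev2 proj_mon sol_mon h x = poly_fun L x" by blast
    obtain c a b k l where t: "t = (c, a, b, k, l)" by (cases t)
    define d where "d = c * (of_nat (a + 1 - b) / of_nat (a + 1))"
    have "ev2 proj_mon sol_mon (t # h) x = poly_fun ((d * inverse (of_nat (l + 1)), a - b, 0, k, l + 1) #
        (- (d * (of_nat (k - l) / of_nat ((k + 1) * (l + 1)))), a - b, 0, k - l - 1, 0) # L) x" for x
    proof -
      have eq: "c * (A * M * (I * N - J * N')) = c * A * I * (M * N) + (- (c * A * J) * (M * N'))"
        for A I J M N N' :: complex by (simp add: algebra_simps)
      show ?thesis
        unfolding t ev2_Cons proj_mon_def sol_mon_def eq d_def L [rule_format, of x] by simp
    qed
    then show ?case by blast
  qed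
  obtain L1 where L1: "\<forall>x. ev2 sol_mon mon h1 x = poly_fun L1 x" using S by blast
  obtain L2 where L2: "\<forall>x. ev2 proj_mon sol_mon h2 x = poly_fun L2 x" using P by blast
  have "potential h1 h2 = poly_fun (L1 @ L2)"
    using L1 L2 by (intro ext) (simp only: potential_def ev2_append)
  then show ?thesis by blast
qed

section \<open>Cutting off the singularity at the origin\<close>

definition dir_poly :: "C2 \<Rightarrow> bipoly \<Rightarrow> bipoly" where
  "dir_poly v ts = map (\<lambda>(c, a, b, k, l). (c * (of_nat a * fst v), a - 1, b, k, l)) ts
     @ map (\<lambda>(c, a, b, k, l). (c * (of_nat b * cnj (fst v)), a, b - 1, k, l)) ts
     @ map (\<lambda>(c, a, b, k, l). (c * (of_nat k * snd v), a, b, k - 1, l)) ts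
     @ map (\<lambda>(c, a, b, k, l). (c * (of_nat l * cnj (snd v)), a, b, k, l - 1)) ts"

lemma poly_has_derivative: "(poly_fun ts has_derivative (\<lambda>v. poly_fun (dir_poly v ts) x)) (at x)"
proof -
  let ?M = "\<lambda>a b x. of_nat a * mon (a - 1) b x"
  have "has_wirtinger2 (poly_fun ts) (ev2 ?M mon ts x) (poly_dbar1 ts x) (ev2 mon ?M ts x) (poly_dbar2 ts x) x"
    by (intro has_wirtinger2_ev2 wirtinger_mon)
  moreover have "poly_fun (dir_poly v ts) x = ev2 ?M mon ts x * fst v + poly_dbar1 ts x * cnj (fst v)
      + ev2 mon ?M ts x * snd v + poly_dbar2 ts x * cnj (snd v)" for v
  proof -
    have "poly_fun (map (\<lambda>(c, a, b, k, l). (c * (of_nat a * d), a - 1, b, k, l)) ts) x = ev2 ?M mon ts x * d" for d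
      by (induction ts) (auto simp: algebra_simps)
    moreover have "poly_fun (map (\<lambda>(c, a, b, k, l). (c * (of_nat b * d), a, b - 1, k, l)) ts) x = poly_dbar1 ts x * d" for d
      by (induction ts) (auto simp: algebra_simps)
    moreover have "poly_fun (map (\<lambda>(c, a, b, k, l). (c * (of_nat k * d), a, b, k - 1, l)) ts) x = ev2 mon ?M ts x * d" for d
      by (induction ts) (auto simp: algebra_simps)
    moreover have "poly_fun (map (\<lambda>(c, a, b, k, l). (c * (of_nat l * d), a, b, k, l - 1)) ts) x = poly_dbar2 ts x * d" for d
      by (induction ts) (auto simp: algebra_simps)
    ultimately show ?thesis unfolding dir_poly_def ev2_append by simp
  qed
  ultimately show ?thesis unfolding has_wirtinger2_def by simp
qed

lemma modulus_sq_has_derivative: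
  "((\<lambda>x::C2. (cmod (snd x))\<^sup>2 + \<delta>) has_derivative (\<lambda>v. 2 * (snd x \<bullet> snd v))) (at x)"
  unfolding power2_norm_eq_inner
  by (auto intro!: derivative_eq_intros simp: inner_commute)

text \<open>
Products of a polynomial with a real power of \<open>|w|\<^sup>2 + \<delta>\<close> are closed under directional
derivatives: the factor that the derivative of the power loses is supplied by multiplying the polynomial with \<open>|w|\<^sup>2 + \<delta>\<close>.
\<close>

lemma higher_differentiable_poly_powr:
  assumes \<delta>: "0 < \<delta>"
  shows "higher_differentiable (\<lambda>x. poly_fun ts x * of_real (((cmod (snd x))\<^sup>2 + \<delta>) powr s)) n"
proof (induction n arbitrary: ts s)
  case 0
  have "(cmod (snd x))\<^sup>2 + \<delta> \<noteq> 0" for x :: "C2"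
    using \<delta> by (smt (verit) zero_le_power2)
  then show ?case
    by (auto intro!: continuous_on_mult continuous_ev2 continuous_mon continuous_on_of_real continuous_on_powr continuous_intros)
next
  case (Suc n)
  define Q where "Q x = (cmod (snd x))\<^sup>2 + \<delta>" for x :: "C2"
  have Q: "Q x > 0" for x using \<delta> by (simp add: Q_def add_nonneg_pos)
  define mulQ where "mulQ us = map (\<lambda>(c, a, b, k, l). (c, a, b, k + 1, l + 1)) us
      @ map (\<lambda>(c, a, b, k, l). (c * of_real \<delta>, a, b, k, l)) us" for us :: bipoly
  define M where "M v = map (\<lambda>(c, a, b, k, l). (c * (of_real s * cnj (snd v)), a, b, k + 1, l)) ts
      @ map (\<lambda>(c, a, b, k, l). (c * (of_real s * snd v), a, b, k, l + 1)) ts" for v :: "C2"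
  have mulQ: "poly_fun (mulQ us) x = poly_fun us x * of_real (Q x)" for us x
  proof -
    have "poly_fun (map (\<lambda>(c, a, b, k, l). (c, a, b, k + 1, l + 1)) us) x = poly_fun us x * (snd x * cnj (snd x))"
      by (induction us) (auto simp: mon_def algebra_simps)
    moreover have "poly_fun (map (\<lambda>(c, a, b, k, l). (c * of_real \<delta>, a, b, k, l)) us) x = poly_fun us x * of_real \<delta>"
      by (induction us) (auto simp: algebra_simps)
    moreover have "of_real (Q x) = snd x * cnj (snd x) + of_real \<delta>"
      by (simp only: Q_def of_real_add complex_norm_square)
    ultimately show ?thesis
      by (simp only: mulQ_def ev2_append distrib_left)
  qed
  have M: "poly_fun (M v) x = poly_fun ts x * of_real (s * (2 * (snd x \<bullet> snd v)))" for v x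
  proof -
    have "poly_fun (map (\<lambda>(c, a, b, k, l). (c * d, a, b, k + 1, l)) ts) x = poly_fun ts x * (d * snd x)" for d
      by (induction ts) (auto simp: mon_def algebra_simps)
    moreover have "poly_fun (map (\<lambda>(c, a, b, k, l). (c * d, a, b, k, l + 1)) ts) x = poly_fun ts x * (d * cnj (snd x))" for d
      by (induction ts) (auto simp: mon_def algebra_simps)
    moreover have "of_real (2 * (z \<bullet> w)) = z * cnj w + cnj z * w" for z w :: complex
      by (simp add: complex_eq_iff inner_complex_def)
    ultimately have "poly_fun (M v) x = poly_fun ts x * (of_real s * cnj (snd v) * snd x)
        + poly_fun ts x * (of_real s * snd v * cnj (snd x))"
      and "of_real (2 * (snd x \<bullet> snd v)) = snd x * cnj (snd v) + cnj (snd x) * snd v"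
      by (simp_all only: M_def ev2_append)
    then show ?thesis
      by (simp only: of_real_mult [of s]) (simp add: algebra_simps)
  qed
  have deriv: "((\<lambda>x. poly_fun ts x * of_real (Q x powr s)) has_derivative
      (\<lambda>v. poly_fun (mulQ (dir_poly v ts) @ M v) x * of_real (Q x powr (s - 1)))) (at x)" for x
  proof -
    have "((\<lambda>r. r powr s) has_derivative (\<lambda>h. s * Q x powr (s - 1) * h)) (at (Q x))"
      using has_real_derivative_powr [OF Q, of s x] by (simp add: has_field_derivative_def)
    moreover have "(Q has_derivative (\<lambda>v. 2 * (snd x \<bullet> snd v))) (at x)"
      unfolding Q_def by (rule modulus_sq_has_derivative)
    ultimately have "((\<lambda>x. Q x powr s) has_derivative (\<lambda>v. s * Q x powr (s - 1) * (2 * (snd x \<bullet> snd v)))) (at x)"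
      using diff_chain_at [of Q _ x "\<lambda>r. r powr s"] by (simp add: o_def)
    from has_derivative_mult [OF poly_has_derivative has_derivative_of_real [OF this]]
    have "((\<lambda>x. poly_fun ts x * of_real (Q x powr s)) has_derivative
      (\<lambda>v. poly_fun ts x * of_real (s * Q x powr (s - 1) * (2 * (snd x \<bullet> snd v)))
         + poly_fun (dir_poly v ts) x * of_real (Q x powr s))) (at x)" .
    moreover have "Q x powr s = Q x * Q x powr (s - 1)"
      using Q [of x] powr_mult_base [of "Q x" "s - 1"] by simp
    ultimately show ?thesis
      by (simp add: ev2_append mulQ M algebra_simps)
  qed
  have "frechet_derivative (\<lambda>x. poly_fun ts x * of_real (Q x powr s)) (at x)
      = (\<lambda>v. poly_fun (mulQ (dir_poly v ts) @ M v) x * of_real (Q x powr (s - 1)))" for x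
    by (rule frechet_derivative_at [symmetric]) (rule deriv)
  moreover have "(\<lambda>x. poly_fun ts x * of_real (Q x powr s)) differentiable (at x)" for x
    using deriv differentiable_def by blast
  ultimately show ?case
    using Suc.IH by (simp add: Q_def)
qed

lemma smooth_poly_powr:
  "0 < \<delta> \<Longrightarrow> smooth (\<lambda>x. poly_fun ts x * of_real (((cmod (snd x))\<^sup>2 + \<delta>) powr s))"
  unfolding smooth_def by (intro allI higher_differentiable_poly_powr)

text \<open>
The poles of \<open>poly_fun L (z / w, w) / w\<close> at \<open>w = 0\<close> are cancelled by a large power of \<open>|w|\<^sup>2\<close>.
\<close>

lemma clear_denominators:
  "\<exists>N0. \<forall>N\<ge>N0. \<exists>L'. \<forall>z w. w \<noteq> 0 \<longrightarrow>
     poly_fun L' (z, w) = poly_fun L (z / w, w) / w * (w ^ N * cnj w ^ N)"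
proof (induction L)
  case Nil
  show ?case by (auto intro: exI [of _ "[]"])
next
  case (Cons t L)
  obtain c a b k l where t: "t = (c, a, b, k, l)" by (cases t)
  obtain N0 where N0: "\<And>N. N \<ge> N0 \<Longrightarrow> \<exists>L'. \<forall>z w. w \<noteq> 0 \<longrightarrow>
     poly_fun L' (z, w) = poly_fun L (z / w, w) / w * (w ^ N * cnj w ^ N)"
    using Cons.IH by blast
  show ?case
  proof (rule exI, intro allI impI)
    fix N assume N: "N0 + a + b + 1 \<le> N"
    then obtain L' where L': "\<And>z w. w \<noteq> 0 \<Longrightarrow>
       poly_fun L' (z, w) = poly_fun L (z / w, w) / w * (w ^ N * cnj w ^ N)"
      using N0 [of N] by auto
    define i where "i = N - 1 - a"
    define j where "j = N - b"
    have Na: "N = Suc (i + a)" and Nb: "N = j + b" using N by (auto simp: i_def j_def)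
    have "poly_fun ((c, a, b, k + i, l + j) # L') (z, w) = poly_fun (t # L) (z / w, w) / w * (w ^ N * cnj w ^ N)"
      if w: "w \<noteq> 0" for z w
    proof -
      have "mon a b z * mon (k + i) (l + j) w = mon a b (z / w) * mon k l w / w * (w ^ Suc (i + a) * cnj w ^ (j + b))"
        using w by (simp add: mon_def power_add power_divide field_simps)
      then have "mon a b z * mon (k + i) (l + j) w = mon a b (z / w) * mon k l w / w * (w ^ N * cnj w ^ N)"
        using Na Nb by metis
      then have "c * (mon a b z * mon (k + i) (l + j) w) = c * (mon a b (z / w) * mon k l w) / w * (w ^ N * cnj w ^ N)"
        by simp
      then show ?thesis
        by (simp add: t L' [OF w] add_divide_distrib distrib_right)
    qed
    then show "\<exists>L'. \<forall>z w. w \<noteq> 0 \<longrightarrow>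
       poly_fun L' (z, w) = poly_fun (t # L) (z / w, w) / w * (w ^ N * cnj w ^ N)"
      by blast
  qed
qed

text \<open>
A function of \<open>r = |w|\<^sup>2\<close> that approximates \<open>r powr t\<close> for \<open>\<delta> \<rightarrow> 0\<close>, and vanishes at \<open>r = 0\<close> to an order that clears
denominators, while the remaining factor is smooth.
\<close>

definition cutoff :: "nat \<Rightarrow> real \<Rightarrow> real \<Rightarrow> real \<Rightarrow> real" where
  "cutoff N \<delta> t r = r ^ N * (r + \<delta>) powr (t - real N)"

definition cutoff' :: "nat \<Rightarrow> real \<Rightarrow> real \<Rightarrow> real \<Rightarrow> real" where
  "cutoff' N \<delta> t r = r ^ (N - 1) * (r + \<delta>) powr (t - real N - 1) * (real N * \<delta> + t * r)"

lemma cutoff_deriv: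
  assumes "0 < r" "0 < \<delta>" "1 \<le> N"
  shows "(cutoff N \<delta> t has_real_derivative cutoff' N \<delta> t r) (at r)"
proof -
  have pos: "r + \<delta> > 0" using assms by simp
  have "((\<lambda>r. r ^ N * (r + \<delta>) powr (t - real N)) has_real_derivative
      real N * r ^ (N - 1) * (r + \<delta>) powr (t - real N) + r ^ N * ((t - real N) * (r + \<delta>) powr (t - real N - 1))) (at r)"
    using pos by (auto intro!: derivative_eq_intros)
  moreover have "(r + \<delta>) powr (t - real N) = (r + \<delta>) * (r + \<delta>) powr (t - real N - 1)"
    using pos powr_mult_base [of "r + \<delta>" "t - real N - 1"] by simp
  moreover have "r ^ N = r * r ^ (N - 1)" using assms by (simp flip: power_Suc)
  ultimately show ?thesis
    unfolding cutoff_def [abs_def] cutoff'_def by (simp add: algebra_simps)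
qed

lemma cutoff_bounds:
  assumes "0 < r" "r < 1" "0 < \<delta>" "\<delta> \<le> 1" "0 < t" "t \<le> 1"
  shows "0 \<le> cutoff N \<delta> t r" "cutoff N \<delta> t r \<le> 2"
proof -
  show "0 \<le> cutoff N \<delta> t r" using assms by (simp add: cutoff_def)
  have "cutoff N \<delta> t r \<le> (r + \<delta>) ^ N * (r + \<delta>) powr (t - real N)"
    unfolding cutoff_def using assms by (intro mult_right_mono power_mono) auto
  also have "\<dots> = (r + \<delta>) powr t"
    using assms by (simp add: powr_realpow [symmetric] powr_add [symmetric])
  also have "\<dots> \<le> 2 powr t" using assms by (intro powr_mono2) auto
  also have "\<dots> \<le> 2 powr 1" using assms by (intro powr_mono) auto
  finally show "cutoff N \<delta> t r \<le> 2" by simp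
qed

text \<open>
The two summands of \<open>real N * \<delta> + t * r\<close> are estimated separately.  Of the factor \<open>\<delta>\<^sup>2\<close> in the square of the
first one, only \<open>\<delta> powr t\<close> is kept; the rest makes the singularity at \<open>r = 0\<close> integrable.
\<close>

lemma cutoff'_bound:
  assumes "0 < r" "0 < \<delta>" "0 < t" "t \<le> 1" "1 \<le> N"
  shows "r * (cutoff' N \<delta> t r)\<^sup>2 \<le> 2 * t\<^sup>2 * r powr (2 * t - 1) + 2 * (real N)\<^sup>2 * \<delta> powr t * r powr (t - 1)"
proof -
  define R where "R = r + \<delta>"
  have R: "0 < R" "r \<le> R" "\<delta> \<le> R" using assms by (auto simp: R_def)
  have rN: "r ^ (N - 1) = r powr (real N - 1)"
    using assms by (simp add: powr_realpow [symmetric] of_nat_diff)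
  have "r * (cutoff' N \<delta> t r)\<^sup>2 = r powr (2 * real N - 1) * R powr (2 * t - 2 * real N - 2) * (real N * \<delta> + t * r)\<^sup>2"
  proof -
    have "r * (r powr (real N - 1))\<^sup>2 = r powr (2 * real N - 1)"
      using assms by (simp add: power2_eq_square powr_add [symmetric] powr_mult_base)
    moreover have "(R powr (t - real N - 1))\<^sup>2 = R powr (2 * t - 2 * real N - 2)"
    proof -
      have e: "2 * t - 2 * real N - 2 = (t - real N - 1) + (t - real N - 1)" by simp
      show ?thesis unfolding e power2_eq_square powr_add ..
    qed
    ultimately show ?thesis
      unfolding cutoff'_def rN R_def [symmetric] by (simp add: power_mult_distrib)
  qed
  also have "\<dots> \<le> r powr (2 * real N - 1) * R powr (2 * t - 2 * real N - 2) * (2 * (real N * \<delta>)\<^sup>2 + 2 * (t * r)\<^sup>2)"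
  proof (intro mult_left_mono)
    show "(real N * \<delta> + t * r)\<^sup>2 \<le> 2 * (real N * \<delta>)\<^sup>2 + 2 * (t * r)\<^sup>2"
      using zero_le_power2 [of "real N * \<delta> - t * r"] by (simp add: power2_eq_square algebra_simps)
  qed auto
  also have "\<dots> = 2 * t\<^sup>2 * (r powr (2 * real N - 1) * r powr 2 * R powr (2 * t - 2 * real N - 2))
      + 2 * (real N)\<^sup>2 * (\<delta> powr 2 * r powr (2 * real N - 1) * R powr (2 * t - 2 * real N - 2))"
    using assms by (simp add: power_mult_distrib algebra_simps)
  also have "\<dots> \<le> 2 * t\<^sup>2 * r powr (2 * t - 1) + 2 * (real N)\<^sup>2 * (\<delta> powr t * r powr (t - 1))"
  proof (intro add_mono mult_left_mono)
    have "r powr (2 * real N - 1) * r powr 2 * R powr (2 * t - 2 * real N - 2)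
        \<le> r powr (2 * real N - 1) * r powr 2 * r powr (2 * t - 2 * real N - 2)"
      using assms R by (intro mult_left_mono powr_mono2') auto
    also have "\<dots> = r powr (2 * t - 1)" by (simp add: powr_add [symmetric])
    finally show "r powr (2 * real N - 1) * r powr 2 * R powr (2 * t - 2 * real N - 2) \<le> r powr (2 * t - 1)" .
    have "\<delta> powr 2 * r powr (2 * real N - 1) * R powr (2 * t - 2 * real N - 2)
       = (\<delta> powr t * r powr (t - 1)) * ((\<delta> powr (2 - t) * R powr (- (2 - t))) * (r powr (2 * real N - t) * R powr (- (2 * real N - t))))"
    proof -
      have "\<delta> powr 2 = \<delta> powr t * \<delta> powr (2 - t)" by (simp add: powr_add [symmetric] del: powr_numeral)
      moreover have "r powr (2 * real N - 1) = r powr (t - 1) * r powr (2 * real N - t)" by (simp add: powr_add [symmetric])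
      moreover have "R powr (2 * t - 2 * real N - 2) = R powr (- (2 - t)) * R powr (- (2 * real N - t))"
      proof -
        have e: "2 * t - 2 * real N - 2 = (- (2 - t)) + (- (2 * real N - t))" by simp
        show ?thesis unfolding e powr_add ..
      qed
      ultimately show ?thesis by (simp only: mult_ac)
    qed
    also have "\<dots> \<le> (\<delta> powr t * r powr (t - 1)) * (1 * 1)"
    proof (intro mult_left_mono mult_mono)
      have le1: "x powr a * R powr (- a) \<le> 1" if "0 < x" "x \<le> R" "0 \<le> a" for x a
      proof -
        have "x powr a * R powr (- a) \<le> R powr a * R powr (- a)"
          using that by (intro mult_right_mono powr_mono2) auto
        also have "\<dots> = 1" using R by (simp add: powr_add [symmetric])
        finally show ?thesis .
      qed
      show "\<delta> powr (2 - t) * R powr (- (2 - t)) \<le> 1" using assms R by (intro le1) auto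
      have "t \<le> 2 * real N" using assms by linarith
      then show "r powr (2 * real N - t) * R powr (- (2 * real N - t)) \<le> 1" using assms R by (intro le1) auto
    qed auto
    finally show "\<delta> powr 2 * r powr (2 * real N - 1) * R powr (2 * t - 2 * real N - 2) \<le> \<delta> powr t * r powr (t - 1)" by simp
  qed auto
  finally show ?thesis by (simp add: mult.assoc)
qed

lemma nn_integral_powr_unit:
  assumes "(0::real) < a"
  shows "(\<integral>\<^sup>+s. ennreal (s powr (a - 1)) * indicator {0..1} s \<partial>lborel) = ennreal (1 / a)"
proof -
  have "((\<lambda>x. x powr (a - 1)) has_integral (1 powr (a - 1 + 1) / (a - 1 + 1))) {0..1}"
    using assms by (intro has_integral_powr_from_0) auto
  then have "((\<lambda>x. x powr (a - 1)) has_integral (1 / a)) {0..1}" by simp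
  then show ?thesis
    by (rule nn_integral_has_integral_lebesgue' [rotated]) simp
qed

text \<open>
A disc of area \<open>\<pi> |w|\<^sup>2\<close> of points of \<open>T\<close> lies over \<open>w\<close>, which absorbs the singularity \<open>|u|\<^sup>2 \<le> C\<^sup>2 / |w|\<^sup>2\<close>.  What remains is
the Dirichlet integral of the cut-off over the unit disc.
\<close>

lemma T_sq_cutoff_gradient:
  assumes C: "\<And>x. x \<in> T \<Longrightarrow> cmod (u x) \<le> C / cmod (snd x)"
    and \<delta>: "0 < \<delta>" and t: "0 < t" "t \<le> 1" and N: "1 \<le> N"
  shows "T_sq (\<lambda>x. u x * (snd x * of_real (cutoff' N \<delta> t ((cmod (snd x))\<^sup>2))))
    \<le> ennreal (C\<^sup>2 * pi\<^sup>2 * (t + 2 * (real N)\<^sup>2 * \<delta> powr t / t))"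
proof -
  define \<beta> where "\<beta> r = 2 * t\<^sup>2 * r powr (2 * t - 1) + 2 * (real N)\<^sup>2 * \<delta> powr t * r powr (t - 1)" for r :: real
  have \<beta>0: "\<beta> r \<ge> 0" for r by (simp add: \<beta>_def)
  have [measurable]: "\<beta> \<in> borel_measurable borel" unfolding \<beta>_def [abs_def] by measurable
  have \<beta>_int: "(\<integral>\<^sup>+s. ennreal (\<beta> s) * indicator {0..1} s \<partial>lborel) = ennreal (t + 2 * (real N)\<^sup>2 * \<delta> powr t / t)"
  proof -
    have "(\<integral>\<^sup>+s. ennreal (\<beta> s) * indicator {0..1} s \<partial>lborel)
        = (\<integral>\<^sup>+s. ennreal (2 * t\<^sup>2) * (ennreal (s powr (2 * t - 1)) * indicator {0..1} s)
           + ennreal (2 * (real N)\<^sup>2 * \<delta> powr t) * (ennreal (s powr (t - 1)) * indicator {0..1} s) \<partial>lborel)"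
      by (intro nn_integral_cong) (auto simp: \<beta>_def ennreal_mult ennreal_plus split: split_indicator)
    also have "\<dots> = ennreal (2 * t\<^sup>2) * ennreal (1 / (2 * t)) + ennreal (2 * (real N)\<^sup>2 * \<delta> powr t) * ennreal (1 / t)"
      using t by (subst nn_integral_add, measurable, subst (1 2) nn_integral_cmult, measurable)
         (simp add: nn_integral_powr_unit)
    also have "\<dots> = ennreal (2 * t\<^sup>2 * (1 / (2 * t)) + 2 * (real N)\<^sup>2 * \<delta> powr t * (1 / t))"
    proof -
      have "ennreal A * ennreal B + ennreal A' * ennreal B' = ennreal (A * B + A' * B')"
        if "0 \<le> A" "0 \<le> B" "0 \<le> A'" "0 \<le> B'" for A B A' B' :: real
        using that by (simp add: ennreal_mult ennreal_plus)
      then show ?thesis using t by simp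
    qed
    also have "2 * t\<^sup>2 * (1 / (2 * t)) + 2 * (real N)\<^sup>2 * \<delta> powr t * (1 / t) = t + 2 * (real N)\<^sup>2 * \<delta> powr t / t"
      using t by (simp add: power2_eq_square)
    finally show ?thesis .
  qed
  define g where "g x = ennreal (C\<^sup>2 / (cmod (snd x))\<^sup>2 * \<beta> ((cmod (snd x))\<^sup>2))" for x :: "C2"
  have snd_m [measurable]: "(\<lambda>x::C2. cmod (snd x)) \<in> borel_measurable borel"
    by (intro borel_measurable_continuous_onI continuous_intros)
  have g_m: "g \<in> borel_measurable borel"
    unfolding g_def [abs_def] by measurable
  have "T_sq (\<lambda>x. u x * (snd x * of_real (cutoff' N \<delta> t ((cmod (snd x))\<^sup>2))))
      \<le> (\<integral>\<^sup>+x. g x * indicator T x \<partial>lborel)"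
    unfolding T_sq_eq
  proof (intro nn_integral_mono)
    fix x
    show "ennreal ((cmod (u x * (snd x * of_real (cutoff' N \<delta> t ((cmod (snd x))\<^sup>2)))))\<^sup>2) * indicator T x \<le> g x * indicator T x"
    proof (cases "x \<in> T")
      case True
      define r where "r = (cmod (snd x))\<^sup>2"
      have r: "r > 0" using True by (auto simp: r_def hartogs_triangle_def)
      have "(cmod (u x * (snd x * of_real (cutoff' N \<delta> t r))))\<^sup>2 = (cmod (u x))\<^sup>2 * (r * (cutoff' N \<delta> t r)\<^sup>2)"
        by (simp add: norm_mult power_mult_distrib r_def)
      also have "\<dots> \<le> (C / cmod (snd x))\<^sup>2 * \<beta> r"
        unfolding \<beta>_def
        by (intro mult_mono power_mono C True cutoff'_bound r \<delta> t N) (auto simp: less_imp_le [OF r])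
      finally show ?thesis using True
        by (auto simp: g_def r_def power_divide intro: ennreal_leI)
    qed simp
  qed
  also have "\<dots> = (\<integral>\<^sup>+w. (\<integral>\<^sup>+z. g (z * w, w) * ennreal ((cmod w)\<^sup>2) * indicator (ball 0 1) z \<partial>lborel)
        * indicator (ball 0 1) w \<partial>lborel)"
    by (rule nn_integral_T_slices [OF g_m])
  also have "\<dots> = (\<integral>\<^sup>+w. ennreal (C\<^sup>2 * pi) * (ennreal (\<beta> ((cmod w)\<^sup>2)) * indicator (ball 0 1) w) \<partial>lborel)"
  proof (rule nn_integral_cong_AE)
    show "AE w in lborel. (\<integral>\<^sup>+z. g (z * w, w) * ennreal ((cmod w)\<^sup>2) * indicator (ball 0 1) z \<partial>lborel)
        * indicator (ball 0 1) w = ennreal (C\<^sup>2 * pi) * (ennreal (\<beta> ((cmod w)\<^sup>2)) * indicator (ball 0 1) w)"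
      using AE_lborel_singleton [of "0::complex"]
    proof eventually_elim
      case (elim w)
      have "g (z * w, w) * ennreal ((cmod w)\<^sup>2) = ennreal (C\<^sup>2 * \<beta> ((cmod w)\<^sup>2))" for z
        using elim \<beta>0 by (simp add: g_def ennreal_mult [symmetric])
      then have "(\<integral>\<^sup>+z. g (z * w, w) * ennreal ((cmod w)\<^sup>2) * indicator (ball 0 1) z \<partial>lborel)
          = ennreal (C\<^sup>2 * \<beta> ((cmod w)\<^sup>2)) * ennreal pi"
        by (simp add: nn_integral_cmult emeasure_complex_ball)
      also have "\<dots> = ennreal (C\<^sup>2 * pi) * ennreal (\<beta> ((cmod w)\<^sup>2))"
        using \<beta>0 by (simp add: ennreal_mult [symmetric] mult_ac)
      finally show ?case by (simp add: mult.assoc)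
    qed
  qed
  also have "\<dots> = ennreal (C\<^sup>2 * pi) * (ennreal pi * (\<integral>\<^sup>+s. ennreal (\<beta> s) * indicator {0..1} s \<partial>lborel))"
    by (subst nn_integral_cmult, measurable, subst nn_integral_disc_radial, measurable)
  also have "\<dots> = ennreal (C\<^sup>2 * pi\<^sup>2 * (t + 2 * (real N)\<^sup>2 * \<delta> powr t / t))"
  proof -
    have "ennreal (C\<^sup>2 * pi) * (ennreal pi * ennreal A) = ennreal (C\<^sup>2 * pi\<^sup>2 * A)" if "0 \<le> A" for A
      using that by (simp only: ennreal_mult [symmetric] zero_le_mult_iff zero_le_power2 pi_ge_zero simp_thms)
        (simp add: power2_eq_square mult_ac)
    moreover have "0 \<le> t + 2 * (real N)\<^sup>2 * \<delta> powr t / t" using t by simp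
    ultimately show ?thesis unfolding \<beta>_int by blast
  qed
  finally show ?thesis .
qed

lemma T_subset: "T \<subseteq> cball 0 2"
proof
  fix x assume "x \<in> T"
  moreover have "norm x \<le> cmod (fst x) + cmod (snd x)"
    by (simp add: norm_prod_def sqrt_sum_squares_le_sum)
  ultimately show "x \<in> cball 0 2" by (auto simp: hartogs_triangle_def)
qed

lemma emeasure_T_finite: "emeasure lborel T < \<infinity>"
  using emeasure_mono [OF T_subset] emeasure_lborel_cball_finite [of 0 2] le_less_trans
  by (metis borel_closed closed_cball infinity_ennreal_def sets_lborel)

lemma T_sq_cong: "(\<And>x. x \<in> T \<Longrightarrow> f x = g x) \<Longrightarrow> T_sq f = T_sq g"
  unfolding T_sq_def by (rule nn_integral_cong) simp

lemma T_sq_bounded: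
  assumes "\<And>x. x \<in> T \<Longrightarrow> cmod (f x) \<le> B" "0 \<le> B"
  shows "T_sq f \<le> ennreal (B\<^sup>2) * emeasure lborel T"
proof -
  have "T_sq f \<le> (\<integral>\<^sup>+x. ennreal (B\<^sup>2) * indicator T x \<partial>lborel)"
    unfolding T_sq_eq using assms
    by (intro nn_integral_mono) (auto split: split_indicator intro!: ennreal_leI power_mono)
  then show ?thesis by (simp add: nn_integral_cmult)
qed

lemma T_sq_continuous_finite:
  assumes "continuous_on UNIV f"
  shows "T_sq f < \<infinity>"
proof -
  have "bounded (f ` cball 0 2)"
    using assms by (intro compact_imp_bounded compact_continuous_image) (auto intro: continuous_on_subset)
  then obtain B where B: "B > 0" "\<And>x. x \<in> cball 0 2 \<Longrightarrow> cmod (f x) \<le> B"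
    by (auto simp: bounded_pos)
  have "T_sq f \<le> ennreal (B\<^sup>2) * emeasure lborel T"
    using B T_subset by (intro T_sq_bounded) auto
  also have "\<dots> < \<infinity>" using emeasure_T_finite by (simp add: ennreal_mult_less_top)
  finally show ?thesis .
qed

lemma T_measurable_borel [measurable (raw)]:
  "f \<in> borel_measurable borel \<Longrightarrow> f \<in> borel_measurable (lebesgue_on T)"
  using borel_measurable_if_lebesgue_on measurable_completion measurable_restrict_space1
  by (metis measurable_lborel2)

text \<open>
The pair of \<open>u\<close> and \<open>g\<^sub>1 d\<bar>z + g\<^sub>2 d\<bar>w\<close> lies in the closure of the graph of \<open>dbar\<close> on functions that are smooth up to the
boundary.
\<close>

definition dbar_closure :: "(C2 \<Rightarrow> complex) \<Rightarrow> (C2 \<Rightarrow> complex)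
    \<Rightarrow> (C2 \<Rightarrow> complex) \<Rightarrow> bool" where
  "dbar_closure u g1 g2 \<longleftrightarrow> (\<forall>\<epsilon>>0. \<exists>v. smooth v \<and> T_sq (\<lambda>x. v x - u x) \<le> ennreal \<epsilon>
     \<and> T_sq (\<lambda>x. wirtinger_bar 1 v x - g1 x) \<le> ennreal \<epsilon>
     \<and> T_sq (\<lambda>x. wirtinger_bar 2 v x - g2 x) \<le> ennreal \<epsilon>)"

lemma T_sq_dominated:
  assumes f [measurable]: "f \<in> borel_measurable (lebesgue_on T)" and fin: "T_sq f < \<infinity>"
    and [measurable]: "\<And>n. \<kappa> n \<in> borel_measurable (lebesgue_on T)"
    and bound: "\<And>n x. x \<in> T \<Longrightarrow> cmod (\<kappa> n x) \<le> 1"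
    and lim: "\<And>x. x \<in> T \<Longrightarrow> (\<lambda>n. \<kappa> n x) \<longlonglongrightarrow> 0"
  shows "(\<lambda>n. T_sq (\<lambda>x. f x * \<kappa> n x)) \<longlonglongrightarrow> 0"
proof -
  have "(\<lambda>n. T_sq (\<lambda>x. f x * \<kappa> n x)) \<longlonglongrightarrow> (\<integral>\<^sup>+x. 0 \<partial>lebesgue_on T)"
    unfolding T_sq_def
  proof (rule nn_integral_dominated_convergence)
    show "(\<integral>\<^sup>+x. ennreal ((cmod (f x))\<^sup>2) \<partial>lebesgue_on T) < \<infinity>"
      using fin by (simp add: T_sq_def)
    show "AE x in lebesgue_on T. ennreal ((cmod (f x * \<kappa> n x))\<^sup>2) \<le> ennreal ((cmod (f x))\<^sup>2)" for n
      using bound by (intro AE_I2 ennreal_leI power_mono) (auto simp: norm_mult mult_left_le)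
    show "AE x in lebesgue_on T. (\<lambda>n. ennreal ((cmod (f x * \<kappa> n x))\<^sup>2)) \<longlonglongrightarrow> 0"
    proof (intro AE_I2)
      fix x assume "x \<in> space (lebesgue_on T)"
      then have "(\<lambda>n. ennreal ((cmod (f x * \<kappa> n x))\<^sup>2)) \<longlonglongrightarrow> ennreal ((cmod (f x * 0))\<^sup>2)"
        using lim [of x] by (intro tendsto_intros) auto
      then show "(\<lambda>n. ennreal ((cmod (f x * \<kappa> n x))\<^sup>2)) \<longlonglongrightarrow> 0" by simp
    qed
  qed auto
  then show ?thesis by simp
qed

text \<open>
The approximants are \<open>v\<^sub>n = \<kappa>\<^sub>n u\<close> with cut-offs \<open>\<kappa>\<^sub>n \<rightarrow> 1\<close>.  Their derivatives differ from \<open>\<kappa>\<^sub>n\<close> times those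
of \<open>u\<close> by \<open>u\<close> times the derivative of the cut-off, which is small since \<open>|u| \<le> C / |w|\<close>.
\<close>

lemma solution_in_closure: "dbar_closure (solution ts us) (poly_fun ts) (\<lambda>x. poly_fun us x - solution_error ts us x)"
proof -
  let ?u = "solution ts us" and ?g1 = "poly_fun ts" and ?g2 = "\<lambda>x. poly_fun us x - solution_error ts us x"
  have cont_lift: "continuous_on UNIV (solution_lift ts us)"
    unfolding solution_lift_def by (rule continuous_potential)
  have cont_error: "continuous_on UNIV (ev2 sol_mon mon (curl (pullback1 ts) (pullback2 ts us)))"
    by (intro continuous_ev2 continuous_mon continuous_sol_mon)
  have u_m: "?u \<in> borel_measurable borel"
    unfolding solution_def [abs_def] using cont_lift by (rule quotient_measurable)
  have e_m: "solution_error ts us \<in> borel_measurable borel"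
    unfolding solution_error_def [abs_def] using cont_error by (rule quotient_measurable)
  have g1_m: "?g1 \<in> borel_measurable borel" by (rule poly_fun_measurable)
  have g2_m: "?g2 \<in> borel_measurable borel"
    using e_m poly_fun_measurable [of us] by (rule borel_measurable_diff [rotated])
  have poly_fin: "T_sq (poly_fun ts) < \<infinity>" for ts
    by (intro T_sq_continuous_finite continuous_ev2 continuous_mon)
  have u_fin: "T_sq ?u < \<infinity>"
    using poly_fin [of ts] poly_fin [of us]
    by (intro le_less_trans [OF T_sq_solution]) (auto simp: ennreal_mult_less_top)
  have g2_fin: "T_sq ?g2 < \<infinity>"
  proof -
    have c: "continuous_on UNIV (dbar_mon a b)" for a b
      by (intro continuous_on_mult_left continuous_mon)
    have "T_sq (\<lambda>x. poly_dbar1 us x - poly_dbar2 ts x) < \<infinity>"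
      by (intro T_sq_continuous_finite continuous_on_diff continuous_ev2 continuous_mon c)
    then have e_fin: "T_sq (solution_error ts us) < \<infinity>"
      by (intro le_less_trans [OF T_sq_solution_error]) (auto simp: ennreal_mult_less_top)
    have "T_sq (\<lambda>x. poly_fun us x + - solution_error ts us x) \<le> 2 * T_sq (poly_fun us) + 2 * T_sq (\<lambda>x. - solution_error ts us x)"
      using e_m by (intro T_sq_add T_measurable_borel poly_fun_measurable borel_measurable_uminus)
    also have "T_sq (\<lambda>x. - solution_error ts us x) = T_sq (solution_error ts us)" by (simp add: T_sq_def)
    also have "2 * T_sq (poly_fun us) + 2 * T_sq (solution_error ts us) < \<infinity>"
      using poly_fin [of us] e_fin by (simp add: ennreal_mult_less_top)
    finally show ?thesis by simp
  qed
  obtain L where L: "solution_lift ts us = poly_fun L"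
    using potential_poly unfolding solution_lift_def by blast
  obtain N0 where N0: "\<And>N. N \<ge> N0 \<Longrightarrow> \<exists>L'. \<forall>z w. w \<noteq> 0 \<longrightarrow>
     poly_fun L' (z, w) = poly_fun L (z / w, w) / w * (w ^ N * cnj w ^ N)"
    using clear_denominators [of L] by blast
  define N where "N = max 1 N0"
  have N: "1 \<le> N" by (simp add: N_def)
  obtain L' where L': "\<And>z w. w \<noteq> 0 \<Longrightarrow>
     poly_fun L' (z, w) = poly_fun L (z / w, w) / w * (w ^ N * cnj w ^ N)"
    using N0 [of N] by (auto simp: N_def)
  obtain C where C: "\<And>x. x \<in> T \<Longrightarrow> cmod (?u x) \<le> C / cmod (snd x)"
  proof -
    have "bounded (solution_lift ts us ` (cball 0 1 \<times> cball 0 1))"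
      using cont_lift
      by (intro compact_imp_bounded compact_continuous_image compact_Times) (auto intro: continuous_on_subset)
    then obtain C where C: "\<And>y. y \<in> cball 0 1 \<times> cball 0 1 \<Longrightarrow> cmod (solution_lift ts us y) \<le> C"
      by (auto simp: bounded_iff)
    have "cmod (?u x) \<le> C / cmod (snd x)" if "x \<in> T" for x
    proof -
      have "(fst x / snd x, snd x) \<in> cball 0 1 \<times> cball 0 1"
        using that by (auto simp: hartogs_triangle_def norm_divide divide_simps)
      from C [OF this] show ?thesis by (simp add: solution_def norm_divide divide_right_mono)
    qed
    then show ?thesis by (rule that)
  qed
  \<comment> \<open>\<open>\<delta>\<close> is so small that \<open>\<delta> powr t = t\<^sup>2\<close>, which makes the bound for the gradient \<open>O(t)\<close>.\<close>
  define t where "t n = 1 / real (Suc n)" for n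
  define \<delta> where "\<delta> n = (1 / real (Suc n)) ^ (2 * Suc n)" for n
  have t: "0 < t n" "t n \<le> 1" for n by (auto simp: t_def)
  have \<delta>: "0 < \<delta> n" "\<delta> n \<le> 1" for n
    unfolding \<delta>_def by (rule zero_less_power, simp, rule power_le_one) auto
  have t_lim: "t \<longlonglongrightarrow> 0"
    unfolding t_def [abs_def] using LIMSEQ_inverse_real_of_nat by (simp add: inverse_eq_divide)
  have \<delta>_lim: "\<delta> \<longlonglongrightarrow> 0"
  proof (rule tendsto_sandwich [OF _ _ tendsto_const t_lim])
    have "\<delta> n \<le> t n ^ 1" for n
      unfolding \<delta>_def t_def by (rule power_decreasing) auto
    then show "\<forall>\<^sub>F n in sequentially. \<delta> n \<le> t n" by simp
    show "\<forall>\<^sub>F n in sequentially. 0 \<le> \<delta> n" using \<delta>(1) by (simp add: less_imp_le)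
  qed
  have \<delta>_t: "\<delta> n powr t n = (t n)\<^sup>2" for n
  proof -
    have "\<delta> n = (1 / real (Suc n)) powr real (2 * Suc n)"
      unfolding \<delta>_def by (subst powr_realpow) auto
    then have "\<delta> n powr t n = (1 / real (Suc n)) powr (real (2 * Suc n) * t n)"
      by (simp only: powr_powr)
    also have "real (2 * Suc n) * t n = 2" by (simp add: t_def field_simps)
    finally show ?thesis by (simp add: t_def)
  qed
  define \<kappa> where "\<kappa> n x = complex_of_real (cutoff N (\<delta> n) (t n) ((cmod (snd x))\<^sup>2))" for n and x :: "C2"
  define \<kappa>' where "\<kappa>' n x = snd x * complex_of_real (cutoff' N (\<delta> n) (t n) ((cmod (snd x))\<^sup>2))" for n and x :: "C2"
  define v where "v n x = poly_fun L' x * of_real (((cmod (snd x))\<^sup>2 + \<delta> n) powr (t n - real N))" for n x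
  have r: "0 < (cmod (snd x))\<^sup>2" "(cmod (snd x))\<^sup>2 < 1" if "x \<in> T" for x
    using that by (auto simp: hartogs_triangle_def power_less_one_iff)
  have v_smooth: "smooth (v n)" for n
    unfolding v_def [abs_def] by (intro smooth_poly_powr \<delta>)
  have v_eq: "v n x = ?u x * \<kappa> n x" if "snd x \<noteq> 0" for n x
  proof -
    have "snd x ^ N * cnj (snd x) ^ N = of_real (((cmod (snd x))\<^sup>2) ^ N)"
      unfolding of_real_power [of "(cmod (snd x))\<^sup>2" N] complex_norm_square power_mult_distrib ..
    then have "poly_fun L' x = ?u x * of_real (((cmod (snd x))\<^sup>2) ^ N)"
      using L' [OF that, of "fst x"] by (simp only: prod.collapse solution_def L)
    then show ?thesis by (simp add: v_def \<kappa>_def cutoff_def)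
  qed
  have v_bar: "wirtinger_bar 1 (v n) x = ?g1 x * \<kappa> n x"
    "wirtinger_bar 2 (v n) x = ?g2 x * \<kappa> n x + ?u x * \<kappa>' n x" if x: "x \<in> T" for n x
  proof -
    obtain p1 p2 where P: "has_wirtinger2 ?u p1 (?g1 x) p2 (?g2 x) x"
      using wirtinger_solution [OF x] by blast
    let ?c = "complex_of_real (cutoff' N (\<delta> n) (t n) ((cmod (snd x))\<^sup>2))"
    have X: "has_wirtinger2 (\<kappa> n) 0 0 (cnj (snd x) * ?c) (snd x * ?c) x"
    proof -
      have d: "((\<lambda>w. (cmod w)\<^sup>2) has_derivative (\<lambda>h. 2 * (snd x \<bullet> h))) (at (snd x))"
        unfolding power2_norm_eq_inner by (auto intro!: derivative_eq_intros simp: inner_commute)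
      have "(cutoff N (\<delta> n) (t n) has_derivative (\<lambda>h. cutoff' N (\<delta> n) (t n) ((cmod (snd x))\<^sup>2) * h)) (at ((cmod (snd x))\<^sup>2))"
        using cutoff_deriv [OF r(1) [OF x] \<delta>(1) N] by (simp add: has_field_derivative_def)
      from has_derivative_of_real [OF diff_chain_at [OF d this]]
      have "((\<lambda>w. complex_of_real (cutoff N (\<delta> n) (t n) ((cmod w)\<^sup>2))) has_derivative
          (\<lambda>h. of_real (cutoff' N (\<delta> n) (t n) ((cmod (snd x))\<^sup>2) * (2 * (snd x \<bullet> h))))) (at (snd x))"
        by (simp only: o_def)
      then have "has_wirtinger (\<lambda>w. complex_of_real (cutoff N (\<delta> n) (t n) ((cmod w)\<^sup>2))) (cnj (snd x) * ?c) (snd x * ?c) (snd x)"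
        unfolding has_wirtinger_def
        by (rule has_derivative_eq_rhs) (auto simp: fun_eq_iff complex_eq_iff inner_complex_def algebra_simps)
      then show ?thesis unfolding \<kappa>_def [abs_def] by (rule has_wirtinger2_snd)
    qed
    obtain p1 p2 where "has_wirtinger2 (\<lambda>x. ?u x * \<kappa> n x) p1 (?g1 x * \<kappa> n x + ?u x * 0) p2
        (?g2 x * \<kappa> n x + ?u x * (snd x * ?c)) x"
      using has_wirtinger2_mult [OF P X] by blast
    then have "has_wirtinger2 (v n) p1 (?g1 x * \<kappa> n x + ?u x * 0) p2 (?g2 x * \<kappa> n x + ?u x * (snd x * ?c)) x"
      unfolding has_wirtinger2_def
    proof (rule has_derivative_transform_within_open [OF _ open_hartogs x])
      show "?u y * \<kappa> n y = v n y" if "y \<in> T" for y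
        using that by (subst v_eq) (auto simp: hartogs_triangle_def)
    qed
    then show "wirtinger_bar 1 (v n) x = ?g1 x * \<kappa> n x"
      "wirtinger_bar 2 (v n) x = ?g2 x * \<kappa> n x + ?u x * \<kappa>' n x"
      by (simp_all add: wirtinger_bar_eq \<kappa>'_def)
  qed
  have snd_m: "(\<lambda>x::C2. (cmod (snd x))\<^sup>2) \<in> borel_measurable borel"
    by (intro borel_measurable_continuous_onI continuous_intros)
  have \<kappa>_m: "(\<lambda>x. \<kappa> n x - 1) \<in> borel_measurable borel" for n
  proof -
    have "cutoff N (\<delta> n) (t n) \<in> borel_measurable borel"
      unfolding cutoff_def [abs_def] by measurable
    from measurable_compose [OF snd_m this] show ?thesis
      unfolding \<kappa>_def [abs_def] by measurable
  qed
  have \<kappa>'_m: "\<kappa>' n \<in> borel_measurable borel" for n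
  proof -
    have s: "(\<lambda>x::C2. snd x) \<in> borel_measurable borel"
      by (intro borel_measurable_continuous_onI continuous_intros)
    have "cutoff' N (\<delta> n) (t n) \<in> borel_measurable borel"
      unfolding cutoff'_def [abs_def] by measurable
    note [measurable] = measurable_compose [OF snd_m this]
    have "(\<lambda>x::C2. complex_of_real (cutoff' N (\<delta> n) (t n) ((cmod (snd x))\<^sup>2))) \<in> borel_measurable borel"
      by measurable
    with s show ?thesis unfolding \<kappa>'_def [abs_def] by (rule borel_measurable_times)
  qed
  have small: "(\<lambda>n. T_sq (\<lambda>x. f x * (\<kappa> n x - 1))) \<longlonglongrightarrow> 0"
    if "f \<in> borel_measurable borel" "T_sq f < \<infinity>" for f
  proof (rule T_sq_dominated)
    show "f \<in> borel_measurable (lebesgue_on T)" using that by (intro T_measurable_borel)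
    show "T_sq f < \<infinity>" by fact
    show "(\<lambda>x. \<kappa> n x - 1) \<in> borel_measurable (lebesgue_on T)" for n
      by (intro T_measurable_borel \<kappa>_m)
    show "cmod (\<kappa> n x - 1) \<le> 1" if "x \<in> T" for n x
    proof -
      have "\<kappa> n x - 1 = of_real (cutoff N (\<delta> n) (t n) ((cmod (snd x))\<^sup>2) - 1)"
        by (simp add: \<kappa>_def)
      also have "cmod \<dots> = \<bar>cutoff N (\<delta> n) (t n) ((cmod (snd x))\<^sup>2) - 1\<bar>"
        by (rule norm_of_real)
      also have "\<dots> \<le> 1"
        using cutoff_bounds [OF r [OF that] \<delta> [of n] t [of n], where N = N] by (simp add: abs_le_iff)
      finally show ?thesis .
    qed
    show "(\<lambda>n. \<kappa> n x - 1) \<longlonglongrightarrow> 0" if x: "x \<in> T" for x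
    proof -
      let ?r = "(cmod (snd x))\<^sup>2"
      have "(\<lambda>n. cutoff N (\<delta> n) (t n) ?r) \<longlonglongrightarrow> ?r ^ N * (?r + 0) powr (0 - real N)"
        unfolding cutoff_def using r [OF x]
        by (intro tendsto_mult tendsto_powr tendsto_add tendsto_diff tendsto_const \<delta>_lim t_lim) auto
      also have "?r ^ N * (?r + 0) powr (0 - real N) = 1"
        using r(1) [OF x] by (simp add: powr_minus powr_realpow)
      finally have "(\<lambda>n. complex_of_real (cutoff N (\<delta> n) (t n) ?r) - 1) \<longlonglongrightarrow> of_real 1 - 1"
        by (intro tendsto_intros)
      then show ?thesis by (simp add: \<kappa>_def)
    qed
  qed
  have grad: "(\<lambda>n. T_sq (\<lambda>x. ?u x * \<kappa>' n x)) \<longlonglongrightarrow> 0"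
  proof (rule tendsto_sandwich [OF _ _ tendsto_const])
    show "\<forall>\<^sub>F n in sequentially. T_sq (\<lambda>x. ?u x * \<kappa>' n x)
        \<le> ennreal (C\<^sup>2 * pi\<^sup>2 * (t n + 2 * (real N)\<^sup>2 * t n))"
    proof (intro always_eventually allI)
      fix n
      have "2 * (real N)\<^sup>2 * \<delta> n powr t n / t n = 2 * (real N)\<^sup>2 * t n"
        using t(1) [of n] by (simp add: \<delta>_t power2_eq_square)
      then show "T_sq (\<lambda>x. ?u x * \<kappa>' n x) \<le> ennreal (C\<^sup>2 * pi\<^sup>2 * (t n + 2 * (real N)\<^sup>2 * t n))"
        using T_sq_cutoff_gradient [OF C \<delta>(1) [of n] t [of n] N] by (simp add: \<kappa>'_def)
    qed
    have "(\<lambda>n. ennreal (C\<^sup>2 * pi\<^sup>2 * (t n + 2 * (real N)\<^sup>2 * t n))) \<longlonglongrightarrow> ennreal (C\<^sup>2 * pi\<^sup>2 * (0 + 2 * (real N)\<^sup>2 * 0))"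
      by (intro tendsto_ennrealI tendsto_intros t_lim)
    then show "(\<lambda>n. ennreal (C\<^sup>2 * pi\<^sup>2 * (t n + 2 * (real N)\<^sup>2 * t n))) \<longlonglongrightarrow> 0" by simp
  qed auto
  have 0: "(\<lambda>n. T_sq (\<lambda>x. v n x - ?u x)) \<longlonglongrightarrow> 0"
  proof -
    have "T_sq (\<lambda>x. v n x - ?u x) = T_sq (\<lambda>x. ?u x * (\<kappa> n x - 1))" for n
      by (intro T_sq_cong, subst v_eq) (auto simp: hartogs_triangle_def algebra_simps)
    then show ?thesis using small [OF u_m u_fin] by simp
  qed
  have 1: "(\<lambda>n. T_sq (\<lambda>x. wirtinger_bar 1 (v n) x - ?g1 x)) \<longlonglongrightarrow> 0"
  proof -
    have "T_sq (\<lambda>x. wirtinger_bar 1 (v n) x - ?g1 x) = T_sq (\<lambda>x. ?g1 x * (\<kappa> n x - 1))" for n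
      by (intro T_sq_cong) (simp only: v_bar right_diff_distrib mult_1_right)
    then show ?thesis using small [OF g1_m poly_fin] by simp
  qed
  have 2: "(\<lambda>n. T_sq (\<lambda>x. wirtinger_bar 2 (v n) x - ?g2 x)) \<longlonglongrightarrow> 0"
  proof (rule tendsto_sandwich [OF _ _ tendsto_const])
    show "\<forall>\<^sub>F n in sequentially. T_sq (\<lambda>x. wirtinger_bar 2 (v n) x - ?g2 x)
       \<le> 2 * T_sq (\<lambda>x. ?g2 x * (\<kappa> n x - 1)) + 2 * T_sq (\<lambda>x. ?u x * \<kappa>' n x)"
    proof (intro always_eventually allI)
      fix n
      have "T_sq (\<lambda>x. wirtinger_bar 2 (v n) x - ?g2 x) = T_sq (\<lambda>x. ?g2 x * (\<kappa> n x - 1) + ?u x * \<kappa>' n x)"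
        by (intro T_sq_cong) (simp add: v_bar algebra_simps)
      also have "\<dots> \<le> 2 * T_sq (\<lambda>x. ?g2 x * (\<kappa> n x - 1)) + 2 * T_sq (\<lambda>x. ?u x * \<kappa>' n x)"
        by (intro T_sq_add T_measurable_borel borel_measurable_times g2_m u_m \<kappa>_m \<kappa>'_m)
      finally show "T_sq (\<lambda>x. wirtinger_bar 2 (v n) x - ?g2 x)
         \<le> 2 * T_sq (\<lambda>x. ?g2 x * (\<kappa> n x - 1)) + 2 * T_sq (\<lambda>x. ?u x * \<kappa>' n x)" .
    qed
    have "(\<lambda>n. 2 * T_sq (\<lambda>x. ?g2 x * (\<kappa> n x - 1)) + 2 * T_sq (\<lambda>x. ?u x * \<kappa>' n x)) \<longlonglongrightarrow> 2 * 0 + 2 * 0"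
      by (intro tendsto_add ennreal_tendsto_cmult small g2_m g2_fin grad) auto
    then show "(\<lambda>n. 2 * T_sq (\<lambda>x. ?g2 x * (\<kappa> n x - 1)) + 2 * T_sq (\<lambda>x. ?u x * \<kappa>' n x)) \<longlonglongrightarrow> 0" by simp
  qed auto
  show ?thesis
    unfolding dbar_closure_def
  proof (intro allI impI)
    fix e :: real assume "0 < e"
    define \<epsilon> where "\<epsilon> = ennreal e"
    have "0 < \<epsilon>" using \<open>0 < e\<close> by (simp add: \<epsilon>_def)
    then have "\<forall>\<^sub>F n in sequentially. T_sq (\<lambda>x. v n x - ?u x) < \<epsilon>
       \<and> T_sq (\<lambda>x. wirtinger_bar 1 (v n) x - ?g1 x) < \<epsilon> \<and> T_sq (\<lambda>x. wirtinger_bar 2 (v n) x - ?g2 x) < \<epsilon>"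
      by (intro eventually_conj order_tendstoD(2) [OF 0] order_tendstoD(2) [OF 1] order_tendstoD(2) [OF 2])
    then obtain n where "T_sq (\<lambda>x. v n x - ?u x) < \<epsilon>"
       "T_sq (\<lambda>x. wirtinger_bar 1 (v n) x - ?g1 x) < \<epsilon>" "T_sq (\<lambda>x. wirtinger_bar 2 (v n) x - ?g2 x) < \<epsilon>"
      by (auto simp: eventually_sequentially)
    then show "\<exists>v. smooth v \<and> T_sq (\<lambda>x. v x - ?u x) \<le> ennreal e
       \<and> T_sq (\<lambda>x. wirtinger_bar 1 v x - ?g1 x) \<le> ennreal e
       \<and> T_sq (\<lambda>x. wirtinger_bar 2 v x - ?g2 x) \<le> ennreal e"
      using v_smooth [of n] unfolding \<epsilon>_def by (intro exI [of _ "v n"] conjI less_imp_le)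
  qed
qed

section \<open>Polynomial approximation together with first derivatives\<close>

text \<open>
On the ball of radius \<open>6\<close> this is a polynomial, and it concentrates at \<open>0\<close> as \<open>n\<close> grows.  The radius leaves
room for differences \<open>x - y\<close> with \<open>|x| \<le> 3\<close> and \<open>|y| \<le> 3\<close>.
\<close>

definition landau_kernel :: "nat \<Rightarrow> 'a::euclidean_space \<Rightarrow> real" where
  "landau_kernel n y = max 0 (1 - (norm y)\<^sup>2 / 36) ^ Suc n"

lemma landau_kernel_nonneg: "0 \<le> landau_kernel n y"
  by (simp add: landau_kernel_def)

lemma landau_kernel_outside: "6 \<le> norm y \<Longrightarrow> landau_kernel n y = 0"
proof -
  assume "6 \<le> norm y"
  then have "6\<^sup>2 \<le> (norm y)\<^sup>2" by (intro power_mono) auto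
  then show ?thesis by (simp add: landau_kernel_def)
qed

lemma landau_kernel_inside: "norm y \<le> 6 \<Longrightarrow> landau_kernel n y = (1 - (norm y)\<^sup>2 / 36) ^ Suc n"
proof -
  assume "norm y \<le> 6"
  then have "(norm y)\<^sup>2 \<le> 6\<^sup>2" by (intro power_mono) auto
  then show ?thesis by (simp add: landau_kernel_def max_def)
qed

lemma continuous_landau_kernel: "continuous_on S (landau_kernel n)"
  unfolding landau_kernel_def [abs_def] by (intro continuous_intros) auto

lemma integrable_landau_kernel:
  fixes g :: "'a::euclidean_space \<Rightarrow> 'b::{banach, second_countable_topology}"
  assumes "continuous_on UNIV g"
  shows "integrable lborel (\<lambda>y. landau_kernel n y *\<^sub>R g y)"
proof -
  have "integrable lborel (\<lambda>y. indicator (cball 0 6) y *\<^sub>R (landau_kernel n y *\<^sub>R g y))"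
    by (intro borel_integrable_compact continuous_on_scaleR continuous_landau_kernel continuous_on_subset [OF assms]) auto
  also have "(\<lambda>y. indicator (cball 0 6) y *\<^sub>R (landau_kernel n y *\<^sub>R g y)) = (\<lambda>y. landau_kernel n y *\<^sub>R g y)"
  proof
    show "indicator (cball 0 6) y *\<^sub>R (landau_kernel n y *\<^sub>R g y) = landau_kernel n y *\<^sub>R g y" for y
      by (cases "norm y \<le> 6") (simp_all add: landau_kernel_outside)
  qed
  finally show ?thesis .
qed

definition landau_mass :: "'a::euclidean_space itself \<Rightarrow> nat \<Rightarrow> real" where
  "landau_mass _ n = (LINT y|lborel. landau_kernel n (y::'a))"

lemma integrable_landau_kernel_alone: "integrable lborel (landau_kernel n)"
  using integrable_landau_kernel [of "\<lambda>_. 1::real" n] by simp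

text \<open>
Away from \<open>0\<close> the kernel is at most \<open>\<rho> ^ Suc n\<close>, near \<open>0\<close> it is at least \<open>\<rho>' ^ Suc n\<close> with \<open>\<rho> < \<rho>'\<close>, and the ratio of the
powers tends to \<open>0\<close>.
\<close>

lemma landau_concentration:
  fixes \<delta> :: real
  assumes \<delta>: "0 < \<delta>" "\<delta> \<le> 6" and \<epsilon>: "0 < \<epsilon>"
  shows "\<forall>\<^sub>F n in sequentially. 0 < landau_mass TYPE('a::euclidean_space) n \<and>
    (LINT y:{y. \<delta> \<le> norm y}|lborel. landau_kernel n (y::'a)) \<le> \<epsilon> * landau_mass TYPE('a) n"
proof -
  define \<rho> where "\<rho> = 1 - \<delta>\<^sup>2 / 36"
  define \<rho>' where "\<rho>' = 1 - (\<delta> / 2)\<^sup>2 / 36"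
  have sq: "\<delta>\<^sup>2 \<le> 36" using power_mono [OF \<delta>(2), of 2] \<delta>(1) by simp
  have \<rho>: "0 \<le> \<rho>" "\<rho> < \<rho>'" "0 < \<rho>'" using \<delta> sq by (auto simp: \<rho>_def \<rho>'_def power_divide)
  define V where "V = measure lborel (cball (0::'a) 6)"
  define W where "W = measure lborel (cball (0::'a) (\<delta> / 2))"
  have W: "W > 0" using \<delta> by (simp add: W_def content_cball_pos)
  have V: "V > 0" by (simp add: V_def content_cball_pos)
  have lower: "\<rho>' ^ Suc n * W \<le> landau_mass TYPE('a) n" for n
  proof -
    have "\<rho>' ^ Suc n * W = (LINT y|lborel. indicator (cball (0::'a) (\<delta> / 2)) y * \<rho>' ^ Suc n)"
      by (simp add: W_def)
    also have "\<dots> \<le> (LINT y|lborel. landau_kernel n (y::'a))"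
    proof (rule integral_mono)
      show "integrable lborel (\<lambda>y::'a. indicator (cball (0::'a) (\<delta> / 2)) y * \<rho>' ^ Suc n)"
        using emeasure_lborel_cball_finite [of "0::'a" "\<delta> / 2"]
        by (intro integrable_mult_left integrable_real_indicator) auto
      show "indicator (cball (0::'a) (\<delta> / 2)) y * \<rho>' ^ Suc n \<le> landau_kernel n (y::'a)" for y :: 'a
      proof (cases "norm y \<le> \<delta> / 2")
        case True
        have "(norm y)\<^sup>2 \<le> (\<delta> / 2)\<^sup>2" using True by (intro power_mono) auto
        then have "\<rho>' \<le> 1 - (norm y)\<^sup>2 / 36" by (simp add: \<rho>'_def divide_right_mono)
        then have "\<rho>' ^ Suc n \<le> (1 - (norm y)\<^sup>2 / 36) ^ Suc n" using \<rho> by (intro power_mono) auto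
        then show ?thesis using True \<delta> by (simp add: landau_kernel_inside del: power_Suc)
      next
        case False
        then show ?thesis by (simp add: landau_kernel_nonneg)
      qed
    qed (rule integrable_landau_kernel_alone)
    finally show ?thesis by (simp add: landau_mass_def)
  qed
  have upper: "(LINT y:{y. \<delta> \<le> norm y}|lborel. landau_kernel n (y::'a)) \<le> \<rho> ^ Suc n * V" for n
  proof -
    have "(LINT y:{y. \<delta> \<le> norm y}|lborel. landau_kernel n (y::'a)) \<le> (LINT y|lborel. indicator (cball (0::'a) 6) y * \<rho> ^ Suc n)"
      unfolding set_lebesgue_integral_def
    proof (rule integral_mono)
      have "{y::'a. \<delta> \<le> norm y} \<in> sets borel"
        by (intro borel_closed closed_Collect_le continuous_intros)
      then show "integrable lborel (\<lambda>y::'a. indicator {y. \<delta> \<le> norm y} y *\<^sub>R landau_kernel n y)"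
        by (intro integrable_mult_indicator integrable_landau_kernel_alone) simp
      show "integrable lborel (\<lambda>y::'a. indicator (cball (0::'a) 6) y * \<rho> ^ Suc n)"
        using emeasure_lborel_cball_finite [of "0::'a" 6]
        by (intro integrable_mult_left integrable_real_indicator) auto
      show "indicator {y. \<delta> \<le> norm y} y *\<^sub>R landau_kernel n y \<le> indicator (cball (0::'a) 6) y * \<rho> ^ Suc n" for y :: 'a
      proof (cases "\<delta> \<le> norm y \<and> norm y \<le> 6")
        case True
        have "\<delta>\<^sup>2 \<le> (norm y)\<^sup>2" using True \<delta> by (intro power_mono) auto
        then have 1: "1 - (norm y)\<^sup>2 / 36 \<le> \<rho>" by (simp add: \<rho>_def divide_right_mono)
        have "(norm y)\<^sup>2 \<le> 6\<^sup>2" using True by (intro power_mono) auto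
        then have "(1 - (norm y)\<^sup>2 / 36) ^ Suc n \<le> \<rho> ^ Suc n" using 1 by (intro power_mono) auto
        then show ?thesis using True by (simp add: landau_kernel_inside del: power_Suc)
      next
        case False
        then show ?thesis using \<rho> landau_kernel_outside [of y n] by (auto simp: indicator_def)
      qed
    qed
    then show ?thesis by (simp add: V_def mult.commute)
  qed
  have "(\<lambda>n. (\<rho> / \<rho>') ^ Suc n) \<longlonglongrightarrow> 0"
    using \<rho> by (intro LIMSEQ_Suc LIMSEQ_power_zero) (auto simp: divide_less_eq)
  then have "\<forall>\<^sub>F n in sequentially. (\<rho> / \<rho>') ^ Suc n < \<epsilon> * W / V"
    using \<epsilon> W V by (intro order_tendstoD(2)) auto
  then show ?thesis
  proof eventually_elim
    case (elim n)
    have "\<rho> ^ Suc n * V = (\<rho> / \<rho>') ^ Suc n * (\<rho>' ^ Suc n * V)"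
      using \<rho> by (simp add: power_divide del: power_Suc)
    also have "\<dots> \<le> (\<epsilon> * W / V) * (\<rho>' ^ Suc n * V)"
      using elim \<rho> V by (intro mult_right_mono) auto
    also have "\<dots> = \<epsilon> * (\<rho>' ^ Suc n * W)" using V by simp
    also have "\<dots> \<le> \<epsilon> * landau_mass TYPE('a) n" using \<epsilon> lower by (intro mult_left_mono) auto
    finally have "\<rho> ^ Suc n * V \<le> \<epsilon> * landau_mass TYPE('a) n" .
    moreover have "0 < \<rho>' ^ Suc n * W" using \<rho> W by simp
    ultimately show ?case using upper [of n] lower [of n] by linarith
  qed
qed

lemma landau_approximate_identity:
  fixes g :: "'a::euclidean_space \<Rightarrow> 'b::{banach, second_countable_topology}"
  assumes uc: "uniformly_continuous_on UNIV g" and B: "\<And>x. norm (g x) \<le> B" and \<epsilon>: "0 < \<epsilon>"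
  shows "\<forall>\<^sub>F n in sequentially. 0 < landau_mass TYPE('a) n \<and>
    (\<forall>x. norm ((LINT y|lborel. (landau_kernel n y / landau_mass TYPE('a) n) *\<^sub>R g (x - y)) - g x) \<le> \<epsilon>)"
proof -
  have B0: "0 \<le> B" using B [of 0] norm_ge_zero order_trans by blast
  obtain d where d: "d > 0" "\<And>x y. dist y x < d \<Longrightarrow> dist (g y) (g x) < \<epsilon> / 2"
    using uc \<epsilon> unfolding uniformly_continuous_on_def by (metis UNIV_I half_gt_zero)
  define \<delta> where "\<delta> = min d 6"
  have \<delta>: "0 < \<delta>" "\<delta> \<le> 6" using d by (auto simp: \<delta>_def)
  \<comment> \<open>\<open>B + 1\<close> avoids a zero denominator.\<close>
  define \<eta> where "\<eta> = \<epsilon> / (4 * (B + 1))"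
  have \<eta>: "\<eta> > 0" "2 * B * \<eta> \<le> \<epsilon> / 2" using \<epsilon> B0 by (auto simp: \<eta>_def field_simps)
  have meas: "{y::'a. \<delta> \<le> norm y} \<in> sets borel"
    by (intro borel_closed closed_Collect_le continuous_intros)
  show ?thesis
    using landau_concentration [OF \<delta> \<eta>(1), where 'a='a]
  proof eventually_elim
    case (elim n)
    define I where "I = landau_mass TYPE('a) n"
    define k where "k y = landau_kernel n y / I" for y :: 'a
    have I: "I > 0" using elim by (simp add: I_def)
    have k0: "k y \<ge> 0" for y using I landau_kernel_nonneg [of n y] by (simp add: k_def)
    have k_int: "integrable lborel k"
      unfolding k_def [abs_def] by (intro integrable_divide_zero integrable_landau_kernel_alone)
    have k1: "(LINT y|lborel. k y) = 1"
      using I by (simp add: k_def I_def landau_mass_def)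
    have k_tail_int: "integrable lborel (\<lambda>y. indicator {y. \<delta> \<le> norm y} y *\<^sub>R k y)"
      using integrable_mult_indicator [OF _ k_int, of "{y. \<delta> \<le> norm y}"] meas by simp
    have k_tail: "(LINT y|lborel. indicator {y. \<delta> \<le> norm y} y *\<^sub>R k y) \<le> \<eta>"
    proof -
      have "(LINT y|lborel. indicator {y. \<delta> \<le> norm y} y *\<^sub>R k y) = (LINT y:{y. \<delta> \<le> norm y}|lborel. landau_kernel n (y::'a)) / I"
        by (simp add: k_def set_lebesgue_integral_def)
      then show ?thesis using elim I by (simp add: I_def divide_le_eq)
    qed
    have "norm ((LINT y|lborel. k y *\<^sub>R g (x - y)) - g x) \<le> \<epsilon>" for x
    proof -
      have cont: "continuous_on UNIV (\<lambda>y. g (x - y))"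
        by (rule continuous_on_compose2 [OF uniformly_continuous_imp_continuous [OF uc]])
           (auto intro!: continuous_intros)
      have int1: "integrable lborel (\<lambda>y. k y *\<^sub>R g (x - y))"
        using integrable_scaleR_right [OF integrable_landau_kernel [OF cont, of n], of "1 / I"]
        by (simp add: k_def)
      have int2: "integrable lborel (\<lambda>y. k y *\<^sub>R g x)" using k_int by simp
      have "(LINT y|lborel. k y *\<^sub>R g (x - y)) - g x = (LINT y|lborel. k y *\<^sub>R g (x - y)) - (LINT y|lborel. k y *\<^sub>R g x)"
        by (simp add: k_int k1)
      also have "\<dots> = (LINT y|lborel. k y *\<^sub>R (g (x - y) - g x))"
        by (simp add: Bochner_Integration.integral_diff [OF int1 int2, symmetric] scaleR_diff_right)
      finally have eq: "(LINT y|lborel. k y *\<^sub>R g (x - y)) - g x = (LINT y|lborel. k y *\<^sub>R (g (x - y) - g x))" .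
      have "norm ((LINT y|lborel. k y *\<^sub>R g (x - y)) - g x) \<le> (LINT y|lborel. norm (k y *\<^sub>R (g (x - y) - g x)))"
        unfolding eq by (rule integral_norm_bound)
      also have "\<dots> \<le> (LINT y|lborel. (\<epsilon> / 2) * k y + (2 * B) * (indicator {y. \<delta> \<le> norm y} y *\<^sub>R k y))"
      proof (rule integral_mono)
        show "integrable lborel (\<lambda>y. norm (k y *\<^sub>R (g (x - y) - g x)))"
          using integrable_norm [OF Bochner_Integration.integrable_diff [OF int1 int2]] by (simp add: scaleR_diff_right)
        show "integrable lborel (\<lambda>y. (\<epsilon> / 2) * k y + (2 * B) * (indicator {y. \<delta> \<le> norm y} y *\<^sub>R k y))"
          by (intro Bochner_Integration.integrable_add integrable_mult_right k_int k_tail_int)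
        fix y
        show "norm (k y *\<^sub>R (g (x - y) - g x)) \<le> (\<epsilon> / 2) * k y + (2 * B) * (indicator {y. \<delta> \<le> norm y} y *\<^sub>R k y)"
        proof (cases "\<delta> \<le> norm y")
          case True
          have "norm (g (x - y) - g x) \<le> 2 * B"
            using norm_triangle_ineq4 [of "g (x - y)" "g x"] B [of "x - y"] B [of x] by linarith
          then have "k y * norm (g (x - y) - g x) \<le> k y * (2 * B)" by (intro mult_left_mono k0)
          moreover have "0 \<le> \<epsilon> * k y" using \<epsilon> k0 [of y] by simp
          ultimately show ?thesis using True k0 [of y] by (simp add: mult.commute)
        next
          case False
          then have "dist (x - y) x < d" by (simp add: \<delta>_def dist_norm)
          then have "norm (g (x - y) - g x) \<le> \<epsilon> / 2" using d(2) by (simp add: dist_norm less_imp_le)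
          then have "k y * norm (g (x - y) - g x) \<le> k y * (\<epsilon> / 2)" by (intro mult_left_mono k0)
          then show ?thesis using False k0 [of y] by (simp add: mult.commute)
        qed
      qed
      also have "\<dots> = \<epsilon> / 2 + 2 * B * (LINT y|lborel. indicator {y. \<delta> \<le> norm y} y *\<^sub>R k y)"
        using k_int k_tail_int k1 by (simp add: Bochner_Integration.integral_add)
      also have "\<dots> \<le> \<epsilon> / 2 + 2 * B * \<eta>" using k_tail B0 by (intro add_left_mono mult_left_mono) auto
      also have "\<dots> \<le> \<epsilon>" using \<eta> by linarith
      finally show ?thesis .
    qed
    then show ?case using I by (simp add: k_def I_def)
  qed
qed

lemma lborel_integral_reflect:
  fixes h :: "'a::euclidean_space \<Rightarrow> 'b::{banach, second_countable_topology}"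
  assumes h: "h \<in> borel_measurable borel"
  shows "(LINT y|lborel. h y) = (LINT y|lborel. h (x - y))"
proof -
  have "(lborel :: 'a measure) = distr lborel borel (\<lambda>y. x - y)"
    using lborel_affine [of "-1" x] by (simp add: density_1)
  then have "(LINT y|lborel. h y) = (LINT y|distr lborel borel (\<lambda>y. x - y). h y)" by simp
  also have "\<dots> = (LINT y|lborel. h (x - y))"
    using h by (subst integral_distr) auto
  finally show ?thesis .
qed

text \<open>
A function with continuous derivative that is \<open>1\<close> for \<open>s \<le> 5\<close> and \<open>0\<close> for \<open>s \<ge> 6\<close>.  It is applied to
\<open>s = |x|\<^sup>2\<close>: the ball of radius \<open>2\<close>, which contains \<open>T\<close>, lies where it is \<open>1\<close>, and it vanishes for \<open>|x| \<ge> 3\<close>.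
\<close>

definition bump :: "real \<Rightarrow> real" where
  "bump s = (max 0 (1 - (max 0 (s - 5))\<^sup>2))\<^sup>2"

definition bump' :: "real \<Rightarrow> real" where
  "bump' s = - (4 * max 0 (1 - (max 0 (s - 5))\<^sup>2) * max 0 (s - 5))"

lemma max_sq_deriv: "((\<lambda>s::real. (max 0 s)\<^sup>2) has_real_derivative 2 * max 0 s) (at s)"
proof -
  consider "s < 0" | "s > 0" | "s = 0" by linarith
  then show ?thesis
  proof cases
    case 1
    have "((\<lambda>s::real. 0) has_real_derivative 2 * max 0 s) (at s)" using 1 by simp
    then show ?thesis
      by (rule has_field_derivative_transform_within_open [where S = "{..<0}"]) (use 1 in auto)
  next
    case 2
    have "((\<lambda>s::real. s\<^sup>2) has_real_derivative 2 * max 0 s) (at s)"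
      using 2 by (auto intro!: derivative_eq_intros)
    then show ?thesis
      by (rule has_field_derivative_transform_within_open [where S = "{0<..}"]) (use 2 in auto)
  next
    case 3
    have "((\<lambda>h::real. (max 0 h)\<^sup>2 / h) \<longlongrightarrow> 0) (at 0)"
    proof (rule tendsto_sandwich [of "\<lambda>h. - \<bar>h\<bar>" _ _ "\<lambda>h. \<bar>h\<bar>"])
      have "- \<bar>h\<bar> \<le> (max 0 h)\<^sup>2 / h \<and> (max 0 h)\<^sup>2 / h \<le> \<bar>h\<bar>" for h :: real
        by (cases "h > 0") (auto simp: max_def power2_eq_square)
      then show "\<forall>\<^sub>F h in at (0::real). - \<bar>h\<bar> \<le> (max 0 h)\<^sup>2 / h"
        "\<forall>\<^sub>F h in at (0::real). (max 0 h)\<^sup>2 / h \<le> \<bar>h\<bar>"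
        by (auto intro!: always_eventually)
    qed (auto intro!: tendsto_eq_intros)
    then show ?thesis using 3 by (simp add: DERIV_def)
  qed
qed

lemma bump_deriv: "(bump has_real_derivative bump' s) (at s)"
proof -
  have "((\<lambda>s. (max 0 (s - 5))\<^sup>2) has_real_derivative 2 * max 0 (s - 5)) (at s)"
  proof -
    have "((\<lambda>s. s - 5) has_real_derivative 1) (at s)" by (auto intro!: derivative_eq_intros)
    from DERIV_chain2 [OF max_sq_deriv this] show ?thesis by simp
  qed
  from DERIV_diff [OF DERIV_const [of 1] this]
  have "((\<lambda>s. 1 - (max 0 (s - 5))\<^sup>2) has_real_derivative - (2 * max 0 (s - 5))) (at s)"
    by simp
  from DERIV_chain2 [OF max_sq_deriv this] show ?thesis
    unfolding bump_def [abs_def] bump'_def by (rule DERIV_cong) simp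
qed

lemma bump_one: "s \<le> 5 \<Longrightarrow> bump s = 1" and bump'_one: "s \<le> 5 \<Longrightarrow> bump' s = 0"
  by (auto simp: bump_def bump'_def)

lemma bump_zero: "6 \<le> s \<Longrightarrow> bump s = 0" and bump'_zero: "6 \<le> s \<Longrightarrow> bump' s = 0"
proof -
  have "1 \<le> (max 0 (s - 5))\<^sup>2" if "6 \<le> s" using that power_mono [of 1 "max 0 (s - 5)" 2] by simp
  then show "6 \<le> s \<Longrightarrow> bump s = 0" "6 \<le> s \<Longrightarrow> bump' s = 0" by (auto simp: bump_def bump'_def)
qed

lemma uniformly_continuous_compact_support:
  fixes g :: "'a::euclidean_space \<Rightarrow> 'b::real_normed_vector"
  assumes cont: "continuous_on UNIV g" and zero: "\<And>x. R \<le> norm x \<Longrightarrow> g x = 0"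
  shows "uniformly_continuous_on UNIV g" and "\<exists>B. \<forall>x. norm (g x) \<le> B"
proof -
  have uc: "uniformly_continuous_on (cball 0 (R + 1)) g"
    by (intro compact_uniformly_continuous continuous_on_subset [OF cont]) auto
  show "uniformly_continuous_on UNIV g"
    unfolding uniformly_continuous_on_def
  proof (intro allI impI)
    fix e :: real assume e: "e > 0"
    obtain d where d: "d > 0" "\<And>x y. norm x \<le> R + 1 \<Longrightarrow> norm y \<le> R + 1 \<Longrightarrow> dist y x < d \<Longrightarrow> dist (g y) (g x) < e"
      using uc e unfolding uniformly_continuous_on_def by (auto simp: Ball_def)
    have "dist (g y) (g x) < e" if "dist y x < min d 1" for x y
    proof (cases "norm x \<le> R + 1 \<and> norm y \<le> R + 1")
      case True
      then show ?thesis using d(2) that by auto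
    next
      case False
      have "\<bar>norm y - norm x\<bar> < 1"
        using that norm_triangle_ineq3 [of y x] by (simp add: dist_norm)
      then have "R \<le> norm x" "R \<le> norm y" using False by linarith+
      then show ?thesis using zero e by simp
    qed
    then show "\<exists>d>0. \<forall>x\<in>UNIV. \<forall>y\<in>UNIV. dist y x < d \<longrightarrow> dist (g y) (g x) < e"
      using d(1) by (intro exI [of _ "min d 1"]) auto
  qed
  have "bounded (g ` cball 0 R)"
    by (intro compact_imp_bounded compact_continuous_image continuous_on_subset [OF cont]) auto
  then obtain B where B: "B > 0" "\<And>x. x \<in> cball 0 R \<Longrightarrow> norm (g x) \<le> B"
    by (auto simp: bounded_pos)
  have "norm (g x) \<le> B" for x
    using B zero [of x] by (cases "norm x \<le> R") auto
  then show "\<exists>B. \<forall>x. norm (g x) \<le> B" by blast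
qed

text \<open>
A kernel that is a polynomial in \<open>x\<close> with coefficients continuous in \<open>y\<close>; integrating it against a function of \<open>y\<close>
gives a polynomial.
\<close>

definition separable :: "(C2 \<Rightarrow> C2 \<Rightarrow> complex) \<Rightarrow> bool" where
  "separable K \<longleftrightarrow> (\<exists>ls. (\<forall>(s, r)\<in>set ls. continuous_on UNIV s) \<and>
     (\<forall>x y. K x y = poly_fun (map (\<lambda>(s, r). (s y, r)) ls) x))"

lemma separable_add:
  assumes "separable K" "separable K'" shows "separable (\<lambda>x y. K x y + K' x y)"
proof -
  obtain ls where ls: "\<forall>(s, r)\<in>set ls. continuous_on UNIV s"
    "\<And>x y. K x y = poly_fun (map (\<lambda>(s, r). (s y, r)) ls) x"
    using assms(1) unfolding separable_def by blast
  obtain ls' where ls': "\<forall>(s, r)\<in>set ls'. continuous_on UNIV s"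
    "\<And>x y. K' x y = poly_fun (map (\<lambda>(s, r). (s y, r)) ls') x"
    using assms(2) unfolding separable_def by blast
  show ?thesis
    unfolding separable_def using ls ls'
    by (intro exI [of _ "ls @ ls'"]) (auto simp: ev2_append)
qed

lemma separable_mult:
  assumes "separable K" and s: "continuous_on UNIV s"
  shows "separable (\<lambda>x y. K x y * (s y * (mon a b (fst x) * mon k l (snd x))))"
proof -
  obtain ls where ls: "\<forall>(s, r)\<in>set ls. continuous_on UNIV s"
    "\<And>x y. K x y = poly_fun (map (\<lambda>(s, r). (s y, r)) ls) x"
    using assms(1) unfolding separable_def by blast
  define ls' where "ls' = map (\<lambda>(s', a', b', k', l'). ((\<lambda>y. s' y * s y), a' + a, b' + b, k' + k, l' + l)) ls"
  have "continuous_on UNIV s'" if "(s', r) \<in> set ls'" for s' r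
    using that ls(1) s by (auto simp: ls'_def intro!: continuous_intros)
  moreover have "K x y * (s y * (mon a b (fst x) * mon k l (snd x)))
      = poly_fun (map (\<lambda>(s, r). (s y, r)) ls') x" for x y
  proof -
    have "poly_fun (map (\<lambda>(s, r). (s y, r)) ls) x * (s y * (mon a b (fst x) * mon k l (snd x)))
      = poly_fun (map (\<lambda>(s, r). (s y, r)) (map (\<lambda>(s', a', b', k', l'). ((\<lambda>y. s' y * s y), a' + a, b' + b, k' + k, l' + l)) ls)) x"
      by (induction ls) (auto simp: mon_def power_add algebra_simps)
    then show ?thesis by (simp add: ls(2) ls'_def)
  qed
  ultimately show ?thesis
    unfolding separable_def by (intro exI [of _ ls']) auto
qed

lemma separable_landau:
  "separable (\<lambda>x y. of_real ((1 - (norm (x - y))\<^sup>2 / 36) ^ n))"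
proof (induction n)
  case 0
  show ?case
    unfolding separable_def
    by (intro exI [of _ "[(\<lambda>_. 1, 0, 0, 0, 0)]"]) (simp add: mon_def)
next
  case (Suc n)
  have expand: "of_real (1 - (norm (x - y))\<^sup>2 / 36) =
      (1 - (fst y * cnj (fst y) + snd y * cnj (snd y)) / 36) * (mon 0 0 (fst x) * mon 0 0 (snd x))
      + cnj (fst y) / 36 * (mon 1 0 (fst x) * mon 0 0 (snd x))
      + fst y / 36 * (mon 0 1 (fst x) * mon 0 0 (snd x))
      + cnj (snd y) / 36 * (mon 0 0 (fst x) * mon 1 0 (snd x))
      + snd y / 36 * (mon 0 0 (fst x) * mon 0 1 (snd x))
      + (-1/36) * (mon 1 1 (fst x) * mon 0 0 (snd x))
      + (-1/36) * (mon 0 0 (fst x) * mon 1 1 (snd x))" for x y :: C2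
  proof -
    have "(norm (x - y))\<^sup>2 = (cmod (fst x - fst y))\<^sup>2 + (cmod (snd x - snd y))\<^sup>2"
      by (simp add: norm_prod_def)
    then have "complex_of_real ((norm (x - y))\<^sup>2) = (fst x - fst y) * cnj (fst x - fst y)
        + (snd x - snd y) * cnj (snd x - snd y)"
      by (simp only: of_real_add complex_norm_square)
    then have "complex_of_real (1 - (norm (x - y))\<^sup>2 / 36) = 1 - ((fst x - fst y) * cnj (fst x - fst y)
        + (snd x - snd y) * cnj (snd x - snd y)) / 36"
      by (simp only: of_real_diff of_real_1 of_real_divide of_real_numeral)
    then show ?thesis by (simp only:) (simp add: mon_def field_simps)
  qed
  show ?case
    unfolding power_Suc2 of_real_mult expand distrib_left
    by (intro separable_add separable_mult [OF Suc.IH]) (auto intro!: continuous_intros)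
qed

lemma separable_integral:
  assumes K: "separable K"
    and int: "\<And>s. continuous_on UNIV s \<Longrightarrow> integrable lborel (\<lambda>y. u y * s y)"
  shows "\<exists>ts. \<forall>x. poly_fun ts x = (LINT y|lborel. u y * K x y)"
proof -
  obtain ls where ls: "\<forall>(s, r)\<in>set ls. continuous_on UNIV s"
    "\<And>x y. K x y = poly_fun (map (\<lambda>(s, r). (s y, r)) ls) x"
    using assms(1) unfolding separable_def by blast
  have "integrable lborel (\<lambda>y. u y * poly_fun (map (\<lambda>(s, r). (s y, r)) ls) x) \<and>
    poly_fun (map (\<lambda>(s, r). ((LINT y|lborel. u y * s y), r)) ls) x
      = (LINT y|lborel. u y * poly_fun (map (\<lambda>(s, r). (s y, r)) ls) x)" for x
    using ls(1)
  proof (induction ls)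
    case (Cons t ls)
    obtain s a b k l where t: "t = (s, a, b, k, l)" by (cases t)
    have s: "integrable lborel (\<lambda>y. u y * s y)" using Cons.prems by (auto simp: t intro: int)
    let ?m = "mon a b (fst x) * mon k l (snd x)"
    have IH: "integrable lborel (\<lambda>y. u y * poly_fun (map (\<lambda>(s, r). (s y, r)) ls) x)"
      "poly_fun (map (\<lambda>(s, r). ((LINT y|lborel. u y * s y), r)) ls) x
      = (LINT y|lborel. u y * poly_fun (map (\<lambda>(s, r). (s y, r)) ls) x)"
      using Cons by auto
    have eq: "(\<lambda>y. u y * poly_fun (map (\<lambda>(s, r). (s y, r)) (t # ls)) x)
        = (\<lambda>y. u y * s y * ?m + u y * poly_fun (map (\<lambda>(s, r). (s y, r)) ls) x)"
      by (simp add: t fun_eq_iff algebra_simps)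
    have sm: "integrable lborel (\<lambda>y. u y * s y * ?m)" using s by (rule integrable_mult_left)
    have "(LINT y|lborel. u y * s y * ?m + u y * poly_fun (map (\<lambda>(s, r). (s y, r)) ls) x)
        = (LINT y|lborel. u y * s y) * ?m + (LINT y|lborel. u y * poly_fun (map (\<lambda>(s, r). (s y, r)) ls) x)"
      using s IH(1) sm by (subst Bochner_Integration.integral_add) auto
    moreover have "poly_fun (map (\<lambda>(s, r). ((LINT y|lborel. u y * s y), r)) (t # ls)) x
        = (LINT y|lborel. u y * s y) * ?m + poly_fun (map (\<lambda>(s, r). ((LINT y|lborel. u y * s y), r)) ls) x"
      by (simp add: t)
    moreover have "integrable lborel (\<lambda>y. u y * s y * ?m + u y * poly_fun (map (\<lambda>(s, r). (s y, r)) ls) x)"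
      using sm IH(1) by (rule Bochner_Integration.integrable_add)
    ultimately show ?case unfolding eq IH(2) by simp
  qed simp
  then show ?thesis unfolding ls(2) by (intro exI allI) blast
qed

text \<open>
Convolution with the Landau kernels approximates \<open>u\<close> uniformly, and since it commutes with differentiation it approximates
the derivatives too.  On the ball of radius \<open>3\<close> the convolution is a polynomial.
\<close>

lemma weierstrass_compact_support:
  fixes u :: "C2 \<Rightarrow> complex"
  assumes u': "\<And>x. (u has_derivative u' x) (at x)"
    and cont: "\<And>v. continuous_on UNIV (\<lambda>x. u' x v)"
    and zero: "\<And>x. 3 \<le> norm x \<Longrightarrow> u x = 0" and zero': "\<And>x v. 3 \<le> norm x \<Longrightarrow> u' x v = 0"
    and \<epsilon>: "0 < \<epsilon>" and V: "finite V"
  shows "\<exists>ts. \<forall>x. norm x \<le> 2 \<longrightarrow> cmod (poly_fun ts x - u x) \<le> \<epsilon> \<and>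
    (\<forall>v\<in>V. cmod (poly_fun (dir_poly v ts) x - u' x v) \<le> \<epsilon>)"
proof -
  define I where "I n = landau_mass TYPE(C2) n" for n
  define k where "k n y = landau_kernel n y / I n" for n and y :: C2
  have u_cont: "continuous_on UNIV u"
    using u' by (meson has_derivative_continuous continuous_at_imp_continuous_on)
  have approx: "\<forall>\<^sub>F n in sequentially. 0 < I n \<and> (\<forall>x. norm ((LINT y|lborel. k n y *\<^sub>R g (x - y)) - g x) \<le> \<epsilon>)"
    if g: "continuous_on UNIV g" "\<And>x. 3 \<le> norm x \<Longrightarrow> g x = 0" for g :: "C2 \<Rightarrow> complex"
  proof -
    obtain B where "\<And>x. norm (g x) \<le> B"
      using uniformly_continuous_compact_support(2) [OF g] by blast
    from landau_approximate_identity [OF uniformly_continuous_compact_support(1) [OF g] this \<epsilon>]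
    show ?thesis by (simp add: k_def I_def)
  qed
  have "\<forall>\<^sub>F n in sequentially. (0 < I n \<and> (\<forall>x. norm ((LINT y|lborel. k n y *\<^sub>R u (x - y)) - u x) \<le> \<epsilon>)) \<and>
      (\<forall>v\<in>V. 0 < I n \<and> (\<forall>x. norm ((LINT y|lborel. k n y *\<^sub>R u' (x - y) v) - u' x v) \<le> \<epsilon>))"
    using V by (intro eventually_conj eventually_ball_finite ballI approx u_cont cont zero zero') auto
  then obtain n where n: "0 < I n" "\<And>x. norm ((LINT y|lborel. k n y *\<^sub>R u (x - y)) - u x) \<le> \<epsilon>"
      "\<And>v x. v \<in> V \<Longrightarrow> norm ((LINT y|lborel. k n y *\<^sub>R u' (x - y) v) - u' x v) \<le> \<epsilon>"
    by (auto simp: eventually_sequentially)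
  have k_cont: "continuous_on UNIV (k n)"
    unfolding k_def [abs_def] using n(1) by (intro continuous_intros continuous_landau_kernel) auto
  have k0: "0 \<le> k n y" for y using n(1) landau_kernel_nonneg [of n y] by (simp add: k_def)
  have k_int: "integrable lborel (\<lambda>y. k n y *\<^sub>R g y)" if "continuous_on UNIV g"
    for g :: "C2 \<Rightarrow> 'b::{banach, second_countable_topology}"
    using integrable_scaleR_right [OF integrable_landau_kernel [OF that, of n], of "1 / I n"]
    by (simp add: k_def)
  have shifted: "continuous_on UNIV (\<lambda>y. g (x - y))" if "continuous_on UNIV g" for g :: "C2 \<Rightarrow> complex" and x
    by (rule continuous_on_compose2 [OF that]) (auto intro!: continuous_intros)
  have u_int: "integrable lborel (\<lambda>y. u y * s y)" if s: "continuous_on UNIV s" for s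
  proof -
    have "integrable lborel (\<lambda>y. indicator (cball 0 3) y *\<^sub>R (u y * s y))"
      by (intro borel_integrable_compact continuous_on_subset [OF continuous_on_mult [OF u_cont s]]) auto
    also have "(\<lambda>y. indicator (cball 0 3) y *\<^sub>R (u y * s y)) = (\<lambda>y. u y * s y)"
    proof
      show "indicator (cball 0 3) y *\<^sub>R (u y * s y) = u y * s y" for y
        by (cases "norm y \<le> 3") (simp_all add: zero)
    qed
    finally show ?thesis .
  qed
  let ?K = "\<lambda>x y. complex_of_real ((1 - (norm (x - y))\<^sup>2 / 36) ^ Suc n)"
  have "\<exists>ts. \<forall>x. poly_fun ts x = (LINT y|lborel. u y * ?K x y)"
    by (rule separable_integral [OF separable_landau u_int])
  then obtain ts0 where "\<forall>x. poly_fun ts0 x = (LINT y|lborel. u y * ?K x y)" ..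
  then have ts0: "poly_fun ts0 x = (LINT y|lborel. u y * ?K x y)" for x by (rule spec)
  define ts where "ts = map (\<lambda>(c, r). (c * of_real (1 / I n), r)) ts0"
  have "poly_fun (map (\<lambda>(c, r). (c * d, r)) us) x = poly_fun us x * d" for d us x
    by (induction us) (auto simp: algebra_simps)
  then have "poly_fun ts x = poly_fun ts0 x * of_real (1 / I n)" for x
    unfolding ts_def by blast
  then have ts: "poly_fun ts x = (LINT y|lborel. u y * ?K x y * of_real (1 / I n))" for x
    by (simp only: ts0 integral_mult_left_zero)
  have conv: "poly_fun ts x = (LINT y|lborel. k n y *\<^sub>R u (x - y))" if x: "norm x \<le> 3" for x
  proof -
    have "u y * ?K x y * of_real (1 / I n) = k n (x - y) *\<^sub>R u y" for y
    proof (cases "norm y \<le> 3")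
      case True
      have "norm (x - y) \<le> 6" using norm_triangle_ineq4 [of x y] True x by simp
      then show ?thesis
        by (simp add: k_def landau_kernel_inside scaleR_conv_of_real)
    qed (simp add: zero)
    then have "poly_fun ts x = (LINT y|lborel. k n (x - y) *\<^sub>R u y)" by (simp add: ts)
    also have "\<dots> = (LINT y|lborel. k n (x - (x - y)) *\<^sub>R u (x - y))"
      by (rule lborel_integral_reflect)
        (intro borel_measurable_continuous_onI continuous_on_scaleR u_cont
          continuous_on_compose2 [OF k_cont], auto intro!: continuous_intros)
    finally show ?thesis by simp
  qed
  have deriv: "poly_fun (dir_poly v ts) x = (LINT y|lborel. k n y *\<^sub>R u' (x - y) v)" if x: "norm x \<le> 2" for x v
  proof -
    obtain B where B: "\<And>x. cmod (u' x v) \<le> B"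
      using uniformly_continuous_compact_support(2) [OF cont [of v] zero'] by blast
    have lip: "cmod (u (a + t *\<^sub>R v) - u a) \<le> B * t" if "0 \<le> t" for a t
    proof -
      have "norm (u (a + t *\<^sub>R v) - u (a + 0 *\<^sub>R v)) \<le> B * norm (t - 0)"
      proof (rule differentiable_bound [of "{0..t}"])
        show "((\<lambda>s. u (a + s *\<^sub>R v)) has_derivative (\<lambda>h. h *\<^sub>R u' (a + s *\<^sub>R v) v)) (at s within {0..t})" for s
        proof -
          have "((\<lambda>s. a + s *\<^sub>R v) has_derivative (\<lambda>h. h *\<^sub>R v)) (at s)"
            by (auto intro!: derivative_eq_intros)
          from diff_chain_at [OF this u']
          have "((\<lambda>s. u (a + s *\<^sub>R v)) has_derivative (\<lambda>h. u' (a + s *\<^sub>R v) (h *\<^sub>R v))) (at s)"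
            by (simp add: o_def)
          moreover have "u' (a + s *\<^sub>R v) (h *\<^sub>R v) = h *\<^sub>R u' (a + s *\<^sub>R v) v" for h
            by (rule linear_cmul [OF bounded_linear.linear [OF has_derivative_bounded_linear [OF u']]])
          ultimately show ?thesis by (simp add: has_derivative_at_withinI)
        qed
        show "onorm (\<lambda>h. h *\<^sub>R u' (a + s *\<^sub>R v) v) \<le> B" for s
        proof (rule onorm_bound)
          show "0 \<le> B" using B [of 0] norm_ge_zero order_trans by blast
          show "norm (h *\<^sub>R u' (a + s *\<^sub>R v) v) \<le> B * norm h" for h :: real
            using mult_left_mono [OF B [of "a + s *\<^sub>R v"], of "\<bar>h\<bar>"] by (simp add: mult.commute)
        qed
      qed (use that in auto)
      then show ?thesis using that by simp
    qed
    have B0: "0 \<le> B" using B [of 0] norm_ge_zero order_trans by blast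
    define q where "q m z = real (Suc m) *\<^sub>R (u (z + v /\<^sub>R real (Suc m)) - u z)" for m z
    have quotients: "(\<lambda>m. real (Suc m) *\<^sub>R (poly_fun ts (x + v /\<^sub>R real (Suc m)) - poly_fun ts x))
        \<longlonglongrightarrow> poly_fun (dir_poly v ts) x"
      using difference_quotient_tendsto [OF poly_has_derivative] .
    have averages: "(\<lambda>m. LINT y|lborel. k n y *\<^sub>R q m (x - y)) \<longlonglongrightarrow> (LINT y|lborel. k n y *\<^sub>R u' (x - y) v)"
    proof (rule integral_dominated_convergence)
      have q_cont: "continuous_on UNIV (q m)" for m
        unfolding q_def [abs_def]
        by (intro continuous_on_scaleR continuous_on_diff continuous_on_const u_cont continuous_on_compose2 [OF u_cont])
          (auto intro!: continuous_intros)
      show "(\<lambda>y. k n y *\<^sub>R u' (x - y) v) \<in> borel_measurable lborel"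
        using k_int [OF shifted [OF cont]] by (rule borel_measurable_integrable)
      show "(\<lambda>y. k n y *\<^sub>R q m (x - y)) \<in> borel_measurable lborel" for m
        using k_int [OF shifted [OF q_cont]] by (rule borel_measurable_integrable)
      show "integrable lborel (\<lambda>y. k n y *\<^sub>R B)" by (intro k_int continuous_intros)
      show "AE y in lborel. norm (k n y *\<^sub>R q m (x - y)) \<le> k n y *\<^sub>R B" for m
      proof (intro AE_I2)
        fix y
        have "norm (q m (x - y)) = real (Suc m) * cmod (u (x - y + (1 / real (Suc m)) *\<^sub>R v) - u (x - y))"
          by (simp add: q_def divide_inverse_commute)
        also have "\<dots> \<le> real (Suc m) * (B * (1 / real (Suc m)))"
          by (intro mult_left_mono lip) auto
        also have "\<dots> = B" by simp
        finally show "norm (k n y *\<^sub>R q m (x - y)) \<le> k n y *\<^sub>R B"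
          using k0 [of y] by (simp add: mult_left_mono)
      qed
      show "AE y in lborel. (\<lambda>m. k n y *\<^sub>R q m (x - y)) \<longlonglongrightarrow> k n y *\<^sub>R u' (x - y) v"
        unfolding q_def by (intro AE_I2 tendsto_scaleR tendsto_const difference_quotient_tendsto u')
    qed
    have "\<forall>\<^sub>F m in sequentially. real (Suc m) *\<^sub>R (poly_fun ts (x + v /\<^sub>R real (Suc m)) - poly_fun ts x)
        = (LINT y|lborel. k n y *\<^sub>R q m (x - y))"
    proof -
      have lim0: "(\<lambda>m. v /\<^sub>R real (Suc m)) \<longlonglongrightarrow> 0"
        using tendsto_scaleR [OF LIMSEQ_inverse_real_of_nat tendsto_const [of v]] by simp
      then have "(\<lambda>m. x + v /\<^sub>R real (Suc m)) \<longlonglongrightarrow> x"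
        using tendsto_add [OF tendsto_const [of x] lim0] by simp
      then have "\<forall>\<^sub>F m in sequentially. x + v /\<^sub>R real (Suc m) \<in> ball 0 3"
        using x by (intro topological_tendstoD) auto
      then show ?thesis
      proof eventually_elim
        case (elim m)
        have "poly_fun ts (x + v /\<^sub>R real (Suc m)) - poly_fun ts x
            = (LINT y|lborel. k n y *\<^sub>R u (x + v /\<^sub>R real (Suc m) - y)) - (LINT y|lborel. k n y *\<^sub>R u (x - y))"
          using elim x by (simp add: conv)
        also have "\<dots> = (LINT y|lborel. k n y *\<^sub>R u (x + v /\<^sub>R real (Suc m) - y) - k n y *\<^sub>R u (x - y))"
          by (intro Bochner_Integration.integral_diff [symmetric] k_int shifted u_cont)
        finally have "real (Suc m) *\<^sub>R (poly_fun ts (x + v /\<^sub>R real (Suc m)) - poly_fun ts x)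
            = (LINT y|lborel. real (Suc m) *\<^sub>R (k n y *\<^sub>R u (x + v /\<^sub>R real (Suc m) - y) - k n y *\<^sub>R u (x - y)))"
          by (simp only: integral_scaleR_right)
        also have "\<dots> = (LINT y|lborel. k n y *\<^sub>R q m (x - y))"
          by (intro Bochner_Integration.integral_cong) (simp_all add: q_def scaleR_diff_right algebra_simps)
        finally show ?case .
      qed
    qed
    from Lim_transform_eventually [OF quotients this] averages show ?thesis
      by (rule LIMSEQ_unique)
  qed
  show ?thesis
    using n conv deriv by (intro exI [of _ ts]) (auto intro: order_trans)
qed

lemma smooth_continuous: "smooth f \<Longrightarrow> continuous_on UNIV f"
  unfolding smooth_def by (metis higher_differentiable.simps(1))

lemma smooth_has_derivative:
  assumes "smooth f"
  shows "(f has_derivative frechet_derivative f (at x)) (at x)"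
proof -
  have "higher_differentiable f (Suc 0)" using assms unfolding smooth_def by blast
  then show ?thesis by (simp add: frechet_derivative_works)
qed

lemma smooth_continuous_derivative:
  assumes "smooth f"
  shows "continuous_on UNIV (\<lambda>x. frechet_derivative f (at x) v)"
proof -
  have "higher_differentiable f (Suc 0)" using assms unfolding smooth_def by blast
  then show ?thesis by simp
qed

lemma smooth_continuous_wirtinger:
  assumes "smooth f"
  shows "continuous_on UNIV (wirtinger_bar k f)"
  unfolding wirtinger_bar_def [abs_def]
  by (intro continuous_on_divide continuous_on_add continuous_on_mult_left smooth_continuous_derivative assms
      continuous_on_const ballI) simp

text \<open>
Near the closure of \<open>T\<close> the function \<open>F\<close> agrees with its product with a bump function, which has compact support.
\<close>

lemma weierstrass_C1_on_T:
  assumes F: "smooth F" and \<epsilon>: "0 < \<epsilon>"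
  shows "\<exists>ts. \<forall>x\<in>T. cmod (poly_fun ts x - F x) \<le> \<epsilon>
    \<and> cmod (poly_dbar1 ts x - wirtinger_bar 1 F x) \<le> \<epsilon> \<and> cmod (poly_dbar2 ts x - wirtinger_bar 2 F x) \<le> \<epsilon>"
proof -
  define F' where "F' x v = frechet_derivative F (at x) v" for x v
  define u where "u x = F x * of_real (bump ((norm x)\<^sup>2))" for x
  define u' where "u' x v = F x * of_real (bump' ((norm x)\<^sup>2) * (2 * (x \<bullet> v))) + F' x v * of_real (bump ((norm x)\<^sup>2))" for x v
  have F': "(F has_derivative F' x) (at x)" for x
    unfolding F'_def [abs_def] using smooth_has_derivative [OF F] by simp
  have bump_cont: "continuous_on UNIV (\<lambda>x::C2. complex_of_real (bump ((norm x)\<^sup>2)))"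
    unfolding bump_def [abs_def] by (intro continuous_intros)
  have bump'_cont: "continuous_on UNIV (\<lambda>x::C2. complex_of_real (bump' ((norm x)\<^sup>2) * (2 * (x \<bullet> v))))" for v
    unfolding bump'_def [abs_def] by (intro continuous_intros)
  have deriv: "(u has_derivative u' x) (at x)" for x
  proof -
    have "((\<lambda>x::C2. (norm x)\<^sup>2) has_derivative (\<lambda>v. 2 * (x \<bullet> v))) (at x)"
      unfolding power2_norm_eq_inner by (auto intro!: derivative_eq_intros simp: inner_commute)
    moreover have "(bump has_derivative (\<lambda>h. bump' ((norm x)\<^sup>2) * h)) (at ((norm x)\<^sup>2))"
      using bump_deriv by (simp add: has_field_derivative_def)
    ultimately have "((\<lambda>x::C2. bump ((norm x)\<^sup>2)) has_derivative (\<lambda>v. bump' ((norm x)\<^sup>2) * (2 * (x \<bullet> v)))) (at x)"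
      using diff_chain_at [of "\<lambda>x::C2. (norm x)\<^sup>2" _ x bump] by (simp add: o_def)
    from has_derivative_mult [OF F' has_derivative_of_real [OF this]]
    show ?thesis unfolding u_def [abs_def] u'_def [abs_def] .
  qed
  have nine: "6 \<le> (norm x)\<^sup>2" if "3 \<le> norm x" for x :: C2
    using power_mono [OF that, of 2] by simp
  have "\<exists>ts. \<forall>x. norm x \<le> 2 \<longrightarrow> cmod (poly_fun ts x - u x) \<le> \<epsilon> \<and>
    (\<forall>v\<in>{coord_vec 1 1, coord_vec 1 \<i>, coord_vec 2 1, coord_vec 2 \<i>}. cmod (poly_fun (dir_poly v ts) x - u' x v) \<le> \<epsilon>)"
  proof (rule weierstrass_compact_support)
    show "(u has_derivative u' x) (at x)" for x by (rule deriv)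
    show "continuous_on UNIV (\<lambda>x. u' x v)" for v
      unfolding u'_def F'_def
      by (intro continuous_on_add continuous_on_mult bump_cont bump'_cont smooth_continuous smooth_continuous_derivative F)
    show "u x = 0" if "3 \<le> norm x" for x using bump_zero [OF nine [OF that]] by (simp add: u_def)
    show "u' x v = 0" if "3 \<le> norm x" for x v
      using bump_zero [OF nine [OF that]] bump'_zero [OF nine [OF that]] by (simp add: u'_def)
  qed (use \<epsilon> in auto)
  then obtain ts where ts: "\<And>x. norm x \<le> 2 \<Longrightarrow> cmod (poly_fun ts x - u x) \<le> \<epsilon>"
    "\<And>x v. norm x \<le> 2 \<Longrightarrow> v \<in> {coord_vec 1 1, coord_vec 1 \<i>, coord_vec 2 1, coord_vec 2 \<i>} \<Longrightarrow>
      cmod (poly_fun (dir_poly v ts) x - u' x v) \<le> \<epsilon>"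
    by blast
  have "cmod (poly_fun ts x - F x) \<le> \<epsilon>
    \<and> cmod (poly_dbar1 ts x - wirtinger_bar 1 F x) \<le> \<epsilon> \<and> cmod (poly_dbar2 ts x - wirtinger_bar 2 F x) \<le> \<epsilon>"
    if "x \<in> T" for x
  proof -
    have x: "norm x \<le> 2" using that T_subset by auto
    have "(norm x)\<^sup>2 \<le> 5" using power_mono [OF x, of 2] by simp
    then have one: "u x = F x" "u' x v = F' x v" for v
      by (simp_all add: u_def u'_def bump_one bump'_one)
    have poly: "frechet_derivative (poly_fun ts) (at x) = (\<lambda>v. poly_fun (dir_poly v ts) x)"
      by (rule frechet_derivative_at [symmetric]) (rule poly_has_derivative)
    have W: "cmod (wirtinger_bar k (poly_fun ts) x - wirtinger_bar k F x) \<le> \<epsilon>" if "k = 1 \<or> k = 2" for k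
    proof -
      define A where "A = poly_fun (dir_poly (coord_vec k 1) ts) x - F' x (coord_vec k 1)"
      define B where "B = poly_fun (dir_poly (coord_vec k \<i>) ts) x - F' x (coord_vec k \<i>)"
      have AB: "cmod A \<le> \<epsilon>" "cmod B \<le> \<epsilon>"
        using ts(2) [OF x, of "coord_vec k 1"] ts(2) [OF x, of "coord_vec k \<i>"] that
        by (auto simp: A_def B_def one)
      have "wirtinger_bar k (poly_fun ts) x - wirtinger_bar k F x = (A + \<i> * B) / 2"
        unfolding wirtinger_bar_def poly A_def B_def F'_def by (simp add: field_simps)
      also have "cmod \<dots> \<le> (cmod A + cmod B) / 2"
        using norm_triangle_ineq [of A "\<i> * B"] by (simp add: norm_mult)
      also have "\<dots> \<le> \<epsilon>" using AB by simp
      finally show ?thesis .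
    qed
    have "has_wirtinger2 (poly_fun ts) (ev2 (\<lambda>a b x. of_nat a * mon (a - 1) b x) mon ts x) (poly_dbar1 ts x)
        (ev2 mon (\<lambda>a b x. of_nat a * mon (a - 1) b x) ts x) (poly_dbar2 ts x) x"
      by (intro has_wirtinger2_ev2 wirtinger_mon)
    from wirtinger_bar_eq [OF this]
    have "wirtinger_bar 1 (poly_fun ts) x = poly_dbar1 ts x" "wirtinger_bar 2 (poly_fun ts) x = poly_dbar2 ts x"
      by simp_all
    then show ?thesis using W [of 1] W [of 2] ts(1) [OF x] by (simp add: one)
  qed
  then show ?thesis by blast
qed

section \<open>Passing to the limit\<close>

text \<open>
A subsequence with rapidly decreasing steps converges almost everywhere, and its limit is the limit in norm by Fatou's lemma.
\<close>

lemma L2_complete: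
  fixes g :: "nat \<Rightarrow> 'a \<Rightarrow> complex"
  assumes g [measurable]: "\<And>n. g n \<in> borel_measurable M"
    and cauchy: "\<And>\<epsilon>. 0 < \<epsilon> \<Longrightarrow> \<exists>N. \<forall>m\<ge>N. \<forall>n\<ge>N. (\<integral>\<^sup>+x. ennreal ((cmod (g m x - g n x))\<^sup>2) \<partial>M) \<le> ennreal \<epsilon>"
  shows "\<exists>u \<in> borel_measurable M. \<forall>\<epsilon>>0. \<exists>N. \<forall>n\<ge>N. (\<integral>\<^sup>+x. ennreal ((cmod (g n x - u x))\<^sup>2) \<partial>M) \<le> ennreal \<epsilon>"
proof -
  have "\<exists>N. \<forall>m\<ge>N. \<forall>n\<ge>N. (\<integral>\<^sup>+x. ennreal ((cmod (g m x - g n x))\<^sup>2) \<partial>M) \<le> ennreal ((1/8) ^ k)" for k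
    by (rule cauchy) simp
  then obtain N where N: "\<And>k m n. m \<ge> N k \<Longrightarrow> n \<ge> N k \<Longrightarrow>
      (\<integral>\<^sup>+x. ennreal ((cmod (g m x - g n x))\<^sup>2) \<partial>M) \<le> ennreal ((1/8) ^ k)"
    by metis
  define r where "r k = (\<Sum>i\<le>k. N i) + k" for k
  have rN: "r k \<ge> N k" for k
    using member_le_sum [of k "{..k}" N] by (simp add: r_def)
  have r_Suc: "r (Suc k) \<ge> N k" for k using rN [of k] by (simp add: r_def)
  define d where "d k x = g (r (Suc k)) x - g (r k) x" for k x
  have [measurable]: "d k \<in> borel_measurable M" for k unfolding d_def by measurable
  have d: "(\<integral>\<^sup>+x. ennreal ((cmod (d k x))\<^sup>2) \<partial>M) \<le> ennreal ((1/8) ^ k)" for k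
    unfolding d_def by (rule N [OF r_Suc rN])
  \<comment> \<open>The squared norms of the steps are at most \<open>1 / 8 ^ k\<close>, so the sum with weights
    \<open>4 ^ k\<close> is finite almost everywhere, and where it is finite \<open>d k x = O(1 / 2 ^ k)\<close>.\<close>
  have "(\<integral>\<^sup>+x. (\<Sum>k. ennreal (4 ^ k * (cmod (d k x))\<^sup>2)) \<partial>M) = (\<Sum>k. \<integral>\<^sup>+x. ennreal (4 ^ k * (cmod (d k x))\<^sup>2) \<partial>M)"
    by (rule nn_integral_suminf) measurable
  also have "\<dots> \<le> (\<Sum>k. ennreal ((1/2) ^ k))"
  proof (intro suminf_le)
    fix k
    have "(\<integral>\<^sup>+x. ennreal (4 ^ k * (cmod (d k x))\<^sup>2) \<partial>M) = ennreal (4 ^ k) * (\<integral>\<^sup>+x. ennreal ((cmod (d k x))\<^sup>2) \<partial>M)"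
      by (simp only: ennreal_mult zero_le_power2 zero_le_power zero_le_numeral) (rule nn_integral_cmult, measurable)
    also have "\<dots> \<le> ennreal (4 ^ k) * ennreal ((1/8) ^ k)" by (intro mult_left_mono d) auto
    also have "\<dots> = ennreal ((1/2) ^ k)"
      by (subst ennreal_mult [symmetric]) (simp_all flip: power_mult_distrib)
    finally show "(\<integral>\<^sup>+x. ennreal (4 ^ k * (cmod (d k x))\<^sup>2) \<partial>M) \<le> ennreal ((1/2) ^ k)" .
  qed auto
  also have "\<dots> = ennreal (\<Sum>k. (1/2) ^ k)"
    by (intro suminf_ennreal2) (auto intro: summable_geometric)
  also have "\<dots> < \<infinity>" by simp
  finally have fin: "(\<integral>\<^sup>+x. (\<Sum>k. ennreal (4 ^ k * (cmod (d k x))\<^sup>2)) \<partial>M) < \<infinity>" .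
  have "AE x in M. (\<Sum>k. ennreal (4 ^ k * (cmod (d k x))\<^sup>2)) \<noteq> \<infinity>"
  proof (rule nn_integral_PInf_AE)
    show "(\<lambda>x. \<Sum>k. ennreal (4 ^ k * (cmod (d k x))\<^sup>2)) \<in> borel_measurable M" by measurable
    show "(\<integral>\<^sup>+x. (\<Sum>k. ennreal (4 ^ k * (cmod (d k x))\<^sup>2)) \<partial>M) \<noteq> \<infinity>" using fin by simp
  qed
  then have conv: "AE x in M. convergent (\<lambda>k. g (r k) x)"
  proof eventually_elim
    case (elim x)
    define C where "C = enn2real (\<Sum>k. ennreal (4 ^ k * (cmod (d k x))\<^sup>2))"
    have finite: "(\<Sum>k. ennreal (4 ^ k * (cmod (d k x))\<^sup>2)) < top"
      using elim unfolding infinity_ennreal_def by (rule iffD1 [OF less_top])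
    have C0: "0 \<le> C" unfolding C_def by (rule enn2real_nonneg)
    have C: "4 ^ k * (cmod (d k x))\<^sup>2 \<le> C" for k
    proof -
      have "sum (\<lambda>k. ennreal (4 ^ k * (cmod (d k x))\<^sup>2)) {k} \<le> (\<Sum>k. ennreal (4 ^ k * (cmod (d k x))\<^sup>2))"
        by (rule sum_le_suminf) auto
      also have "\<dots> = ennreal C" unfolding C_def by (rule ennreal_enn2real [symmetric]) (rule finite)
      finally have "ennreal (4 ^ k * (cmod (d k x))\<^sup>2) \<le> ennreal C" by simp
      then show ?thesis using C0 by (subst (asm) ennreal_le_iff)
    qed
    have bound: "cmod (d k x) \<le> sqrt C * (1/2) ^ k" for k
    proof -
      have "2 ^ k * cmod (d k x) = sqrt (4 ^ k * (cmod (d k x))\<^sup>2)"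
      proof -
        have "(4::real) ^ k = (2 ^ k)\<^sup>2" by (simp add: power2_eq_square flip: power_mult_distrib)
        then show ?thesis by (simp add: real_sqrt_mult)
      qed
      also have "\<dots> \<le> sqrt C" using C by simp
      finally show ?thesis by (simp add: power_divide field_simps)
    qed
    have "summable (\<lambda>k. sqrt C * (1/2) ^ k)"
      by (intro summable_mult summable_geometric) simp
    then have "summable (\<lambda>k. d k x)"
      by (rule summable_comparison_test' [where N = 0]) (use bound in simp)
    then have "convergent (\<lambda>k. \<Sum>i<k. d i x)" by (simp add: summable_iff_convergent)
    moreover have "(\<Sum>i<k. d i x) = g (r k) x - g (r 0) x" for k
      unfolding d_def by (rule sum_lessThan_telescope)
    ultimately have "convergent (\<lambda>k. g (r k) x - g (r 0) x)" by simp
    from convergent_add [OF this convergent_const [of "g (r 0) x"]] show ?case by simp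
  qed
  define u where "u x = lim (\<lambda>k. g (r k) x)" for x
  have u [measurable]: "u \<in> borel_measurable M"
    unfolding u_def [abs_def] by (rule borel_measurable_lim_metric) measurable
  have "\<exists>N. \<forall>n\<ge>N. (\<integral>\<^sup>+x. ennreal ((cmod (g n x - u x))\<^sup>2) \<partial>M) \<le> ennreal \<epsilon>" if \<epsilon>: "\<epsilon> > 0" for \<epsilon>
  proof -
    obtain N' where N': "\<And>m n. m \<ge> N' \<Longrightarrow> n \<ge> N' \<Longrightarrow>
        (\<integral>\<^sup>+x. ennreal ((cmod (g m x - g n x))\<^sup>2) \<partial>M) \<le> ennreal \<epsilon>"
      using cauchy [OF \<epsilon>] by blast
    have "(\<integral>\<^sup>+x. ennreal ((cmod (g n x - u x))\<^sup>2) \<partial>M) \<le> ennreal \<epsilon>" if n: "n \<ge> N'" for n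
    proof -
      have "(\<integral>\<^sup>+x. ennreal ((cmod (g n x - u x))\<^sup>2) \<partial>M)
          = (\<integral>\<^sup>+x. liminf (\<lambda>k. ennreal ((cmod (g n x - g (r k) x))\<^sup>2)) \<partial>M)"
      proof (rule nn_integral_cong_AE)
        show "AE x in M. ennreal ((cmod (g n x - u x))\<^sup>2) = liminf (\<lambda>k. ennreal ((cmod (g n x - g (r k) x))\<^sup>2))"
          using conv
        proof eventually_elim
          case (elim x)
          then have "(\<lambda>k. g (r k) x) \<longlonglongrightarrow> u x" by (simp add: u_def convergent_LIMSEQ_iff)
          then have "(\<lambda>k. ennreal ((cmod (g n x - g (r k) x))\<^sup>2)) \<longlonglongrightarrow> ennreal ((cmod (g n x - u x))\<^sup>2)"
            by (intro tendsto_ennrealI tendsto_intros)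
          then show ?case by (intro lim_imp_Liminf [symmetric]) auto
        qed
      qed
      also have "\<dots> \<le> liminf (\<lambda>k. \<integral>\<^sup>+x. ennreal ((cmod (g n x - g (r k) x))\<^sup>2) \<partial>M)"
        by (rule nn_integral_liminf) measurable
      also have "\<dots> \<le> limsup (\<lambda>k. \<integral>\<^sup>+x. ennreal ((cmod (g n x - g (r k) x))\<^sup>2) \<partial>M)"
        by (rule Liminf_le_Limsup) simp
      also have "\<dots> \<le> ennreal \<epsilon>"
      proof (rule Limsup_bounded)
        show "\<forall>\<^sub>F k in sequentially. (\<integral>\<^sup>+x. ennreal ((cmod (g n x - g (r k) x))\<^sup>2) \<partial>M) \<le> ennreal \<epsilon>"
          using eventually_ge_at_top [of N']
          by eventually_elim (intro N' n, simp add: r_def)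
      qed
      finally show ?thesis .
    qed
    then show ?thesis by blast
  qed
  with u show ?thesis by blast
qed

lemma tendsto_ennreal_0_iff:
  fixes f :: "nat \<Rightarrow> ennreal"
  shows "f \<longlonglongrightarrow> 0 \<longleftrightarrow> (\<forall>e>0. \<forall>\<^sub>F n in sequentially. f n \<le> ennreal e)"
proof
  assume f: "f \<longlonglongrightarrow> 0"
  show "\<forall>e>0. \<forall>\<^sub>F n in sequentially. f n \<le> ennreal e"
  proof (intro allI impI)
    fix e :: real assume "0 < e"
    then have "\<forall>\<^sub>F n in sequentially. f n < ennreal e"
      by (intro order_tendstoD(2) [OF f]) simp
    then show "\<forall>\<^sub>F n in sequentially. f n \<le> ennreal e"
      by eventually_elim simp
  qed
next
  assume R: "\<forall>e>0. \<forall>\<^sub>F n in sequentially. f n \<le> ennreal e"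
  show "f \<longlonglongrightarrow> 0"
  proof (rule order_tendstoI)
    fix a :: ennreal assume "0 < a"
    then obtain b where b: "0 < b" "b < a" using dense by blast
    have fin: "b < top" using b(2) by (rule less_le_trans) simp
    have "0 < enn2real b" using b(1) fin by (simp add: enn2real_positive_iff)
    then have "\<forall>\<^sub>F n in sequentially. f n \<le> ennreal (enn2real b)" using R by blast
    then show "\<forall>\<^sub>F n in sequentially. f n < a"
    proof eventually_elim
      case (elim n)
      then show ?case using b(2) fin by (simp add: ennreal_enn2real_if le_less_trans)
    qed
  qed simp
qed

lemma T_sq_diff:
  assumes f: "f \<in> borel_measurable (lebesgue_on T)" and g: "g \<in> borel_measurable (lebesgue_on T)"
  shows "T_sq (\<lambda>x. f x - g x) \<le> 2 * T_sq f + 2 * T_sq g"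
proof -
  have "T_sq (\<lambda>x. f x + - g x) \<le> 2 * T_sq f + 2 * T_sq (\<lambda>x. - g x)"
    using f g by (intro T_sq_add borel_measurable_uminus)
  then show ?thesis by (simp add: T_sq_def)
qed

lemma T_sq_triangle:
  assumes "f \<in> borel_measurable (lebesgue_on T)" "g \<in> borel_measurable (lebesgue_on T)"
    "h \<in> borel_measurable (lebesgue_on T)"
    and "T_sq (\<lambda>x. f x - g x) \<le> ennreal a" "T_sq (\<lambda>x. g x - h x) \<le> ennreal b" "0 \<le> a" "0 \<le> b"
  shows "T_sq (\<lambda>x. f x - h x) \<le> ennreal (2 * a + 2 * b)"
proof -
  have "T_sq (\<lambda>x. f x - h x) = T_sq (\<lambda>x. (f x - g x) + (g x - h x))" by simp
  also have "\<dots> \<le> 2 * T_sq (\<lambda>x. f x - g x) + 2 * T_sq (\<lambda>x. g x - h x)"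
    using assms(1-3) by (intro T_sq_add borel_measurable_diff)
  also have "\<dots> \<le> 2 * ennreal a + 2 * ennreal b"
    using assms(4,5) by (intro add_mono mult_left_mono) auto
  also have "\<dots> = ennreal (2 * a + 2 * b)"
    using assms(6,7) by (simp add: ennreal_mult ennreal_plus)
  finally show ?thesis .
qed

lemma T_sq_commute: "T_sq (\<lambda>x. f x - g x) = T_sq (\<lambda>x. g x - f x)"
  unfolding T_sq_def by (simp add: norm_minus_commute)

lemma smooth_T_measurable: "smooth f \<Longrightarrow> f \<in> borel_measurable (lebesgue_on T)"
  by (intro T_measurable_borel borel_measurable_continuous_onI smooth_continuous)

lemma smooth_wirtinger_T_measurable: "smooth f \<Longrightarrow> wirtinger_bar k f \<in> borel_measurable (lebesgue_on T)"
  by (intro T_measurable_borel borel_measurable_continuous_onI smooth_continuous_wirtinger)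

lemma poly_T_measurable:
  "poly_fun ts \<in> borel_measurable (lebesgue_on T)"
  "poly_dbar1 ts \<in> borel_measurable (lebesgue_on T)"
  "poly_dbar2 ts \<in> borel_measurable (lebesgue_on T)"
  by (intro T_measurable_borel borel_measurable_continuous_onI continuous_ev2 continuous_on_mult_left continuous_mon)+

lemma solution_T_measurable: "solution ts us \<in> borel_measurable (lebesgue_on T)"
  unfolding solution_def [abs_def] solution_lift_def
  by (intro T_measurable_borel quotient_measurable continuous_potential)

lemma solution_error_T_measurable: "solution_error ts us \<in> borel_measurable (lebesgue_on T)"
  unfolding solution_error_def [abs_def]
  by (intro T_measurable_borel quotient_measurable continuous_ev2 continuous_mon continuous_sol_mon)

lemma T_sq_uniform_limit_0:
  assumes "\<And>n x. x \<in> T \<Longrightarrow> cmod (h n x) \<le> 1 / real (Suc n)"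
  shows "(\<lambda>n. T_sq (h n)) \<longlonglongrightarrow> 0"
proof (rule tendsto_sandwich [OF _ _ tendsto_const])
  show "\<forall>\<^sub>F n in sequentially. T_sq (h n) \<le> ennreal ((1 / real (Suc n))\<^sup>2) * emeasure lborel T"
    by (intro always_eventually allI T_sq_bounded assms) auto
  have "(\<lambda>n. ennreal ((1 / real (Suc n))\<^sup>2)) \<longlonglongrightarrow> ennreal (0\<^sup>2)"
    using LIMSEQ_inverse_real_of_nat by (intro tendsto_ennrealI tendsto_power) (simp add: inverse_eq_divide)
  then have "(\<lambda>n. emeasure lborel T * ennreal ((1 / real (Suc n))\<^sup>2)) \<longlonglongrightarrow> emeasure lborel T * 0"
    using emeasure_T_finite by (intro ennreal_tendsto_cmult) auto
  then show "(\<lambda>n. ennreal ((1 / real (Suc n))\<^sup>2) * emeasure lborel T) \<longlonglongrightarrow> 0"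
    by (simp add: mult.commute)
qed auto

lemma T_sq_limit_add:
  assumes "\<And>n. f n \<in> borel_measurable (lebesgue_on T)" "\<And>n. g n \<in> borel_measurable (lebesgue_on T)"
    and f: "(\<lambda>n. T_sq (f n)) \<longlonglongrightarrow> 0" and g: "(\<lambda>n. T_sq (g n)) \<longlonglongrightarrow> 0"
  shows "(\<lambda>n. T_sq (\<lambda>x. f n x + g n x)) \<longlonglongrightarrow> 0"
proof (rule tendsto_sandwich [OF _ _ tendsto_const])
  show "\<forall>\<^sub>F n in sequentially. T_sq (\<lambda>x. f n x + g n x) \<le> 2 * T_sq (f n) + 2 * T_sq (g n)"
    using assms(1,2) by (intro always_eventually allI T_sq_add)
  have "(\<lambda>n. 2 * T_sq (f n) + 2 * T_sq (g n)) \<longlonglongrightarrow> 2 * 0 + 2 * 0"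
    by (intro tendsto_add ennreal_tendsto_cmult f g) auto
  then show "(\<lambda>n. 2 * T_sq (f n) + 2 * T_sq (g n)) \<longlonglongrightarrow> 0" by simp
qed auto

text \<open>
The derivatives have to be approximated as well, so that the approximating forms are still nearly closed.
\<close>

lemma polynomial_approximation:
  assumes f1: "f1 \<in> borel_measurable (lebesgue_on T)" and f2: "f2 \<in> borel_measurable (lebesgue_on T)"
    and F: "\<And>n. smooth (F1 n)" "\<And>n. smooth (F2 n)"
    and lim1: "(\<lambda>n. T_sq (\<lambda>x. F1 n x - f1 x)) \<longlonglongrightarrow> 0"
    and lim2: "(\<lambda>n. T_sq (\<lambda>x. F2 n x - f2 x)) \<longlonglongrightarrow> 0"
    and closed: "(\<lambda>n. T_sq (\<lambda>x. wirtinger_bar 1 (F2 n) x - wirtinger_bar 2 (F1 n) x)) \<longlonglongrightarrow> 0"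
  obtains ts us where "(\<lambda>n. T_sq (\<lambda>x. poly_fun (ts n) x - f1 x)) \<longlonglongrightarrow> 0"
    "(\<lambda>n. T_sq (\<lambda>x. poly_fun (us n) x - f2 x)) \<longlonglongrightarrow> 0"
    "(\<lambda>n. T_sq (\<lambda>x. poly_dbar1 (us n) x - poly_dbar2 (ts n) x)) \<longlonglongrightarrow> 0"
proof -
  define close where "close F n ts \<longleftrightarrow> (\<forall>x\<in>T. cmod (poly_fun ts x - F x) \<le> 1 / real (Suc n)
    \<and> cmod (poly_dbar1 ts x - wirtinger_bar 1 F x) \<le> 1 / real (Suc n)
    \<and> cmod (poly_dbar2 ts x - wirtinger_bar 2 F x) \<le> 1 / real (Suc n))" for F n ts
  have close_ex: "\<exists>ts. close F n ts" if "smooth F" for F n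
    unfolding close_def by (rule weierstrass_C1_on_T [OF that]) simp
  have "\<forall>n. \<exists>ts. close (F1 n) n ts" using close_ex [OF F(1)] by blast
  from choice [OF this] obtain ts where ts: "\<And>n. close (F1 n) n (ts n)" by blast
  have "\<forall>n. \<exists>ts. close (F2 n) n ts" using close_ex [OF F(2)] by blast
  from choice [OF this] obtain us where us: "\<And>n. close (F2 n) n (us n)" by blast
  note m = borel_measurable_diff smooth_T_measurable smooth_wirtinger_T_measurable poly_T_measurable F f1 f2
  have 1: "(\<lambda>n. T_sq (\<lambda>x. (poly_fun (ts n) x - F1 n x) + (F1 n x - f1 x))) \<longlonglongrightarrow> 0"
    by (intro T_sq_limit_add lim1 T_sq_uniform_limit_0 m) (use ts close_def in blast)
  have 2: "(\<lambda>n. T_sq (\<lambda>x. (poly_fun (us n) x - F2 n x) + (F2 n x - f2 x))) \<longlonglongrightarrow> 0"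
    by (intro T_sq_limit_add lim2 T_sq_uniform_limit_0 m) (use us close_def in blast)
  have "(\<lambda>n. T_sq (\<lambda>x. wirtinger_bar 2 (F1 n) x - poly_dbar2 (ts n) x)) \<longlonglongrightarrow> 0"
    by (rule T_sq_uniform_limit_0) (use ts in \<open>simp add: close_def norm_minus_commute\<close>)
  moreover have "(\<lambda>n. T_sq (\<lambda>x. poly_dbar1 (us n) x - wirtinger_bar 1 (F2 n) x)) \<longlonglongrightarrow> 0"
    by (rule T_sq_uniform_limit_0) (use us close_def in blast)
  ultimately have 3: "(\<lambda>n. T_sq (\<lambda>x. (poly_dbar1 (us n) x - wirtinger_bar 1 (F2 n) x) +
      ((wirtinger_bar 2 (F1 n) x - poly_dbar2 (ts n) x) + (wirtinger_bar 1 (F2 n) x - wirtinger_bar 2 (F1 n) x)))) \<longlonglongrightarrow> 0"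
    by (intro T_sq_limit_add closed borel_measurable_add m)
  show ?thesis
    by (rule that) (use 1 2 3 in simp_all)
qed

text \<open>
The vanishing of the cohomology for one coefficient of \<open>dz\<^sub>I\<close>.  For polynomial forms close to \<open>f\<close> the solutions
converge by \<open>T_sq_solution\<close>, their errors tend to \<open>0\<close> by \<open>T_sq_solution_error\<close>, and each of them is in the domain of
\<open>dbar_s\<close> by \<open>solution_in_closure\<close>.
\<close>

theorem scalar_dbar_problem:
  assumes f1: "f1 \<in> borel_measurable (lebesgue_on T)" and f2: "f2 \<in> borel_measurable (lebesgue_on T)"
    and F: "\<And>n. smooth (F1 n)" "\<And>n. smooth (F2 n)"
    and lim1: "(\<lambda>n. T_sq (\<lambda>x. F1 n x - f1 x)) \<longlonglongrightarrow> 0"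
    and lim2: "(\<lambda>n. T_sq (\<lambda>x. F2 n x - f2 x)) \<longlonglongrightarrow> 0"
    and closed: "(\<lambda>n. T_sq (\<lambda>x. wirtinger_bar 1 (F2 n) x - wirtinger_bar 2 (F1 n) x)) \<longlonglongrightarrow> 0"
  shows "\<exists>u \<in> borel_measurable (lebesgue_on T). dbar_closure u f1 f2"
proof -
  obtain ts us where ts: "(\<lambda>n. T_sq (\<lambda>x. poly_fun (ts n) x - f1 x)) \<longlonglongrightarrow> 0"
    and us: "(\<lambda>n. T_sq (\<lambda>x. poly_fun (us n) x - f2 x)) \<longlonglongrightarrow> 0"
    and curl: "(\<lambda>n. T_sq (\<lambda>x. poly_dbar1 (us n) x - poly_dbar2 (ts n) x)) \<longlonglongrightarrow> 0"
    by (rule polynomial_approximation [OF assms])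
  define s where "s n = solution (ts n) (us n)" for n
  note m = poly_T_measurable f1 f2
  have s_m: "s n \<in> borel_measurable (lebesgue_on T)" for n unfolding s_def by (rule solution_T_measurable)
  have diff: "T_sq (\<lambda>x. s i x - s j x)
      \<le> 24 * (T_sq (\<lambda>x. poly_fun (ts i) x - poly_fun (ts j) x) + T_sq (\<lambda>x. poly_fun (us i) x - poly_fun (us j) x))" for i j
  proof -
    have "poly_fun (vs @ neg_poly ws) = (\<lambda>x. poly_fun vs x - poly_fun ws x)" for vs ws
      by (simp add: fun_eq_iff ev2_append ev2_neg)
    moreover have "solution (ts i @ neg_poly (ts j)) (us i @ neg_poly (us j)) = (\<lambda>x. s i x - s j x)"
      by (simp add: fun_eq_iff s_def solution_diff)
    ultimately show ?thesis
      using T_sq_solution [of "ts i @ neg_poly (ts j)" "us i @ neg_poly (us j)"] by (simp only:)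
  qed
  have cauchy: "\<exists>N. \<forall>i\<ge>N. \<forall>j\<ge>N. (\<integral>\<^sup>+x. ennreal ((cmod (s i x - s j x))\<^sup>2) \<partial>lebesgue_on T) \<le> ennreal \<epsilon>" if "0 < \<epsilon>" for \<epsilon>
  proof -
    \<comment> \<open>\<open>192 = 24 * (4 + 4)\<close>: the bound of the solution operator times two triangle inequalities\<close>
    define e where "e = \<epsilon> / 192"
    have e: "e > 0" using that by (simp add: e_def)
    have "\<forall>\<^sub>F n in sequentially. T_sq (\<lambda>x. poly_fun (ts n) x - f1 x) \<le> ennreal e \<and> T_sq (\<lambda>x. poly_fun (us n) x - f2 x) \<le> ennreal e"
      using ts us e unfolding tendsto_ennreal_0_iff by (intro eventually_conj) blast+
    then obtain N where N: "\<And>n. n \<ge> N \<Longrightarrow> T_sq (\<lambda>x. poly_fun (ts n) x - f1 x) \<le> ennreal e"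
      "\<And>n. n \<ge> N \<Longrightarrow> T_sq (\<lambda>x. poly_fun (us n) x - f2 x) \<le> ennreal e"
      by (auto simp: eventually_sequentially)
    have "T_sq (\<lambda>x. s i x - s j x) \<le> ennreal \<epsilon>" if ij: "i \<ge> N" "j \<ge> N" for i j
    proof -
      have "T_sq (\<lambda>x. poly_fun (ts i) x - poly_fun (ts j) x) \<le> ennreal (2 * e + 2 * e)"
        using N(1) [OF ij(1)] N(1) [OF ij(2)] e
        by (intro T_sq_triangle [of _ f1] m) (auto simp: T_sq_commute [of f1])
      moreover have "T_sq (\<lambda>x. poly_fun (us i) x - poly_fun (us j) x) \<le> ennreal (2 * e + 2 * e)"
        using N(2) [OF ij(1)] N(2) [OF ij(2)] e
        by (intro T_sq_triangle [of _ f2] m) (auto simp: T_sq_commute [of f2])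
      ultimately have "T_sq (\<lambda>x. s i x - s j x) \<le> 24 * (ennreal (2 * e + 2 * e) + ennreal (2 * e + 2 * e))"
        by (intro order_trans [OF diff] mult_left_mono add_mono) auto
      also have "\<dots> = ennreal (24 * ((2 * e + 2 * e) + (2 * e + 2 * e)))"
      proof -
        have "24 * (ennreal a + ennreal b) = ennreal (24 * (a + b))" if "0 \<le> a" "0 \<le> b" for a b
          using that by (simp add: ennreal_mult ennreal_plus)
        moreover have "0 \<le> 2 * e + 2 * e" using e by simp
        ultimately show ?thesis by blast
      qed
      also have "24 * ((2 * e + 2 * e) + (2 * e + 2 * e)) = \<epsilon>" by (simp add: e_def)
      finally show ?thesis .
    qed
    then show ?thesis unfolding T_sq_def by blast
  qed
  have "\<exists>u \<in> borel_measurable (lebesgue_on T). \<forall>\<epsilon>>0. \<exists>N. \<forall>n\<ge>N.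
      (\<integral>\<^sup>+x. ennreal ((cmod (s n x - u x))\<^sup>2) \<partial>lebesgue_on T) \<le> ennreal \<epsilon>"
    by (rule L2_complete [OF s_m cauchy])
  then obtain u where u: "u \<in> borel_measurable (lebesgue_on T)"
    and u_lim: "\<And>\<epsilon>. 0 < \<epsilon> \<Longrightarrow> \<exists>N. \<forall>n\<ge>N. T_sq (\<lambda>x. s n x - u x) \<le> ennreal \<epsilon>"
    unfolding T_sq_def by blast
  have "dbar_closure u f1 f2"
    unfolding dbar_closure_def
  proof (intro allI impI)
    fix \<epsilon> :: real assume "0 < \<epsilon>"
    \<comment> \<open>The largest of the three errors below is \<open>22 * e\<close>.\<close>
    define e where "e = \<epsilon> / 32"
    have e: "0 < e" using \<open>0 < \<epsilon>\<close> by (simp add: e_def)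
    have "\<forall>\<^sub>F n in sequentially. T_sq (\<lambda>x. s n x - u x) \<le> ennreal e"
      using u_lim [OF e] by (simp add: eventually_sequentially)
    then have "\<forall>\<^sub>F n in sequentially. T_sq (\<lambda>x. s n x - u x) \<le> ennreal e
        \<and> T_sq (\<lambda>x. poly_fun (ts n) x - f1 x) \<le> ennreal e \<and> T_sq (\<lambda>x. poly_fun (us n) x - f2 x) \<le> ennreal e
        \<and> T_sq (\<lambda>x. poly_dbar1 (us n) x - poly_dbar2 (ts n) x) \<le> ennreal e"
      using ts us curl e unfolding tendsto_ennreal_0_iff by (intro eventually_conj) blast+
    then obtain n where n: "T_sq (\<lambda>x. s n x - u x) \<le> ennreal e"
      "T_sq (\<lambda>x. poly_fun (ts n) x - f1 x) \<le> ennreal e" "T_sq (\<lambda>x. poly_fun (us n) x - f2 x) \<le> ennreal e"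
      "T_sq (\<lambda>x. poly_dbar1 (us n) x - poly_dbar2 (ts n) x) \<le> ennreal e"
      by (auto simp: eventually_sequentially)
    obtain v where v: "smooth v" "T_sq (\<lambda>x. v x - s n x) \<le> ennreal e"
      "T_sq (\<lambda>x. wirtinger_bar 1 v x - poly_fun (ts n) x) \<le> ennreal e"
      "T_sq (\<lambda>x. wirtinger_bar 2 v x - (poly_fun (us n) x - solution_error (ts n) (us n) x)) \<le> ennreal e"
      using solution_in_closure [of "ts n" "us n"] e unfolding dbar_closure_def s_def by blast
    note m = borel_measurable_diff smooth_T_measurable [OF v(1)] smooth_wirtinger_T_measurable [OF v(1)]
      poly_T_measurable solution_error_T_measurable s_m u f1 f2
    have E: "T_sq (solution_error (ts n) (us n)) \<le> ennreal (4 * e)"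
    proof -
      have "T_sq (solution_error (ts n) (us n)) \<le> 4 * ennreal e"
        using n(4) by (intro order_trans [OF T_sq_solution_error] mult_left_mono) auto
      then show ?thesis using e by (simp add: ennreal_mult)
    qed
    have 0: "T_sq (\<lambda>x. v x - u x) \<le> ennreal (2 * e + 2 * e)"
      using v n e by (intro T_sq_triangle [of _ "s n"] m) auto
    have 1: "T_sq (\<lambda>x. wirtinger_bar 1 v x - f1 x) \<le> ennreal (2 * e + 2 * e)"
      using v n e by (intro T_sq_triangle [of _ "poly_fun (ts n)"] m) auto
    have "T_sq (\<lambda>x. (poly_fun (us n) x - solution_error (ts n) (us n) x) - f2 x) \<le> ennreal (2 * (4 * e) + 2 * e)"
    proof (rule T_sq_triangle [of _ "poly_fun (us n)"])
      show "T_sq (\<lambda>x. poly_fun (us n) x - solution_error (ts n) (us n) x - poly_fun (us n) x) \<le> ennreal (4 * e)"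
        using E by (simp add: T_sq_def)
    qed (use n e in \<open>auto intro: m\<close>)
    from T_sq_triangle [OF _ _ _ v(4) this]
    have 2: "T_sq (\<lambda>x. wirtinger_bar 2 v x - f2 x) \<le> ennreal (2 * e + 2 * (2 * (4 * e) + 2 * e))"
      using e by (simp add: m)
    have le: "ennreal (2 * e + 2 * e) \<le> ennreal \<epsilon>" "ennreal (2 * e + 2 * (2 * (4 * e) + 2 * e)) \<le> ennreal \<epsilon>"
      using e by (auto simp: e_def intro!: ennreal_leI)
    show "\<exists>v. smooth v \<and> T_sq (\<lambda>x. v x - u x) \<le> ennreal \<epsilon>
       \<and> T_sq (\<lambda>x. wirtinger_bar 1 v x - f1 x) \<le> ennreal \<epsilon> \<and> T_sq (\<lambda>x. wirtinger_bar 2 v x - f2 x) \<le> ennreal \<epsilon>"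
      by (intro exI [of _ v] conjI v(1) order_trans [OF 0] order_trans [OF 1] order_trans [OF 2] le)
  qed
  with u show ?thesis by blast
qed

section \<open>Forms and cohomology\<close>

lemma higher_differentiable_add:
  "higher_differentiable f n \<Longrightarrow> higher_differentiable g n \<Longrightarrow> higher_differentiable (\<lambda>x. f x + g x) n"
proof (induction n arbitrary: f g)
  case 0
  then show ?case by (simp add: continuous_on_add)
next
  case (Suc n)
  have f: "(f has_derivative frechet_derivative f (at x)) (at x)" for x
    using Suc.prems(1) by (simp add: frechet_derivative_works)
  have g: "(g has_derivative frechet_derivative g (at x)) (at x)" for x
    using Suc.prems(2) by (simp add: frechet_derivative_works)
  have "frechet_derivative (\<lambda>x. f x + g x) (at x)
      = (\<lambda>v. frechet_derivative f (at x) v + frechet_derivative g (at x) v)" for x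
    by (rule frechet_derivative_at [symmetric]) (rule has_derivative_add [OF f g])
  moreover have "(\<lambda>x. f x + g x) differentiable at x" for x
    using has_derivative_add [OF f g] differentiable_def by blast
  ultimately show ?case using Suc by simp
qed

lemma higher_differentiable_cmult:
  fixes f :: "'a::real_normed_vector \<Rightarrow> complex"
  shows "higher_differentiable f n \<Longrightarrow> higher_differentiable (\<lambda>x. c * f x) n"
proof (induction n arbitrary: f)
  case 0
  then show ?case by (simp add: continuous_on_mult_left)
next
  case (Suc n)
  have f: "(f has_derivative frechet_derivative f (at x)) (at x)" for x
    using Suc.prems by (simp add: frechet_derivative_works)
  have "frechet_derivative (\<lambda>x. c * f x) (at x) = (\<lambda>v. c * frechet_derivative f (at x) v)" for x
    by (rule frechet_derivative_at [symmetric]) (rule has_derivative_mult_right [OF f])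
  moreover have "(\<lambda>x. c * f x) differentiable at x" for x
    using has_derivative_mult_right [OF f] differentiable_def by blast
  ultimately show ?case using Suc by simp
qed

lemma smooth_add: "smooth f \<Longrightarrow> smooth g \<Longrightarrow> smooth (\<lambda>x. f x + g x)"
  unfolding smooth_def by (blast intro: higher_differentiable_add)

lemma smooth_cmult: "smooth f \<Longrightarrow> smooth (\<lambda>x. c * f x :: complex)"
  unfolding smooth_def by (blast intro: higher_differentiable_cmult)

lemma smooth_zero: "smooth (\<lambda>x::C2. 0 :: complex)"
  using smooth_poly_powr [of 1 "[]" 0] by simp

lemma smooth_diff:
  fixes f g :: "C2 \<Rightarrow> complex"
  shows "smooth f \<Longrightarrow> smooth g \<Longrightarrow> smooth (\<lambda>x. f x - g x)"
  using smooth_add [of f "\<lambda>x. (-1) * g x"] smooth_cmult [of g "-1"] by simp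

lemma wirtinger_bar_cmult:
  assumes "smooth f"
  shows "wirtinger_bar k (\<lambda>x. c * f x) x = c * wirtinger_bar k f x"
proof -
  have "frechet_derivative (\<lambda>x. c * f x) (at x) = (\<lambda>v. c * frechet_derivative f (at x) v)"
    by (rule frechet_derivative_at [symmetric])
       (rule has_derivative_mult_right [OF smooth_has_derivative [OF assms]])
  then show ?thesis by (simp add: wirtinger_bar_def algebra_simps)
qed

lemma wirtinger_bar_diff:
  assumes "smooth f" "smooth g"
  shows "wirtinger_bar k (\<lambda>x. f x - g x) x = wirtinger_bar k f x - wirtinger_bar k g x"
proof -
  have "frechet_derivative (\<lambda>x. f x - g x) (at x)
      = (\<lambda>v. frechet_derivative f (at x) v - frechet_derivative g (at x) v)"
    by (rule frechet_derivative_at [symmetric])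
       (rule has_derivative_diff [OF smooth_has_derivative [OF assms(1)] smooth_has_derivative [OF assms(2)]])
  then show ?thesis by (simp add: wirtinger_bar_def algebra_simps diff_divide_distrib)
qed

lemma wirtinger_bar_zero: "wirtinger_bar k (\<lambda>x. 0) x = 0"
  using wirtinger_bar_cmult [OF smooth_zero, of k 0 x] by simp

lemma T_sq_LINT:
  assumes f: "f \<in> borel_measurable (lebesgue_on T)" and fin: "T_sq f < \<infinity>"
  shows "integrable (lebesgue_on T) (\<lambda>x. (cmod (f x))\<^sup>2)"
    and "T_sq f = ennreal (LINT x|lebesgue_on T. (cmod (f x))\<^sup>2)"
proof -
  show i: "integrable (lebesgue_on T) (\<lambda>x. (cmod (f x))\<^sup>2)"
  proof (rule integrableI_bounded)
    show "(\<lambda>x. (cmod (f x))\<^sup>2) \<in> borel_measurable (lebesgue_on T)" using f by measurable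
    show "(\<integral>\<^sup>+x. ennreal (norm ((cmod (f x))\<^sup>2)) \<partial>lebesgue_on T) < \<infinity>"
      using fin by (simp add: T_sq_def)
  qed
  show "T_sq f = ennreal (LINT x|lebesgue_on T. (cmod (f x))\<^sup>2)"
    unfolding T_sq_def by (rule nn_integral_eq_integral [OF i]) simp
qed

definition L2 :: "(C2 \<Rightarrow> complex) \<Rightarrow> bool" where
  "L2 f \<longleftrightarrow> f \<in> borel_measurable (lebesgue_on T) \<and> T_sq f < \<infinity>"

lemma L2_iff: "L2 f \<longleftrightarrow> f \<in> borel_measurable (lebesgue_on T) \<and> integrable (lebesgue_on T) (\<lambda>x. (cmod (f x))\<^sup>2)"
proof
  assume "L2 f" then show "f \<in> borel_measurable (lebesgue_on T) \<and> integrable (lebesgue_on T) (\<lambda>x. (cmod (f x))\<^sup>2)"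
    unfolding L2_def using T_sq_LINT(1) by blast
next
  assume f: "f \<in> borel_measurable (lebesgue_on T) \<and> integrable (lebesgue_on T) (\<lambda>x. (cmod (f x))\<^sup>2)"
  then have "T_sq f = ennreal (LINT x|lebesgue_on T. (cmod (f x))\<^sup>2)"
    unfolding T_sq_def by (intro nn_integral_eq_integral) auto
  with f show "L2 f" by (simp add: L2_def)
qed

lemma L2_diff: "L2 f \<Longrightarrow> L2 g \<Longrightarrow> L2 (\<lambda>x. f x - g x)"
  unfolding L2_def
  by (auto intro!: le_less_trans [OF T_sq_diff] simp: ennreal_mult_less_top)

lemma L2_continuous: "continuous_on UNIV f \<Longrightarrow> L2 f"
  unfolding L2_def
  by (intro conjI T_sq_continuous_finite T_measurable_borel borel_measurable_continuous_onI)

lemma L2_zero: "L2 (\<lambda>x. 0)"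
  by (rule L2_continuous) (rule continuous_on_const)

lemma L2_forms_iff: "f \<in> L2_forms T p q \<longleftrightarrow> f \<in> forms p q \<and> (\<forall>I J. L2 (f I J))"
  by (simp add: L2_forms_def L2_iff)

lemma T_sq_tendsto_iff:
  assumes "\<And>n. L2 (h n)"
  shows "(\<lambda>n. T_sq (h n)) \<longlonglongrightarrow> 0 \<longleftrightarrow> (\<lambda>n. LINT x|lebesgue_on T. (cmod (h n x))\<^sup>2) \<longlonglongrightarrow> 0"
proof -
  have "T_sq (h n) = ennreal (LINT x|lebesgue_on T. (cmod (h n x))\<^sup>2)" for n
    using assms [of n] T_sq_LINT(2) unfolding L2_def by blast
  then have "(\<lambda>n. T_sq (h n)) \<longlonglongrightarrow> 0 \<longleftrightarrow>
      (\<lambda>n. ennreal (LINT x|lebesgue_on T. (cmod (h n x))\<^sup>2)) \<longlonglongrightarrow> ennreal 0" by simp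
  also have "\<dots> \<longleftrightarrow> (\<lambda>n. LINT x|lebesgue_on T. (cmod (h n x))\<^sup>2) \<longlonglongrightarrow> 0"
    by (rule tendsto_ennreal_iff) (auto intro!: always_eventually)
  finally show ?thesis .
qed

lemma L2_norm_tendsto_iff:
  assumes L2: "\<And>n I J. L2 (G n I J)"
  shows "(\<lambda>n. L2_norm T (G n)) \<longlonglongrightarrow> 0 \<longleftrightarrow> (\<forall>I\<in>Pow {1, 2}. \<forall>J\<in>Pow {1, 2}. (\<lambda>n. T_sq (G n I J)) \<longlonglongrightarrow> 0)"
proof -
  define h where "h I J n = (LINT x|lebesgue_on T. (cmod (G n I J x))\<^sup>2)" for I J n
  have h0: "0 \<le> h I J n" for I J n by (simp add: h_def)
  have iff: "(\<lambda>n. T_sq (G n I J)) \<longlonglongrightarrow> 0 \<longleftrightarrow> h I J \<longlonglongrightarrow> 0" for I J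
    using T_sq_tendsto_iff [OF L2] by (simp add: h_def [abs_def])
  have norm: "L2_norm T (G n) = sqrt (\<Sum>I\<in>Pow {1, 2}. \<Sum>J\<in>Pow {1, 2}. h I J n)" for n
    by (simp only: L2_norm_def h_def)
  show ?thesis
  proof
    assume lim: "(\<lambda>n. L2_norm T (G n)) \<longlonglongrightarrow> 0"
    have "(\<lambda>n. (L2_norm T (G n))\<^sup>2) \<longlonglongrightarrow> 0\<^sup>2" by (intro tendsto_power lim)
    then have sq: "(\<lambda>n. (L2_norm T (G n))\<^sup>2) \<longlonglongrightarrow> 0" by simp
    show "\<forall>I\<in>Pow {1, 2}. \<forall>J\<in>Pow {1, 2}. (\<lambda>n. T_sq (G n I J)) \<longlonglongrightarrow> 0"
    proof (intro ballI)
      fix I J :: "nat set" assume IJ: "I \<in> Pow {1, 2}" "J \<in> Pow {1, 2}"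
      have "h I J n \<le> (L2_norm T (G n))\<^sup>2" for n
      proof -
        have "h I J n \<le> (\<Sum>J\<in>Pow {1, 2}. h I J n)"
          by (rule member_le_sum [OF IJ(2)]) (auto simp: h0)
        also have "\<dots> \<le> (\<Sum>I\<in>Pow {1, 2}. \<Sum>J\<in>Pow {1, 2}. h I J n)"
          by (rule member_le_sum [OF IJ(1), of "\<lambda>I. \<Sum>J\<in>Pow {1, 2}. h I J n"]) (auto intro!: sum_nonneg h0)
        also have "\<dots> = (L2_norm T (G n))\<^sup>2"
          unfolding norm by (intro real_sqrt_pow2 [symmetric] sum_nonneg h0)
        finally show ?thesis .
      qed
      then have "h I J \<longlonglongrightarrow> 0"
        by (intro tendsto_sandwich [OF _ _ tendsto_const sq]) (auto simp: h0)
      then show "(\<lambda>n. T_sq (G n I J)) \<longlonglongrightarrow> 0" by (simp add: iff)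
    qed
  next
    assume "\<forall>I\<in>Pow {1, 2}. \<forall>J\<in>Pow {1, 2}. (\<lambda>n. T_sq (G n I J)) \<longlonglongrightarrow> 0"
    then have "\<forall>I\<in>Pow {1, 2}. \<forall>J\<in>Pow {1, 2}. h I J \<longlonglongrightarrow> 0" by (simp only: iff)
    then have "(\<lambda>n. sqrt (\<Sum>I\<in>Pow {1, 2}. \<Sum>J\<in>Pow {1, 2}. h I J n)) \<longlonglongrightarrow> sqrt (\<Sum>I\<in>Pow {1, 2::nat}. \<Sum>J\<in>Pow {1, 2::nat}. 0)"
      by (intro tendsto_real_sqrt tendsto_sum) auto
    then show "(\<lambda>n. L2_norm T (G n)) \<longlonglongrightarrow> 0" by (simp add: norm)
  qed
qed

lemma smooth_form_components:
  assumes "F \<in> smooth_forms p q"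
  shows "smooth (F I J)" and "F \<in> forms p q"
  using assms by (auto simp: smooth_forms_def)

lemma L2_smooth: "smooth f \<Longrightarrow> L2 f"
  by (intro L2_continuous smooth_continuous)

lemma L2_dbar:
  assumes "F \<in> smooth_forms p q"
  shows "L2 (dbar F I J)"
proof (rule L2_continuous)
  have "continuous_on UNIV (\<lambda>x. dbar F I J x)"
    unfolding dbar_def
    by (intro continuous_on_sum continuous_on_mult_left smooth_continuous_wirtinger smooth_form_components [OF assms])
  then show "continuous_on UNIV (dbar F I J)" by simp
qed

lemma dbar_single:
  assumes "k = 1 \<or> k = 2"
  shows "dbar F I {k} x = (-1) ^ card I * wirtinger_bar k (F I {}) x"
proof -
  have domain: "{k} \<inter> {1, 2} = {k}" using assms by auto
  have sign: "{j \<in> {k}. j < k} = {}" by auto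
  have sum: "(\<Sum>k'\<in>{k}. g k') = g k" for g :: "nat \<Rightarrow> complex" by simp
  show ?thesis unfolding dbar_def domain sum sign by simp
qed

lemma dbar_pair:
  "dbar F I {1, 2} x = (-1) ^ card I * (wirtinger_bar 1 (F I {2}) x - wirtinger_bar 2 (F I {1}) x)"
proof -
  have sign: "{j \<in> {1, 2}. j < 1} = ({} :: nat set)" "{j \<in> {1, 2}. j < 2} = {1::nat}" by auto
  have rest: "{1, 2} - {1} = {2::nat}" "{1, 2} - {2} = {1::nat}" by auto
  have sum: "(\<Sum>k\<in>{1, 2}. g k) = g 1 + g 2" for g :: "nat \<Rightarrow> complex" by simp
  show ?thesis
    unfolding dbar_def Int_absorb sum sign rest by (simp add: right_diff_distrib)
qed

lemma multi_indices_1: "multi_indices 1 = {{1}, {2}}"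
proof (intro set_eqI iffI)
  fix J assume "J \<in> multi_indices 1"
  then have J: "J \<subseteq> {1, 2}" and "card J = 1" by (auto simp: multi_indices_def)
  then obtain j where "J = {j}" using card_1_singletonE by blast
  then show "J \<in> {{1}, {2}}" using J by auto
next
  fix J :: "nat set" assume "J \<in> {{1}, {2}}"
  then consider "J = {1}" | "J = {2}" by blast
  then show "J \<in> multi_indices 1" by cases (simp_all add: multi_indices_def)
qed

lemma multi_indices_0: "multi_indices 0 = {{}}"
  unfolding multi_indices_def by (auto dest: finite_subset)

text \<open>
The relation \<open>dbar_s\<close> is defined by approximating sequences, so its linearity has to be derived from that of \<open>dbar\<close> on
smooth forms.
\<close>

lemma kernel_diff:
  assumes "f \<in> dbar_s_kernel T p q" "g \<in> dbar_s_kernel T p q"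
  shows "f - g \<in> dbar_s_kernel T p q"
proof -
  obtain F where F: "f \<in> L2_forms T p q" "\<And>n. F n \<in> smooth_forms p q"
    "(\<lambda>n. L2_norm T (F n - f)) \<longlonglongrightarrow> 0" "(\<lambda>n. L2_norm T (dbar (F n) - zero_form)) \<longlonglongrightarrow> 0"
    and z: "zero_form \<in> L2_forms T p (q + 1)"
    using assms(1) unfolding dbar_s_kernel_def dbar_s_def by blast
  obtain G where G: "g \<in> L2_forms T p q" "\<And>n. G n \<in> smooth_forms p q"
    "(\<lambda>n. L2_norm T (G n - g)) \<longlonglongrightarrow> 0" "(\<lambda>n. L2_norm T (dbar (G n) - zero_form)) \<longlonglongrightarrow> 0"
    using assms(2) unfolding dbar_s_kernel_def dbar_s_def by blast
  have fL: "L2 (f I J)" and gL: "L2 (g I J)" for I J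
    using F(1) G(1) by (auto simp: L2_forms_iff)
  have H: "F n - G n \<in> smooth_forms p q" for n
    using F(2) [of n] G(2) [of n] smooth_diff
    by (auto simp: smooth_forms_def forms_def fun_diff_def)
  have d: "f - g \<in> L2_forms T p q"
    using F(1) G(1) fL gL L2_diff by (auto simp: L2_forms_iff forms_def fun_diff_def)
  have lim: "(\<lambda>n. T_sq (\<lambda>x. a n x - b n x)) \<longlonglongrightarrow> 0"
    if "\<And>n. L2 (a n)" "\<And>n. L2 (b n)" "(\<lambda>n. T_sq (a n)) \<longlonglongrightarrow> 0" "(\<lambda>n. T_sq (b n)) \<longlonglongrightarrow> 0" for a b
  proof (rule tendsto_sandwich [OF _ _ tendsto_const])
    show "\<forall>\<^sub>F n in sequentially. T_sq (\<lambda>x. a n x - b n x) \<le> 2 * T_sq (a n) + 2 * T_sq (b n)"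
      using that(1,2) by (intro always_eventually allI T_sq_diff) (auto simp: L2_def)
    have "(\<lambda>n. 2 * T_sq (a n) + 2 * T_sq (b n)) \<longlonglongrightarrow> 2 * 0 + 2 * 0"
      using that(3,4) by (intro tendsto_add ennreal_tendsto_cmult) auto
    then show "(\<lambda>n. 2 * T_sq (a n) + 2 * T_sq (b n)) \<longlonglongrightarrow> 0" by simp
  qed auto
  have L: "L2 ((F n - f) I J)" "L2 ((G n - g) I J)" "L2 ((F n - G n - (f - g)) I J)"
    "L2 ((dbar (F n) - zero_form) I J)" "L2 ((dbar (G n) - zero_form) I J)"
    "L2 ((dbar (F n - G n) - zero_form) I J)" for n I J
    using L2_diff [OF L2_smooth [OF smooth_form_components(1) [OF F(2)]] fL]
      L2_diff [OF L2_smooth [OF smooth_form_components(1) [OF G(2)]] gL]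
      L2_diff [OF L2_smooth [OF smooth_form_components(1) [OF H]] L2_diff [OF fL gL]]
      L2_dbar [OF F(2)] L2_dbar [OF G(2)] L2_dbar [OF H]
    by (simp_all add: fun_diff_def zero_form_def)
  have 1: "(\<lambda>n. L2_norm T (F n - G n - (f - g))) \<longlonglongrightarrow> 0"
    unfolding L2_norm_tendsto_iff [of "\<lambda>n. F n - G n - (f - g)", OF L(3)]
  proof (intro ballI)
    fix I J :: "nat set" assume IJ: "I \<in> Pow {1, 2}" "J \<in> Pow {1, 2}"
    have "(F n - G n - (f - g)) I J = (\<lambda>x. (F n - f) I J x - (G n - g) I J x)" for n
      by (simp add: fun_eq_iff)
    then show "(\<lambda>n. T_sq ((F n - G n - (f - g)) I J)) \<longlonglongrightarrow> 0"
      using lim [of "\<lambda>n. (F n - f) I J" "\<lambda>n. (G n - g) I J", OF L(1,2)] IJ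
        L2_norm_tendsto_iff [of "\<lambda>n. F n - f", OF L(1)] L2_norm_tendsto_iff [of "\<lambda>n. G n - g", OF L(2)] F(3) G(3)
      by simp
  qed
  have 2: "(\<lambda>n. L2_norm T (dbar (F n - G n) - zero_form)) \<longlonglongrightarrow> 0"
    unfolding L2_norm_tendsto_iff [of "\<lambda>n. dbar (F n - G n) - zero_form", OF L(6)]
  proof (intro ballI)
    fix I J :: "nat set" assume IJ: "I \<in> Pow {1, 2}" "J \<in> Pow {1, 2}"
    have "(dbar (F n - G n) - zero_form) I J = (\<lambda>x. (dbar (F n) - zero_form) I J x - (dbar (G n) - zero_form) I J x)" for n
    proof
      fix x
      have "wirtinger_bar k ((F n - G n) I K) x = wirtinger_bar k (F n I K) x - wirtinger_bar k (G n I K) x" for k K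
        using wirtinger_bar_diff [OF smooth_form_components(1) [OF F(2)] smooth_form_components(1) [OF G(2)]]
        by (simp add: fun_diff_def)
      then show "(dbar (F n - G n) - zero_form) I J x = (dbar (F n) - zero_form) I J x - (dbar (G n) - zero_form) I J x"
        by (simp add: dbar_def zero_form_def right_diff_distrib sum_subtractf)
    qed
    then show "(\<lambda>n. T_sq ((dbar (F n - G n) - zero_form) I J)) \<longlonglongrightarrow> 0"
      using lim [of "\<lambda>n. (dbar (F n) - zero_form) I J" "\<lambda>n. (dbar (G n) - zero_form) I J", OF L(4,5)] IJ
        L2_norm_tendsto_iff [of "\<lambda>n. dbar (F n) - zero_form", OF L(4)]
        L2_norm_tendsto_iff [of "\<lambda>n. dbar (G n) - zero_form", OF L(5)] F(4) G(4)
      by simp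
  qed
  have "dbar_s T p q (f - g) zero_form"
    unfolding dbar_s_def using d z H 1 2 by (intro conjI exI [of _ "\<lambda>n. F n - G n"] allI)
  with d show ?thesis by (simp add: dbar_s_kernel_def)
qed

text \<open>
The components of \<open>dbar u\<close> for a \<open>(p, 0)\<close>-form \<open>u\<close> carry the sign \<open>(-1)\<^bsup>|I|\<^esup>\<close>, which is compensated by
the same sign in \<open>u\<close>.
\<close>

lemma kernel_subset_range: "dbar_s_kernel T p 1 \<subseteq> dbar_s_range T p 1"
proof
  fix f assume f: "f \<in> dbar_s_kernel T p 1"
  obtain F where fL: "f \<in> L2_forms T p 1" and F: "\<And>n. F n \<in> smooth_forms p 1"
    and F1: "(\<lambda>n. L2_norm T (F n - f)) \<longlonglongrightarrow> 0" and F2: "(\<lambda>n. L2_norm T (dbar (F n) - zero_form)) \<longlonglongrightarrow> 0"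
    using f unfolding dbar_s_kernel_def dbar_s_def by blast
  have fc: "L2 (f I J)" for I J using fL by (simp add: L2_forms_iff)
  have Fs: "smooth (F n I J)" for n I J by (rule smooth_form_components(1) [OF F])
  have comp: "(\<lambda>n. T_sq (\<lambda>x. F n I J x - f I J x)) \<longlonglongrightarrow> 0" if "I \<subseteq> {1, 2}" "J \<subseteq> {1, 2}" for I J
  proof -
    have "L2 ((F n - f) I J)" for n I J
      using L2_diff [OF L2_smooth [OF Fs] fc] by (simp add: fun_diff_def)
    from L2_norm_tendsto_iff [of "\<lambda>n. F n - f", OF this] F1 that
    have "(\<lambda>n. T_sq ((F n - f) I J)) \<longlonglongrightarrow> 0" by blast
    then show ?thesis by (simp add: fun_diff_def)
  qed
  have curl: "(\<lambda>n. T_sq (\<lambda>x. wirtinger_bar 1 (F n I {2}) x - wirtinger_bar 2 (F n I {1}) x)) \<longlonglongrightarrow> 0"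
    if I: "I \<subseteq> {1, 2}" for I
  proof -
    have "L2 ((dbar (F n) - zero_form) I J)" for n I J
      using L2_dbar [OF F] by (simp add: fun_diff_def zero_form_def)
    from L2_norm_tendsto_iff [of "\<lambda>n. dbar (F n) - zero_form", OF this] F2 I
    have "(\<lambda>n. T_sq ((dbar (F n) - zero_form) I {1, 2})) \<longlonglongrightarrow> 0" by blast
    moreover have "T_sq ((dbar (F n) - zero_form) I {1, 2})
        = T_sq (\<lambda>x. wirtinger_bar 1 (F n I {2}) x - wirtinger_bar 2 (F n I {1}) x)" for n
    proof -
      have "(dbar (F n) - zero_form) I {1, 2} x = (-1) ^ card I * (wirtinger_bar 1 (F n I {2}) x - wirtinger_bar 2 (F n I {1}) x)" for x
        using dbar_pair [of "F n" I x] by (simp add: zero_form_def)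
      then show ?thesis by (simp add: T_sq_def norm_mult norm_power)
    qed
    ultimately show ?thesis by simp
  qed
  have "\<exists>u. u \<in> borel_measurable (lebesgue_on T) \<and> dbar_closure u (f I {1}) (f I {2})" if I: "I \<subseteq> {1, 2}" for I
  proof -
    have "\<exists>u \<in> borel_measurable (lebesgue_on T). dbar_closure u (f I {1}) (f I {2})"
      using fc [unfolded L2_def]
      by (intro scalar_dbar_problem [of _ _ "\<lambda>n. F n I {1}" "\<lambda>n. F n I {2}"] comp curl Fs I) auto
    then show ?thesis by blast
  qed
  then have "\<forall>I. \<exists>u. I \<subseteq> {1, 2} \<longrightarrow> u \<in> borel_measurable (lebesgue_on T) \<and> dbar_closure u (f I {1}) (f I {2})"
    by blast
  from choice [OF this] obtain w where w: "\<And>I. I \<subseteq> {1, 2} \<Longrightarrow> w I \<in> borel_measurable (lebesgue_on T)"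
    "\<And>I. I \<subseteq> {1, 2} \<Longrightarrow> dbar_closure (w I) (f I {1}) (f I {2})"
    by blast
  define close where "close I n v \<longleftrightarrow> smooth v \<and> T_sq (\<lambda>x. v x - w I x) \<le> ennreal (1 / real (Suc n))
     \<and> T_sq (\<lambda>x. wirtinger_bar 1 v x - f I {1} x) \<le> ennreal (1 / real (Suc n))
     \<and> T_sq (\<lambda>x. wirtinger_bar 2 v x - f I {2} x) \<le> ennreal (1 / real (Suc n))" for I n v
  have "\<forall>n. \<exists>v. I \<subseteq> {1, 2} \<longrightarrow> close I n v" for I
  proof
    fix n
    have "0 < 1 / real (Suc n)" by simp
    then show "\<exists>v. I \<subseteq> {1, 2} \<longrightarrow> close I n v"
      using w(2) [of I] unfolding dbar_closure_def close_def by blast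
  qed
  from choice [OF this] have "\<exists>v. \<forall>n. I \<subseteq> {1, 2} \<longrightarrow> close I n (v n)" for I .
  then have "\<forall>I. \<exists>v. \<forall>n. I \<subseteq> {1, 2} \<longrightarrow> close I n (v n)" ..
  from choice [OF this] obtain v where v: "\<And>I n. I \<subseteq> {1, 2} \<Longrightarrow> close I n (v I n)"
    by blast
  have v_smooth: "smooth (v I n)" if "I \<subseteq> {1, 2}" for I n using v [OF that] by (simp add: close_def)
  have to_0: "a \<longlonglongrightarrow> 0" if "\<And>n. a n \<le> ennreal (1 / real (Suc n))" for a :: "nat \<Rightarrow> ennreal"
  proof (rule tendsto_sandwich [OF _ _ tendsto_const])
    show "\<forall>\<^sub>F n in sequentially. a n \<le> ennreal (1 / real (Suc n))" using that by (intro always_eventually allI)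
    have "(\<lambda>n. ennreal (1 / real (Suc n))) \<longlonglongrightarrow> ennreal 0"
      using LIMSEQ_inverse_real_of_nat by (intro tendsto_ennrealI) (simp add: inverse_eq_divide)
    then show "(\<lambda>n. ennreal (1 / real (Suc n))) \<longlonglongrightarrow> 0" by simp
  qed auto
  have wL: "L2 (w I)" if I: "I \<subseteq> {1, 2}" for I
  proof -
    have "L2 (\<lambda>x. v I 0 x - w I x)"
      unfolding L2_def
    proof
      show "(\<lambda>x. v I 0 x - w I x) \<in> borel_measurable (lebesgue_on T)"
        by (intro borel_measurable_diff smooth_T_measurable v_smooth w I)
      have "T_sq (\<lambda>x. v I 0 x - w I x) \<le> ennreal (1 / real (Suc 0))"
        using v [OF I, of 0] unfolding close_def by blast
      then show "T_sq (\<lambda>x. v I 0 x - w I x) < \<infinity>" by (rule le_less_trans) simp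
    qed
    from L2_diff [OF L2_smooth [OF v_smooth [OF I, of 0]] this] show ?thesis by simp
  qed
  define s :: "nat set \<Rightarrow> complex" where "s I = (-1) ^ card I" for I
  have s2: "s I * (s I * z) = z" for I z
    by (simp add: s_def mult.assoc [symmetric] power_add [symmetric] flip: mult_2)
  have s1: "cmod (s I) = 1" for I by (simp add: s_def norm_power)
  define u :: form where "u I J = (if I \<in> multi_indices p \<and> J = {} then (\<lambda>x. s I * w I x) else (\<lambda>x. 0))" for I J
  define V :: "nat \<Rightarrow> form" where
    "V n I J = (if I \<in> multi_indices p \<and> J = {} then (\<lambda>x. s I * v I n x) else (\<lambda>x. 0))" for n I J
  have mi: "I \<subseteq> {1, 2}" if "I \<in> multi_indices p" for I using that by (simp add: multi_indices_def)
  have T_s: "T_sq (\<lambda>x. s I * h x) = T_sq h" for I h by (simp add: T_sq_def norm_mult s1)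
  have uL: "L2 (u I J)" for I J
  proof (cases "I \<in> multi_indices p \<and> J = {}")
    case True
    have "L2 (w I)" using True by (intro wL mi) simp
    then have "L2 (\<lambda>x. s I * w I x)"
      unfolding L2_def T_s by (intro conjI borel_measurable_times borel_measurable_const) simp_all
    moreover have "u I J = (\<lambda>x. s I * w I x)" using True by (simp add: u_def)
    ultimately show ?thesis by simp
  next
    case False
    then have "u I J = (\<lambda>x. 0)" by (auto simp: u_def fun_eq_iff)
    then show ?thesis using L2_zero by simp
  qed
  have u_form: "u \<in> L2_forms T p 0"
    using uL by (auto simp: L2_forms_iff forms_def u_def multi_indices_0)
  have V_smooth: "smooth (V n I J)" for n I J
    using smooth_cmult [OF v_smooth [OF mi], of I] smooth_zero by (simp add: V_def)
  have V_form: "V n \<in> smooth_forms p 0" for n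
    using V_smooth by (auto simp: smooth_forms_def forms_def V_def multi_indices_0)
  have 1: "(\<lambda>n. L2_norm T (V n - u)) \<longlonglongrightarrow> 0"
  proof -
    have L: "L2 ((V n - u) I J)" for n I J
      using L2_diff [OF L2_smooth [OF V_smooth] uL] by (simp add: fun_diff_def)
    show ?thesis
      unfolding L2_norm_tendsto_iff [of "\<lambda>n. V n - u", OF L]
    proof (intro ballI to_0)
      fix I J :: "nat set" and n assume IJ: "I \<in> Pow {1, 2}" "J \<in> Pow {1, 2}"
      show "T_sq ((V n - u) I J) \<le> ennreal (1 / real (Suc n))"
      proof (cases "I \<in> multi_indices p \<and> J = {}")
        case True
        then have "(V n - u) I J = (\<lambda>x. s I * (v I n x - w I x))"
          by (simp add: V_def u_def fun_eq_iff right_diff_distrib)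
        then show ?thesis using v [of I n] IJ by (simp add: T_s close_def)
      next
        case False
        then have "(V n - u) I J = (\<lambda>x. 0)" by (auto simp: V_def u_def fun_eq_iff)
        then show ?thesis by (simp add: T_sq_def)
      qed
    qed
  qed
  have 2: "(\<lambda>n. L2_norm T (dbar (V n) - f)) \<longlonglongrightarrow> 0"
  proof -
    have L: "L2 ((dbar (V n) - f) I J)" for n I J
      using L2_diff [OF L2_dbar [OF V_form] fc] by (simp add: fun_diff_def)
    have fz: "f I J = (\<lambda>x. 0)" if "\<not> (I \<in> multi_indices p \<and> J \<in> {{1}, {2}})" for I J
      using fL that by (simp add: L2_forms_iff forms_def multi_indices_1)
    show ?thesis
      unfolding L2_norm_tendsto_iff [of "\<lambda>n. dbar (V n) - f", OF L]
    proof (intro ballI to_0)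
      fix I J :: "nat set" and n assume IJ: "I \<in> Pow {1, 2}" "J \<in> Pow {1, 2}"
      show "T_sq ((dbar (V n) - f) I J) \<le> ennreal (1 / real (Suc n))"
      proof (cases "I \<in> multi_indices p \<and> (J = {1} \<or> J = {2})")
        case True
        then obtain k where k: "k = 1 \<or> k = 2" "J = {k}" by blast
        have "(dbar (V n) - f) I J x = wirtinger_bar k (v I n) x - f I {k} x" for x
        proof -
          have "dbar (V n) I {k} x = s I * wirtinger_bar k (\<lambda>x. s I * v I n x) x"
            using dbar_single [OF k(1)] True by (simp add: V_def s_def)
          also have "\<dots> = wirtinger_bar k (v I n) x"
            using wirtinger_bar_cmult [OF v_smooth [OF mi], of I k "s I" n x] True by (simp add: s2)
          finally show ?thesis by (simp add: k(2))
        qed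
        then have "T_sq ((dbar (V n) - f) I J) = T_sq (\<lambda>x. wirtinger_bar k (v I n) x - f I {k} x)"
          by (intro T_sq_cong)
        then show ?thesis using v [of I n] IJ k(1) by (auto simp: close_def)
      next
        case False
        have "dbar (V n) I J x = 0" for x
        proof -
          have "V n I (J - {k}) = (\<lambda>x. 0)" if "k \<in> J \<inter> {1, 2}" for k
          proof (rule ccontr)
            assume "V n I (J - {k}) \<noteq> (\<lambda>x. 0)"
            then have "I \<in> multi_indices p" "J - {k} = {}" by (auto simp: V_def split: if_splits)
            then have "J = {k}" using that by auto
            then show False using False that \<open>I \<in> multi_indices p\<close> by auto
          qed
          then show ?thesis by (simp add: dbar_def wirtinger_bar_zero)
        qed
        moreover have "f I J = (\<lambda>x. 0)" using False by (intro fz) auto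
        ultimately have "(dbar (V n) - f) I J = (\<lambda>x. 0)" by (simp add: fun_eq_iff)
        then show ?thesis by (simp add: T_sq_def)
      qed
    qed
  qed
  have "dbar_s T p 0 u f"
    unfolding dbar_s_def using u_form fL V_form 1 2 by auto
  then show "f \<in> dbar_s_range T p 1"
    using u_form fL by (auto simp: dbar_s_range_def)
qed

lemma zero_in_kernel: "zero_form \<in> dbar_s_kernel T p q"
proof -
  have z: "zero_form \<in> L2_forms T p r" for r
    using L2_zero by (simp add: L2_forms_iff forms_def zero_form_def)
  have "zero_form \<in> smooth_forms p q"
    using smooth_zero by (simp add: smooth_forms_def forms_def zero_form_def)
  moreover have "dbar zero_form = zero_form"
    by (simp add: fun_eq_iff dbar_def zero_form_def wirtinger_bar_zero)
  moreover have "L2_norm T (zero_form - zero_form) = 0"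
    by (simp add: L2_norm_def)
  ultimately have "dbar_s T p q zero_form zero_form"
    unfolding dbar_s_def using z by (intro conjI exI [of _ "\<lambda>n. zero_form"]) simp_all
  with z show ?thesis by (simp add: dbar_s_kernel_def)
qed

text \<open>
All cocycles are cohomologous to each other, so the only class is the kernel itself.
\<close>

theorem proposition3p12:
  fixes p :: int
  assumes "0 \<le> p" and "p \<le> 2"
  shows "L2_cohomology hartogs_triangle p 1 = {null_class hartogs_triangle p 1}"
proof -
  let ?K = "dbar_s_kernel T p 1"
  have "f - g \<in> dbar_s_range T p 1" if "f \<in> ?K" "g \<in> ?K" for f g
    by (rule subsetD [OF kernel_subset_range kernel_diff [OF that]])
  then have image: "cohomologous T p 1 `` {f} = ?K" if "f \<in> ?K" for f
    using that by (auto simp: cohomologous_def)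
  have null: "null_class T p 1 = ?K"
    unfolding null_class_def by (rule image [OF zero_in_kernel])
  have "L2_cohomology T p 1 = (\<Union>f\<in>?K. {?K})"
    unfolding L2_cohomology_def quotient_def using image by auto
  also have "\<dots> = {?K}" using zero_in_kernel [of p 1] by blast
  finally show ?thesis unfolding null .
qed

end
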